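(* Let $A=(A_{i,j})_{i,j\in\mathbb Z}$ be a complex matrix such that for every $i\in\mathbb Z$, $A_{i,j}=0$ for $j\ll0$. For any $\lambda\in\mathbb Z^l$ let $$\tilde s_\lambda=\tilde\Gamma_{-\lambda_1}\cdots\tilde\Gamma_{-\lambda_l}(1)=\sum_{\alpha\in\mathbb Z^l}A_{-\lambda_1,-\alpha_1}\cdots A_{-\lambda_l,-\alpha_l}\,s_\alpha\in\Lambda,\qquad\tilde\Gamma_i=\sum_{j\in\mathbb Z}A_{i,j}\Gamma_j,$$ where $\Gamma(u)=\sum_{j\in\mathbb Z}\Gamma_ju^{-j}=H(u)E^\perp(-u)$. a) $\tilde s_\lambda$ is a polynomial tau-function of the KP hierarchy. Any polynomial tau-function of the KP hierarchy is of the form $\tilde s_\lambda$ for an appropriate choice of the matrix $A$ (and of $l$ and $\lambda\in\mathbb Z^l$). b) If $A$ is invertible and $g_k(u)=\sum_{r\in\mathbb Z}(A^{-1})_{-r,-k}u^r$, then any coefficient $\tilde s_\lambda$ of the re-expansion of the generating function of Schur symmetric functions $$\mathcal S(u_1,\dots,u_l)=\sum_{\lambda\in\mathbb Z^l}\tilde s_\lambda\,g_{\lambda_1}(u_1)\cdots g_{\lambda_l}(u_l)$$ is a polynomial tau-function of the KP hierarchy.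
   Context: $\Lambda=\mathbb C[p_1,p_2,\dots]$ is the ring of symmetric functions; $h_k,e_k$ are the complete and elementary symmetric functions ($h_k=0$ for $k<0$); $f^\perp$ is the adjoint of multiplication by $f$ for the scalar product in which Schur functions are orthonormal ($p_n^\perp=n\,\partial/\partial p_n$). $H(u)=\sum_{k\ge0}h_ku^k$, $E(u)=\sum_{k\ge0}e_ku^k$, $H^\perp(u)=\sum_{k\ge0}h_k^\perp u^{-k}$, $E^\perp(u)=\sum_{k\ge0}e_k^\perp u^{-k}$. For $\alpha\in\mathbb Z^l$, $s_\alpha=\det[h_{\alpha_i-i+j}]_{1\le i,j\le l}$, and $$\mathcal S(u_1,\dots,u_l)=\prod_{1\le i<j\le l}\Big(1-\frac{u_j}{u_i}\Big)\prod_{i=1}^lH(u_i)=\sum_{\alpha\in\mathbb Z^l}s_\alpha u_1^{\alpha_1}\cdots u_l^{\alpha_l}=\Gamma(u_1)\cdots\Gamma(u_l)(1).$$ The sum defining $\tilde s_\lambda$ has finitely many non-zero terms. KP hierarchy: on $\mathcal B=\mathbb C[z,z^{-1}]\otimes\Lambda$ define $\psi^\pm(u)=\sum_{i\in\mathbb Z+1/2}\psi_i^\pm u^{-i-1/2}$ by $\psi^+(u)(z^mf)=z^{m+1}u^mH(u)E^\perp(-u)(f)$, $\psi^-(u)(z^mf)=z^{m-1}u^{-m}E(-u)H^\perp(u)(f)$, and $\Omega=\sum_{k\in\mathbb Z+1/2}\psi^+_k\otimes\psi^-_{-k}$. A polynomial tau-function of the KP hierarchy is a non-zero solution $\tau=z^m\tau(p_1,p_2,\dots)\in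 z^m\Lambda$ of the bilinear KP identity $\Omega(\tau\otimes\tau)=0$. The factor $z^m$ is suppressed: an element of $\Lambda$ is called a tau-function if its product with $z^m$ is. $B=(B_{i,j})_{i,j\in\mathbb Z}$ is the (left) inverse of $A$, written $B=A^{-1}$, if $\sum_{k\in\mathbb Z}B_{i,k}A_{k,j}=\delta_{i,j}$; $A$ is invertible if it has such an inverse.
   Formalization: In a) and b), the claim that s̃_λ is a polynomial tau-function is made only for non-zero s̃_λ, since tau-functions are non-zero by definition while s̃_λ can vanish (A = 0, or A the identity and λ = (0,1)). *)

theory Defs
  imports
    "HOL-Library.Poly_Mapping"
    "HOL-Library.Product_Plus"
    "HOL-Computational_Algebra.Formal_Power_Series"
    "HOL-Analysis.Infinite_Sum"
    "Jordan_Normal_Form.Determinant"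
begin

section \<open>The ring of symmetric functions\<close>

text \<open>
  \<open>\<Lambda> = \<complex>[p\<^sub>1, p\<^sub>2, \<dots>]\<close>. The variable with index \<open>n\<close> in an exponent vector stands
  for \<open>p\<^bsub>n+1\<^esub>\<close>.
\<close>

type_synonym monom = "nat \<Rightarrow>\<^sub>0 nat"
type_synonym sym = "monom \<Rightarrow>\<^sub>0 complex"

text \<open>Only meaningful for \<open>n \<ge> 1\<close>.\<close>

definition p_sym :: "nat \<Rightarrow> sym" where
  "p_sym n = Poly_Mapping.single (Poly_Mapping.single (n - 1) 1) 1"

definition scale :: "complex \<Rightarrow> ('a \<Rightarrow>\<^sub>0 complex) \<Rightarrow> ('a \<Rightarrow>\<^sub>0 complex)" where
  "scale c f = Poly_Mapping.map ((*) c) f"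

text \<open>
  \<open>exp F = (\<Sum>m. F^m / m!)\<close> for a power series \<open>F\<close> without constant term: the terms with
  \<open>m > k\<close> do not contribute to the coefficient of \<open>u^k\<close>.
\<close>

definition exp_ser :: "sym fps \<Rightarrow> sym fps" where
  "exp_ser F = Abs_fps (\<lambda>k. \<Sum>m\<le>k. scale (1 / fact m) (fps_nth (F ^ m) k))"

text \<open>
  \<open>H(u) = exp (\<Sum>n\<ge>1. p\<^sub>n u^n / n)\<close> and \<open>E(u) = exp (\<Sum>n\<ge>1. (-1)^(n-1) p\<^sub>n u^n / n)\<close>.
\<close>

definition h_sym :: "int \<Rightarrow> sym" where
  "h_sym k = (if k < 0 then 0 else
     fps_nth (exp_ser (Abs_fps (\<lambda>n. if n = 0 then 0 else scale (1 / of_nat n) (p_sym n)))) (nat k))"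

definition e_sym :: "int \<Rightarrow> sym" where
  "e_sym k = (if k < 0 then 0 else
     fps_nth (exp_ser (Abs_fps (\<lambda>n. if n = 0 then 0
       else scale ((-1) ^ (n - 1) / of_nat n) (p_sym n)))) (nat k))"

text \<open>With 0-based indices the entry \<open>h\<^bsub>\<alpha>\<^sub>i - i + j\<^esub>\<close> is unchanged.\<close>

definition schur :: "int list \<Rightarrow> sym" where
  "schur \<alpha> = det (mat (length \<alpha>) (length \<alpha>) (\<lambda>(i, j). h_sym (\<alpha> ! i - int i + int j)))"

definition is_partition :: "int list \<Rightarrow> bool" where
  "is_partition \<mu> \<longleftrightarrow> sorted_wrt (\<ge>) \<mu> \<and> (\<forall>x\<in>set \<mu>. x > 0)"

text \<open>
  The Schur functions of partitions form a basis of \<open>\<Lambda>\<close>, so exactly one bilinear form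
  makes them orthonormal.
\<close>

definition is_schur_form :: "(sym \<Rightarrow> sym \<Rightarrow> complex) \<Rightarrow> bool" where
  "is_schur_form B \<longleftrightarrow>
     (\<forall>f g w. B (f + g) w = B f w + B g w) \<and> (\<forall>c f w. B (scale c f) w = c * B f w) \<and>
     (\<forall>f g w. B w (f + g) = B w f + B w g) \<and> (\<forall>c f w. B w (scale c f) = c * B w f) \<and>
     (\<forall>\<mu> \<nu>. is_partition \<mu> \<longrightarrow> is_partition \<nu> \<longrightarrow>
        B (schur \<mu>) (schur \<nu>) = (if \<mu> = \<nu> then 1 else 0))"

definition scalar_prod :: "sym \<Rightarrow> sym \<Rightarrow> complex" where
  "scalar_prod = (THE B. is_schur_form B)"

definition perp :: "sym \<Rightarrow> sym \<Rightarrow> sym" where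
  "perp f g = (THE x. \<forall>w. scalar_prod x w = scalar_prod g (f * w))"


section \<open>Vertex operators\<close>

text \<open>
  A formal series \<open>F(u) = \<Sum>n. F n u^n\<close> of operators on \<open>\<Lambda>\<close> is the family of its
  coefficients. In all products below only finitely many terms are non-zero on a given
  element of \<open>\<Lambda>\<close>.
\<close>

type_synonym op_ser = "int \<Rightarrow> sym \<Rightarrow> sym"

definition ser_mult :: "op_ser \<Rightarrow> op_ser \<Rightarrow> op_ser" where
  "ser_mult F G n f = Sum_any (\<lambda>i. F i (G (n - i) f))"

text \<open>\<open>F(-u)\<close>\<close>

definition ser_neg :: "op_ser \<Rightarrow> op_ser" where
  "ser_neg F n f = (if even n then F n f else - F n f)"

definition H_ser :: op_ser where "H_ser n f = h_sym n * f"
definition E_ser :: op_ser where "E_ser n f = e_sym n * f"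
definition Hperp_ser :: op_ser where "Hperp_ser n f = perp (h_sym (- n)) f"
definition Eperp_ser :: op_ser where "Eperp_ser n f = perp (e_sym (- n)) f"

text \<open>\<open>\<Gamma>(u) = \<Sum>j. \<Gamma>\<^sub>j u^(-j)\<close>\<close>

definition Gam :: "int \<Rightarrow> sym \<Rightarrow> sym" where
  "Gam j = ser_mult H_ser (ser_neg Eperp_ser) (- j)"


section \<open>The KP hierarchy\<close>

text \<open>
  Tensor products of spaces with chosen bases are spaces of finitely supported functions on
  the product of the bases; \<open>\<B>\<close> has the basis of all \<open>z^m\<close> times a monomial.
\<close>

type_synonym fock = "int \<times> monom \<Rightarrow>\<^sub>0 complex"

definition tensor ::
  "('a \<Rightarrow>\<^sub>0 complex) \<Rightarrow> ('b \<Rightarrow>\<^sub>0 complex) \<Rightarrow> ('a \<times> 'b \<Rightarrow>\<^sub>0 complex)" where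
  "tensor f g = (\<Sum>a\<in>Poly_Mapping.keys f. \<Sum>b\<in>Poly_Mapping.keys g.
     Poly_Mapping.single (a, b) (Poly_Mapping.lookup f a * Poly_Mapping.lookup g b))"

text \<open>The linear map with prescribed values on the basis.\<close>

definition lin_ext :: "('a \<Rightarrow> ('b \<Rightarrow>\<^sub>0 complex)) \<Rightarrow> ('a \<Rightarrow>\<^sub>0 complex) \<Rightarrow> ('b \<Rightarrow>\<^sub>0 complex)" where
  "lin_ext \<phi> x = (\<Sum>a\<in>Poly_Mapping.keys x. scale (Poly_Mapping.lookup x a) (\<phi> a))"

definition tensor_op ::
  "(('a \<Rightarrow>\<^sub>0 complex) \<Rightarrow> ('c \<Rightarrow>\<^sub>0 complex)) \<Rightarrow> (('b \<Rightarrow>\<^sub>0 complex) \<Rightarrow> ('d \<Rightarrow>\<^sub>0 complex)) \<Rightarrow>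
     ('a \<times> 'b \<Rightarrow>\<^sub>0 complex) \<Rightarrow> ('c \<times> 'd \<Rightarrow>\<^sub>0 complex)" where
  "tensor_op S T = lin_ext (\<lambda>(a, b).
     tensor (S (Poly_Mapping.single a 1)) (T (Poly_Mapping.single b 1)))"

text \<open>The element \<open>z^m f\<close> of \<open>\<B>\<close>.\<close>

definition z_pow :: "int \<Rightarrow> sym \<Rightarrow> fock" where
  "z_pow m f = tensor (Poly_Mapping.single m (1::complex)) f"

text \<open>
  The half-integer index \<open>i + 1/2\<close> is encoded by the integer \<open>i\<close>, so \<open>psi_plus i\<close> and
  \<open>psi_minus i\<close> are the coefficients of \<open>u^(-i-1)\<close>; the factor \<open>u^(\<plusminus>m)\<close> shifts the
  exponent that is read off from the vertex operator.
\<close>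

definition psi_plus :: "int \<Rightarrow> fock \<Rightarrow> fock" where
  "psi_plus i = lin_ext (\<lambda>(m, \<mu>).
     z_pow (m + 1) (ser_mult H_ser (ser_neg Eperp_ser) (- i - 1 - m) (Poly_Mapping.single \<mu> 1)))"

definition psi_minus :: "int \<Rightarrow> fock \<Rightarrow> fock" where
  "psi_minus i = lin_ext (\<lambda>(m, \<mu>).
     z_pow (m - 1) (ser_mult (ser_neg E_ser) Hperp_ser (- i - 1 + m) (Poly_Mapping.single \<mu> 1)))"

text \<open>If \<open>k = i + 1/2\<close> then \<open>-k = (-i-1) + 1/2\<close>.\<close>

definition Omega ::
  "((int \<times> monom) \<times> (int \<times> monom) \<Rightarrow>\<^sub>0 complex) \<Rightarrow> ((int \<times> monom) \<times> (int \<times> monom) \<Rightarrow>\<^sub>0 complex)" where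
  "Omega x = Sum_any (\<lambda>i. tensor_op (psi_plus i) (psi_minus (- i - 1)) x)"

definition KP_tau :: "fock \<Rightarrow> bool" where
  "KP_tau \<tau> \<longleftrightarrow> \<tau> \<noteq> 0 \<and> (\<exists>m f. \<tau> = z_pow m f) \<and> Omega (tensor \<tau> \<tau>) = 0"


section \<open>Polynomial tau-functions from a matrix\<close>

definition row_finite :: "(int \<Rightarrow> int \<Rightarrow> complex) \<Rightarrow> bool" where
  "row_finite A \<longleftrightarrow> (\<forall>i. \<exists>N. \<forall>j<N. A i j = 0)"

definition Gam_tilde :: "(int \<Rightarrow> int \<Rightarrow> complex) \<Rightarrow> int \<Rightarrow> sym \<Rightarrow> sym" where
  "Gam_tilde A i f = Sum_any (\<lambda>j. scale (A i j) (Gam j f))"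

definition s_tilde :: "(int \<Rightarrow> int \<Rightarrow> complex) \<Rightarrow> int list \<Rightarrow> sym" where
  "s_tilde A \<mu> = foldr (\<lambda>k f. Gam_tilde A (- k) f) \<mu> 1"

definition s_tilde_term :: "(int \<Rightarrow> int \<Rightarrow> complex) \<Rightarrow> int list \<Rightarrow> int list \<Rightarrow> sym" where
  "s_tilde_term A \<mu> \<alpha> = scale (\<Prod>i<length \<mu>. A (- (\<mu> ! i)) (- (\<alpha> ! i))) (schur \<alpha>)"


section \<open>Re-expansion of the generating function\<close>

text \<open>
  The coefficient of \<open>u\<^sub>1^\<alpha>\<^sub>1 \<cdots> u\<^sub>l^\<alpha>\<^sub>l\<close> in \<open>\<S>(u\<^sub>1, \<dots>, u\<^sub>l)\<close>, which is the product of the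
  \<open>H(u\<^sub>i)\<close> multiplied successively by all \<open>1 - u\<^sub>j / u\<^sub>i\<close> with \<open>i < j\<close>. A coefficient of
  \<open>(u\<^sub>j / u\<^sub>i) c(u)\<close> is the coefficient of \<open>c(u)\<close> with \<open>\<alpha>\<^sub>i\<close> raised and \<open>\<alpha>\<^sub>j\<close> lowered by 1.
\<close>

definition S_coeff :: "int list \<Rightarrow> sym" where
  "S_coeff \<alpha> =
     fold (\<lambda>(i, j) c. \<lambda>\<beta>. c \<beta> - c (\<beta>[i := \<beta> ! i + 1, j := \<beta> ! j - 1]))
       [(i, j). j \<leftarrow> [0..<length \<alpha>], i \<leftarrow> [0..<j]]
       (\<lambda>\<beta>. \<Prod>b\<leftarrow>\<beta>. h_sym b) \<alpha>"

text \<open>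
  Infinite sums of complex numbers are unconditional; sums with finitely many non-zero
  terms are a special case.
\<close>

definition left_inverse :: "(int \<Rightarrow> int \<Rightarrow> complex) \<Rightarrow> (int \<Rightarrow> int \<Rightarrow> complex) \<Rightarrow> bool" where
  "left_inverse B A \<longleftrightarrow>
     (\<forall>i j. ((\<lambda>k. B i k * A k j) has_sum (if i = j then 1 else 0)) UNIV)"

text \<open>The coefficient of \<open>u^r\<close> in \<open>g\<^sub>k(u)\<close>, where \<open>B\<close> is the inverse matrix.\<close>

definition g_coeff :: "(int \<Rightarrow> int \<Rightarrow> complex) \<Rightarrow> int \<Rightarrow> int \<Rightarrow> complex" where
  "g_coeff B k r = B (- r) (- k)"

text \<open>
  The coefficient of \<open>u\<^sub>1^\<alpha>\<^sub>1 \<cdots> u\<^sub>l^\<alpha>\<^sub>l\<close> in the summand of the re-expansion indexed by \<open>\<mu>\<close>.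
\<close>

definition reexp_term ::
  "(int \<Rightarrow> int \<Rightarrow> complex) \<Rightarrow> (int \<Rightarrow> int \<Rightarrow> complex) \<Rightarrow> int list \<Rightarrow> int list \<Rightarrow> sym" where
  "reexp_term A B \<alpha> \<mu> = scale (\<Prod>i<length \<alpha>. g_coeff B (\<mu> ! i) (\<alpha> ! i)) (s_tilde A \<mu>)"

text \<open>
  Infinite sums in \<open>\<Lambda>\<close> are taken coefficientwise with respect to the monomials in the
  \<open>p\<^sub>n\<close>. If the sums defining \<open>B A\<close> are finite, so is every sum in the re-expansion; otherwise
  both are unconditionally convergent.
\<close>

definition has_reexpansion ::
  "(int \<Rightarrow> int \<Rightarrow> complex) \<Rightarrow> (int \<Rightarrow> int \<Rightarrow> complex) \<Rightarrow> nat \<Rightarrow> bool" where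
  "has_reexpansion A B l \<longleftrightarrow>
     (\<forall>\<alpha> x. length \<alpha> = l \<longrightarrow>
        ((\<lambda>\<mu>. Poly_Mapping.lookup (reexp_term A B \<alpha> \<mu>) x)
           has_sum Poly_Mapping.lookup (S_coeff \<alpha>) x) {\<mu>. length \<mu> = l} \<and>
        ((\<forall>i j. finite {k. B i k * A k j \<noteq> 0}) \<longrightarrow>
           finite {\<mu>. length \<mu> = l \<and> Poly_Mapping.lookup (reexp_term A B \<alpha> \<mu>) x \<noteq> 0}))"

end

theory Submission
  imports Defs "HOL-Analysis.Elementary_Metric_Spaces"
begin

text \<open>
  Write \<open>X(u) = H(u) E\<^sup>\<bottom>(-u)\<close> and \<open>Y(u) = E(-u) H\<^sup>\<bottom>(u)\<close>. On \<open>\<Lambda>\<close> these are determined by their values on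
  \<open>1\<close> and their commutators with multiplication by the power sums, and induction over products of
  power sums gives the fermionic relations \<open>X\<^bsub>n-1\<^esub> X\<^sub>m = -X\<^bsub>m-1\<^esub> X\<^sub>n\<close>, the same for \<open>Y\<close>, and
  \<open>X\<^bsub>a+1\<^esub> Y\<^sub>b + Y\<^bsub>b+1\<^esub> X\<^sub>a = \<delta>\<^bsub>a+b,-1\<^esub>\<close>. The bilinear identity says
  \<open>\<Sum>\<^sub>n X\<^bsub>-1-n\<^esub> f \<otimes> Y\<^sub>n f = 0\<close>. By the relations it is inherited from \<open>f\<close> by every row-finite
  combination \<open>\<Sum>\<^sub>j a\<^sub>j X\<^sub>j f\<close>, so it passes from \<open>1\<close> to all \<open>s_tilde\<close>. Conversely, it is inherited by
  \<open>g = Y\<^sub>b f\<close>, and contracting it with \<open>Y\<^bsub>b+1\<^esub>\<close> shows \<open>f = \<Sum>\<^sub>j a\<^sub>j X\<^sub>j g\<close> whenever \<open>g \<noteq> 0\<close>. If \<open>f\<close> is not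
  constant, then \<open>g = h\<^sub>d\<^sup>\<bottom> f\<close> for the largest \<open>d\<close> with \<open>h\<^sub>d\<^sup>\<bottom> f \<noteq> 0\<close> is such a \<open>g\<close> of smaller degree, and
  descending to the constants writes \<open>f\<close> as an \<open>s_tilde\<close>. The re-expansion is \<open>B A = 1\<close> applied in each of
  the \<open>l\<close> indices, since only finitely many \<open>s\<^sub>\<alpha>\<close> contain a given monomial.
\<close>

section \<open>Linear algebra on finitely supported functions\<close>

text \<open>The scalar product and the adjoints are introduced by definite descriptions, so nothing
  about \<open>perp\<close> can be computed until the Schur functions of partitions are known to be
  an orthonormal basis. The candidate form \<open>pform\<close> is explicit on products of power
  sums. Orthonormality and spanning both come out of the same fermionic relations, once the
  determinant \<open>schur\<close> is recognised as a word in X applied to 1. Since E(-u) = 1/H(u),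
  the operators X and Y belong to one family with exponent s = 1 or s = -1, and a relation is proved
  once under \<open>s * s = 1\<close>. For the converse, the operators found in the descent may be
  arbitrary and unrelated, because different entries of the index vector select different rows of A.
  In the re-expansion the sums over the index vectors may be infinite. What permits interchanging
  them with the expansion into \<open>schur\<close> is a box for the index \<alpha> that depends
  only on the number of variables and on the chosen monomial: homogeneity bounds the sum of its
  entries, and a zero row of the determinant bounds each entry from below.\<close>

lemma lookup_scale [simp]: "Poly_Mapping.lookup (scale c f) x = c * Poly_Mapping.lookup f x"
  by (simp add: scale_def Poly_Mapping.map.rep_eq when_def)

lemma scale_add: "scale c (f + g) = scale c f + scale c g"
  by (rule poly_mapping_eqI) (simp add: lookup_add algebra_simps)

lemma scale_add_left: "scale (c + d) f = scale c f + scale d f"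
  by (rule poly_mapping_eqI) (simp add: lookup_add algebra_simps)

lemma scale_scale [simp]: "scale c (scale d f) = scale (c * d) f"
  by (rule poly_mapping_eqI) simp

lemma scale_one [simp]: "scale 1 f = f"
  by (rule poly_mapping_eqI) simp

lemma scale_zero [simp]: "scale c 0 = 0"
  by (rule poly_mapping_eqI) simp

lemma scale_zero_left [simp]: "scale 0 f = 0"
  by (rule poly_mapping_eqI) simp

lemma scale_minus: "scale c (- f) = - scale c f"
  by (rule poly_mapping_eqI) simp

lemma scale_minus_left: "scale (- c) f = - scale c f"
  by (rule poly_mapping_eqI) simp

lemma scale_diff: "scale c (f - g) = scale c f - scale c g"
  by (rule poly_mapping_eqI) (simp add: lookup_minus algebra_simps)

lemma scale_diff_left: "scale (c - d) f = scale c f - scale d f"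
  by (rule poly_mapping_eqI) (simp add: lookup_minus algebra_simps)

lemma scale_single [simp]: "scale c (Poly_Mapping.single a d) = Poly_Mapping.single a (c * d)"
  by (rule poly_mapping_eqI) (simp add: lookup_single when_def)

lemma scale_sum: "scale c (sum f I) = (\<Sum>i\<in>I. scale c (f i))"
  by (rule poly_mapping_eqI) (simp add: lookup_sum sum_distrib_left)

lemma scale_sum_left: "scale (sum c I) f = (\<Sum>i\<in>I. scale (c i) f)"
  by (rule poly_mapping_eqI) (simp add: lookup_sum sum_distrib_right)

lemma scale_eq_0_iff [simp]: "scale c f = 0 \<longleftrightarrow> c = 0 \<or> f = 0"
  by (auto simp: poly_mapping_eq_iff fun_eq_iff)

lemma scale_eq_mult: "scale c f = Poly_Mapping.single 0 c * (f :: ('a::monoid_add \<Rightarrow>\<^sub>0 complex))"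
  by (simp add: scale_def mult_map_scale_conv_mult)

lemma scale_mult_left: "scale c f * g = scale c (f * g :: ('a::monoid_add \<Rightarrow>\<^sub>0 complex))"
  by (simp add: scale_eq_mult mult.assoc)

lemma scale_mult_right: "f * scale c g = scale c (f * g :: ('a::comm_monoid_add \<Rightarrow>\<^sub>0 complex))"
  by (simp add: scale_eq_mult mult.left_commute)

lemma sum_single: "(\<Sum>a\<in>Poly_Mapping.keys f. Poly_Mapping.single a (Poly_Mapping.lookup f a)) = f"
proof (rule poly_mapping_eqI)
  fix x
  show "Poly_Mapping.lookup (\<Sum>a\<in>Poly_Mapping.keys f. Poly_Mapping.single a (Poly_Mapping.lookup f a)) x
      = Poly_Mapping.lookup f x"
    by (simp add: lookup_sum lookup_single when_def sum.delta' in_keys_iff)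
qed

definition linop :: "(('a \<Rightarrow>\<^sub>0 complex) \<Rightarrow> ('b \<Rightarrow>\<^sub>0 complex)) \<Rightarrow> bool" where
  "linop T \<longleftrightarrow> (\<forall>f g. T (f + g) = T f + T g) \<and> (\<forall>c f. T (scale c f) = scale c (T f))"

lemma linopI:
  "(\<And>f g. T (f + g) = T f + T g) \<Longrightarrow> (\<And>c f. T (scale c f) = scale c (T f)) \<Longrightarrow> linop T"
  by (simp add: linop_def)

context
  fixes T :: "('a \<Rightarrow>\<^sub>0 complex) \<Rightarrow> ('b \<Rightarrow>\<^sub>0 complex)"
  assumes T: "linop T"
begin

lemma linop_add: "T (f + g) = T f + T g"
  using T by (simp add: linop_def)

lemma linop_scale: "T (scale c f) = scale c (T f)"
  using T by (simp add: linop_def)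

lemma linop_zero: "T 0 = 0"
  using linop_scale[of 0 0] by simp

lemma linop_minus: "T (- f) = - T f"
  using linop_scale[of "-1" f] by (simp add: scale_minus_left)

lemma linop_diff: "T (f - g) = T f - T g"
  using linop_add[of f "- g"] by (simp add: linop_minus)

lemma linop_sum: "T (sum f I) = (\<Sum>i\<in>I. T (f i))"
  by (induction I rule: infinite_finite_induct) (simp_all add: linop_zero linop_add)

lemma linop_Sum_any:
  assumes "finite {i. f i \<noteq> 0}"
  shows "T (Sum_any f) = Sum_any (\<lambda>i. T (f i))"
proof -
  have "Sum_any (\<lambda>i. T (f i)) = (\<Sum>i\<in>{i. f i \<noteq> 0}. T (f i))"
    by (rule Sum_any.expand_superset[OF assms]) (auto simp: linop_zero)
  then show ?thesis
    by (simp add: Sum_any.expand_set linop_sum)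
qed

end

lemma linop_scale_op: "linop (scale c)"
  by (rule linopI) (simp_all add: scale_add mult.commute)

lemma linop_comp: "linop S \<Longrightarrow> linop T \<Longrightarrow> linop (\<lambda>f. S (T f))"
  by (simp add: linop_def)

lemma linop_mult: "linop (\<lambda>f. g * f :: ('a::comm_monoid_add \<Rightarrow>\<^sub>0 complex))"
  by (rule linopI) (simp_all add: algebra_simps scale_mult_right)

lemma linop_sum_op: "(\<And>i. i \<in> I \<Longrightarrow> linop (T i)) \<Longrightarrow> linop (\<lambda>f. \<Sum>i\<in>I. T i f)"
  by (rule linopI) (auto simp: linop_def sum.distrib scale_sum intro!: sum.cong)

lemma linop_ext:
  assumes S: "linop S" and T: "linop T"
    and eq: "\<And>a. S (Poly_Mapping.single a 1) = T (Poly_Mapping.single a 1)"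
  shows "S f = T f"
proof -
  have *: "Poly_Mapping.single a c = scale c (Poly_Mapping.single a 1)" for a :: 'a and c
    by simp
  have "S (\<Sum>a\<in>Poly_Mapping.keys f. Poly_Mapping.single a (Poly_Mapping.lookup f a))
      = T (\<Sum>a\<in>Poly_Mapping.keys f. Poly_Mapping.single a (Poly_Mapping.lookup f a))"
    unfolding linop_sum[OF S] linop_sum[OF T]
    by (subst (1 2) *) (simp only: linop_scale[OF S] linop_scale[OF T] eq)
  then show ?thesis by (simp add: sum_single)
qed

lemma lin_ext_superset:
  assumes "finite K" "Poly_Mapping.keys x \<subseteq> K"
  shows "lin_ext \<phi> x = (\<Sum>a\<in>K. scale (Poly_Mapping.lookup x a) (\<phi> a))"
  unfolding lin_ext_def
  by (rule sum.mono_neutral_left) (use assms in \<open>auto simp: in_keys_iff\<close>)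

lemma linop_lin_ext: "linop (lin_ext \<phi>)"
proof (rule linopI)
  fix f g :: "'a \<Rightarrow>\<^sub>0 complex"
  let ?K = "Poly_Mapping.keys f \<union> Poly_Mapping.keys g"
  have "Poly_Mapping.keys (f + g) \<subseteq> ?K" by (rule Poly_Mapping.keys_add)
  then show "lin_ext \<phi> (f + g) = lin_ext \<phi> f + lin_ext \<phi> g"
    by (simp add: lin_ext_superset[of ?K] lookup_add scale_add_left sum.distrib)
next
  fix c :: complex and f :: "'a \<Rightarrow>\<^sub>0 complex"
  have "Poly_Mapping.keys (scale c f) \<subseteq> Poly_Mapping.keys f"
    by (auto simp: in_keys_iff)
  then show "lin_ext \<phi> (scale c f) = scale c (lin_ext \<phi> f)"
    by (simp add: lin_ext_superset[of "Poly_Mapping.keys f"] scale_sum)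
qed

lemma lin_ext_single [simp]: "lin_ext \<phi> (Poly_Mapping.single a 1) = \<phi> a"
  by (simp add: lin_ext_def)

lemma lookup_tensor:
  "Poly_Mapping.lookup (tensor f g) (x, y) = Poly_Mapping.lookup f x * Poly_Mapping.lookup g y"
proof -
  have "Poly_Mapping.lookup (tensor f g) (x, y) = (\<Sum>a\<in>Poly_Mapping.keys f. \<Sum>b\<in>Poly_Mapping.keys g.
     if a = x then (if b = y then Poly_Mapping.lookup f a * Poly_Mapping.lookup g b else 0) else 0)"
    unfolding tensor_def lookup_sum
    by (intro sum.cong refl) (auto simp: lookup_single when_def)
  also have "\<dots> = (\<Sum>a\<in>Poly_Mapping.keys f. if a = x then \<Sum>b\<in>Poly_Mapping.keys g.
      (if b = y then Poly_Mapping.lookup f a * Poly_Mapping.lookup g b else 0) else 0)"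
    by (intro sum.cong refl) auto
  also have "\<dots> = Poly_Mapping.lookup f x * Poly_Mapping.lookup g y"
    by (auto simp: sum.delta in_keys_iff)
  finally show ?thesis .
qed

lemma linop_tensor_left: "linop (\<lambda>f. tensor f g)"
  by (rule linopI; rule poly_mapping_eqI)
     (simp_all add: lookup_tensor lookup_add algebra_simps split_paired_all)

lemma linop_tensor_right: "linop (tensor f)"
  by (rule linopI; rule poly_mapping_eqI)
     (simp_all add: lookup_tensor lookup_add algebra_simps split_paired_all)

lemma tensor_single: "tensor (Poly_Mapping.single a 1) (Poly_Mapping.single b 1) = Poly_Mapping.single (a, b) 1"
  by (simp add: tensor_def)

text \<open>\<open>tensor_op\<close> is prescribed on pairs of basis elements only; linearity
  extends the formula one factor at a time.\<close>

lemma tensor_op_tensor: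
  assumes S: "linop S" and T: "linop T"
  shows "tensor_op S T (tensor f g) = tensor (S f) (T g)"
proof -
  have L: "linop (tensor_op S T)" unfolding tensor_op_def by (rule linop_lin_ext)
  have 1: "tensor_op S T (tensor (Poly_Mapping.single a 1) h) = tensor (S (Poly_Mapping.single a 1)) (T h)" for a h
    by (rule linop_ext[OF linop_comp[OF L linop_tensor_right] linop_comp[OF linop_tensor_right T]])
      (simp add: tensor_single, simp add: tensor_op_def)
  show ?thesis
    by (rule linop_ext[OF linop_comp[OF L linop_tensor_left] linop_comp[OF linop_tensor_left S]]) (rule 1)
qed

section \<open>Linear functionals and sums indexed by the integers\<close>

definition linfun :: "(('a \<Rightarrow>\<^sub>0 complex) \<Rightarrow> complex) \<Rightarrow> bool" where
  "linfun \<phi> \<longleftrightarrow> (\<forall>f g. \<phi> (f + g) = \<phi> f + \<phi> g) \<and> (\<forall>c f. \<phi> (scale c f) = c * \<phi> f)"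

lemma linfun_add: "linfun \<phi> \<Longrightarrow> \<phi> (f + g) = \<phi> f + \<phi> g"
  and linfun_scale: "linfun \<phi> \<Longrightarrow> \<phi> (scale c f) = c * \<phi> f"
  by (simp_all add: linfun_def)

lemma linfun_zero: "linfun \<phi> \<Longrightarrow> \<phi> 0 = 0"
  using linfun_scale[of \<phi> 0 0] by simp

lemma linfun_diff: "linfun \<phi> \<Longrightarrow> \<phi> (f - g) = \<phi> f - \<phi> g"
  using linfun_add[of \<phi> f "scale (-1) g"] linfun_scale[of \<phi> "-1" g] by (simp add: scale_minus_left)

lemma linfun_sum: "linfun \<phi> \<Longrightarrow> \<phi> (sum f I) = (\<Sum>i\<in>I. \<phi> (f i))"
  by (induction I rule: infinite_finite_induct) (simp_all add: linfun_zero linfun_add)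

lemma linfun_lookup: "linfun (\<lambda>f. Poly_Mapping.lookup f x)"
  by (simp add: linfun_def lookup_add)

lemma linfun_comp: "linfun \<phi> \<Longrightarrow> linop T \<Longrightarrow> linfun (\<lambda>f. \<phi> (T f))"
  by (simp add: linfun_def linop_def)

lemma Sum_any_shift: "Sum_any (\<lambda>n::int. g (n + k)) = Sum_any g"
  by (rule sym, rule Sum_any.reindex_cong[where l = "\<lambda>n. n + k"])
     (auto simp: bij_def inj_def surj_def fun_eq_iff intro: exI[of _ "_ - k"])

lemma Sum_any_reflect: "Sum_any (\<lambda>n::int. g (k - n)) = Sum_any g"
  by (rule sym, rule Sum_any.reindex_cong[where l = "\<lambda>n. k - n"])
     (auto simp: bij_def inj_def surj_def fun_eq_iff intro: exI[of _ "k - _"])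

lemma finite_between: "(\<And>n. n < a \<Longrightarrow> g n = 0) \<Longrightarrow> (\<And>n. n > b \<Longrightarrow> g n = 0) \<Longrightarrow> finite {n::int. g n \<noteq> 0}"
  by (rule finite_subset[of _ "{a..b}"]) (auto simp: not_less[symmetric])

lemma Sum_any_between:
  "(\<And>n. n < a \<Longrightarrow> g n = 0) \<Longrightarrow> (\<And>n. n > b \<Longrightarrow> g n = 0) \<Longrightarrow> Sum_any g = sum g {a..b::int}"
  by (rule Sum_any.expand_superset) (auto simp: not_less[symmetric])

lemma lin_induct:
  assumes add: "\<And>f g. Pr f \<Longrightarrow> Pr g \<Longrightarrow> Pr (f + g)" and scl: "\<And>c f. Pr f \<Longrightarrow> Pr (scale c f)"
    and base: "\<And>a. Pr (Poly_Mapping.single a 1)"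
  shows "Pr f"
proof -
  have zero: "Pr 0" using scl[OF base, of 0] by simp
  have single: "Pr (Poly_Mapping.single a c)" for a c
    using scl[OF base[of a], of c] by simp
  have "Pr (\<Sum>a\<in>I. Poly_Mapping.single a (Poly_Mapping.lookup f a))" for I
    by (induction I rule: infinite_finite_induct) (auto intro: zero add single)
  then show ?thesis by (metis sum_single)
qed

section \<open>Power sums and their adjoints\<close>

definition unit_mon :: "nat \<Rightarrow> monom" where
  "unit_mon n = Poly_Mapping.single n 1"

lemma lookup_unit_mon [simp]: "Poly_Mapping.lookup (unit_mon n) m = (if m = n then 1 else 0)"
  by (simp add: unit_mon_def lookup_single when_def)

definition psum :: "nat \<Rightarrow> sym" where
  "psum n = p_sym (Suc n)"

lemma psum_mult_single: "psum n * Poly_Mapping.single a c = Poly_Mapping.single (unit_mon n + a) c"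
  by (simp add: psum_def p_sym_def mult_single unit_mon_def)

text \<open>Every monomial arises from 1 by single factors \<open>psum n\<close>; the inner
  induction raises one exponent from 0 to its final value. Linear operators can thus be compared
  through their values at 1 and their commutators with the power sums.\<close>

lemma sym_induct [case_names add scale one psum_mult]:
  assumes add: "\<And>f g. Pr f \<Longrightarrow> Pr g \<Longrightarrow> Pr (f + g)" and scl: "\<And>c f. Pr f \<Longrightarrow> Pr (scale c f)"
    and one: "Pr 1" and psum: "\<And>n f. Pr f \<Longrightarrow> Pr (psum n * f)"
  shows "Pr (f :: sym)"
proof (rule lin_induct[OF add scl])
  fix a :: monom
  show "Pr (Poly_Mapping.single a 1)"
  proof (induction a rule: update_induct)
    case const
    show ?case using one by simp
  next
    case (update b n v)
    have upd: "Poly_Mapping.update n v b = Poly_Mapping.single n v + b"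
      by (rule poly_mapping_eqI)
        (use update(1) in \<open>auto simp: lookup_update lookup_add lookup_single when_def in_keys_iff\<close>)
    have "Pr (Poly_Mapping.single (Poly_Mapping.single n w + b) 1)" for w
    proof (induction w)
      case 0
      then show ?case using update by simp
    next
      case (Suc w)
      have "unit_mon n + (Poly_Mapping.single n w + b) = Poly_Mapping.single n (Suc w) + b"
        by (simp add: add.assoc[symmetric] single_add[symmetric] unit_mon_def)
      then show ?case
        using psum[OF Suc, of n] by (simp add: psum_mult_single)
    qed
    then show ?case by (simp add: upd)
  qed
qed

lemma monom_cases:
  obtains "Poly_Mapping.lookup (a :: monom) n = 0" | b where "a = unit_mon n + b"
proof (cases "Poly_Mapping.lookup a n = 0")
  case False
  have "a = unit_mon n + (a - unit_mon n)"
    by (rule poly_mapping_eqI) (use False in \<open>auto simp: lookup_add lookup_minus\<close>)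
  then show ?thesis using that by blast
qed (use that in blast)

lemma lookup_psum_mult [simp]: "Poly_Mapping.lookup (psum n * f) (unit_mon n + b) = Poly_Mapping.lookup f b"
  by (induction f rule: lin_induct)
    (simp_all add: lookup_add distrib_left scale_mult_right psum_mult_single lookup_single when_def)

lemma lookup_psum_mult_zero: "Poly_Mapping.lookup a n = 0 \<Longrightarrow> Poly_Mapping.lookup (psum n * f) a = 0"
  by (induction f rule: lin_induct)
    (auto simp add: lookup_add distrib_left scale_mult_right psum_mult_single lookup_single when_def)

text \<open>The derivation (n+1) d/dp_(n+1). On a monomial without this variable the truncated
  subtraction is harmless, because the coefficient is 0.\<close>

definition psum_perp :: "nat \<Rightarrow> sym \<Rightarrow> sym" where
  "psum_perp n = lin_ext (\<lambda>a. Poly_Mapping.single (a - unit_mon n) (of_nat (Suc n * Poly_Mapping.lookup a n)))"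

lemma linop_psum_perp: "linop (psum_perp n)"
  unfolding psum_perp_def by (rule linop_lin_ext)

lemma lookup_psum_perp:
  "Poly_Mapping.lookup (psum_perp n f) b =
     of_nat (Suc n * Suc (Poly_Mapping.lookup b n)) * Poly_Mapping.lookup f (unit_mon n + b)"
proof (induction f rule: lin_induct)
  case (3 a)
  show ?case
  proof (rule monom_cases[of a n])
    assume "Poly_Mapping.lookup a n = 0"
    moreover from this have "a \<noteq> unit_mon n + b" by (auto simp: lookup_add)
    ultimately show ?thesis
      by (simp add: psum_perp_def lookup_single when_def)
  next
    fix c assume "a = unit_mon n + c"
    then show ?thesis
      by (auto simp: psum_perp_def lookup_single when_def lookup_add simp del: of_nat_Suc of_nat_mult mult_Suc mult_Suc_right)
  qed
qed (simp_all add: linop_add[OF linop_psum_perp] linop_scale[OF linop_psum_perp] lookup_add distrib_left)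

lemma psum_perp_one [simp]: "psum_perp n 1 = 0"
  by (simp add: psum_perp_def single_one[symmetric] del: single_one)

text \<open>The Heisenberg relation, that is, the Leibniz rule. It is checked coefficientwise,
  according to whether p_(m+1) divides the monomial.\<close>

lemma psum_perp_psum_mult: "psum_perp n (psum m * f) = psum m * psum_perp n f + (if n = m then scale (of_nat (Suc n)) f else 0)"
proof (rule poly_mapping_eqI)
  fix x
  show "Poly_Mapping.lookup (psum_perp n (psum m * f)) x =
    Poly_Mapping.lookup (psum m * psum_perp n f + (if n = m then scale (of_nat (Suc n)) f else 0)) x"
  proof (rule monom_cases[of x m])
    assume 0: "Poly_Mapping.lookup x m = 0"
    show ?thesis
    proof (cases "n = m")
      case False
      then have "Poly_Mapping.lookup (unit_mon n + x) m = 0"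
        using 0 by (simp add: lookup_add)
      then show ?thesis using 0 False by (simp add: lookup_psum_perp lookup_psum_mult_zero)
    qed (use 0 in \<open>simp add: lookup_psum_perp lookup_add lookup_psum_mult_zero\<close>)
  next
    fix b assume x: "x = unit_mon m + b"
    have *: "unit_mon n + (unit_mon m + b) = unit_mon m + (unit_mon n + b)"
      by (simp add: ac_simps)
    show ?thesis
      unfolding x lookup_psum_perp * lookup_psum_mult lookup_add
      by (auto simp: lookup_psum_perp lookup_add algebra_simps)
  qed
qed

text \<open>The classical number usually written z with a partition as index: the product of i^m m!
  over the parts i, where m is the multiplicity of i. It is the squared length of the corresponding
  product of power sums.\<close>

definition z_fac :: "monom \<Rightarrow> complex" where
  "z_fac a = (\<Prod>n\<in>Poly_Mapping.keys a. of_nat (Suc n ^ Poly_Mapping.lookup a n * fact (Poly_Mapping.lookup a n)))"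

lemma z_fac_superset:
  "finite K \<Longrightarrow> Poly_Mapping.keys a \<subseteq> K \<Longrightarrow>
    z_fac a = (\<Prod>n\<in>K. of_nat (Suc n ^ Poly_Mapping.lookup a n * fact (Poly_Mapping.lookup a n)))"
  unfolding z_fac_def by (rule prod.mono_neutral_left) (auto simp: in_keys_iff)

lemma z_fac_nonzero [simp]: "z_fac a \<noteq> 0"
  by (simp add: z_fac_def del: of_nat_Suc)

lemma z_fac_zero [simp]: "z_fac 0 = 1"
  by (simp add: z_fac_def)

lemma z_fac_unit_add: "z_fac (unit_mon n + b) = of_nat (Suc n * Suc (Poly_Mapping.lookup b n)) * z_fac b"
proof -
  let ?K = "insert n (Poly_Mapping.keys b)"
  have "Poly_Mapping.keys (unit_mon n + b) \<subseteq> ?K"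
    by (auto simp: in_keys_iff lookup_add split: if_splits)
  let ?t = "\<lambda>a k. of_nat (Suc k ^ Poly_Mapping.lookup a k * fact (Poly_Mapping.lookup a k)) :: complex"
  have "z_fac (unit_mon n + b) = ?t (unit_mon n + b) n * (\<Prod>k\<in>?K - {n}. ?t (unit_mon n + b) k)"
    by (subst z_fac_superset[OF _ \<open>_ \<subseteq> ?K\<close>]) (simp, rule prod.remove, simp_all)
  also have "(\<Prod>k\<in>?K - {n}. ?t (unit_mon n + b) k) = (\<Prod>k\<in>?K - {n}. ?t b k)"
    by (intro prod.cong refl) (simp add: lookup_add)
  also have "?t (unit_mon n + b) n = of_nat (Suc n * Suc (Poly_Mapping.lookup b n)) * ?t b n"
    by (simp add: lookup_add algebra_simps)
  also have "of_nat (Suc n * Suc (Poly_Mapping.lookup b n)) * ?t b n * (\<Prod>k\<in>?K - {n}. ?t b k)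
      = of_nat (Suc n * Suc (Poly_Mapping.lookup b n)) * (\<Prod>k\<in>?K. ?t b k)"
    by (subst prod.remove[of ?K n]) (simp_all only: mult.assoc finite_insert finite_keys insertI1)
  also have "(\<Prod>k\<in>?K. ?t b k) = z_fac b"
    by (rule z_fac_superset[symmetric]) auto
  finally show ?thesis .
qed

text \<open>The Hall scalar product in the basis of power sum products, which are orthogonal; it is
  identified with \<open>scalar_prod\<close> once the Schur functions are available.\<close>

definition pform :: "sym \<Rightarrow> sym \<Rightarrow> complex" where
  "pform f g = (\<Sum>a\<in>Poly_Mapping.keys f. z_fac a * Poly_Mapping.lookup f a * Poly_Mapping.lookup g a)"

lemma pform_superset:
  "finite K \<Longrightarrow> Poly_Mapping.keys f \<subseteq> K \<Longrightarrow>
    pform f g = (\<Sum>a\<in>K. z_fac a * Poly_Mapping.lookup f a * Poly_Mapping.lookup g a)"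
  unfolding pform_def by (rule sum.mono_neutral_left) (auto simp: in_keys_iff)

lemma pform_commute: "pform f g = pform g f"
  by (simp add: pform_superset[of "Poly_Mapping.keys f \<union> Poly_Mapping.keys g"] mult.commute mult.left_commute)

lemma pform_add_right: "pform f (g + h) = pform f g + pform f h"
  by (simp add: pform_def lookup_add distrib_left sum.distrib)

lemma pform_scale_right: "pform f (scale c g) = c * pform f g"
  by (simp add: pform_def sum_distrib_left mult.left_commute)

lemma pform_add_left: "pform (f + g) h = pform f h + pform g h"
  using pform_add_right[of h f g] by (simp add: pform_commute)

lemma pform_scale_left: "pform (scale c f) g = c * pform f g"
  using pform_scale_right[of g c f] by (simp add: pform_commute)

lemma linfun_pform: "linfun (pform f)" and linfun_pform_left: "linfun (\<lambda>f. pform f g)"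
  by (simp_all add: linfun_def pform_add_right pform_scale_right pform_add_left pform_scale_left)

lemma pform_single: "pform (Poly_Mapping.single a 1) g = z_fac a * Poly_Mapping.lookup g a"
  by (simp add: pform_def)

lemma pform_eqI: "(\<And>w. pform w f = pform w g) \<Longrightarrow> f = g"
proof (rule poly_mapping_eqI)
  fix a assume "\<And>w. pform w f = pform w g"
  from this[of "Poly_Mapping.single a 1"] show "Poly_Mapping.lookup f a = Poly_Mapping.lookup g a"
    by (simp add: pform_single)
qed

lemma pform_psum: "pform (psum n * f) g = pform f (psum_perp n g)"
  by (induction f rule: lin_induct)
    (simp_all add: distrib_left scale_mult_right pform_add_left pform_scale_left
      psum_mult_single pform_single lookup_psum_perp z_fac_unit_add del: of_nat_Suc of_nat_mult)

section \<open>Powers of the generating function of the complete symmetric functions\<close>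

text \<open>
  \<open>H_pow s k\<close> is the coefficient of \<open>u^k\<close> in \<open>H(u)^s = exp (s (\<Sum>n\<ge>1. p\<^sub>n u^n / n))\<close>, computed by Newton's
  recursion: \<open>s = 1\<close> gives \<open>H(u)\<close> and \<open>s = -1\<close> gives \<open>E(-u)\<close>. \<open>H_pow_perp\<close> is the adjoint operator.
\<close>

fun H_pow_nat :: "complex \<Rightarrow> nat \<Rightarrow> sym" where
  "H_pow_nat s 0 = 1"
| "H_pow_nat s (Suc k) = scale (s / of_nat (Suc k)) (\<Sum>j\<le>k. psum j * H_pow_nat s (k - j))"

definition H_pow :: "complex \<Rightarrow> int \<Rightarrow> sym" where
  "H_pow s k = (if k < 0 then 0 else H_pow_nat s (nat k))"

lemma H_pow_neg [simp]: "k < 0 \<Longrightarrow> H_pow s k = 0" and H_pow_zero [simp]: "H_pow s 0 = 1"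
  by (simp_all add: H_pow_def)

fun H_pow_perp_nat :: "complex \<Rightarrow> nat \<Rightarrow> sym \<Rightarrow> sym" where
  "H_pow_perp_nat s 0 f = f"
| "H_pow_perp_nat s (Suc k) f = scale (s / of_nat (Suc k)) (\<Sum>j\<le>k. psum_perp j (H_pow_perp_nat s (k - j) f))"

definition H_pow_perp :: "complex \<Rightarrow> int \<Rightarrow> sym \<Rightarrow> sym" where
  "H_pow_perp s k f = (if k < 0 then 0 else H_pow_perp_nat s (nat k) f)"

lemma H_pow_perp_neg [simp]: "k < 0 \<Longrightarrow> H_pow_perp s k f = 0" and H_pow_perp_zero [simp]: "H_pow_perp s 0 f = f"
  by (simp_all add: H_pow_perp_def)

text \<open>Newton's recursion for every integer k and with a summation range N that may be chosen
  larger than k. The common range lets recursions for different indices be combined without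
  adjusting bounds: the surplus terms have negative index and vanish.\<close>

lemma newton_recursion:
  fixes T :: "nat \<Rightarrow> sym \<Rightarrow> sym"
  assumes T: "\<And>j. T j 0 = 0" and neg: "\<And>k. k < 0 \<Longrightarrow> q k = 0"
    and rec: "\<And>k. scale (of_nat (Suc k)) (q (int (Suc k))) = scale s (\<Sum>j\<le>k. T j (q (int (k - j))))"
    and N: "nat k \<le> N"
  shows "scale (of_int k) (q k) = scale s (\<Sum>j<N. T j (q (k - 1 - int j)))"
proof (cases "k > 0")
  case True
  then obtain m where k: "k = int (Suc m)" by (metis Suc_pred' zero_less_imp_eq_int of_nat_0_less_iff)
  have "(\<Sum>j<N. T j (q (k - 1 - int j))) = (\<Sum>j\<le>m. T j (q (k - 1 - int j)))"
    by (rule sum.mono_neutral_right) (use N k in \<open>auto simp: T neg\<close>)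
  also have "\<dots> = (\<Sum>j\<le>m. T j (q (int (m - j))))"
    by (intro sum.cong refl) (simp add: k of_nat_diff)
  finally show ?thesis using rec[of m] by (simp add: k del: of_nat_Suc)
next
  case False
  then have "(\<Sum>j<N. T j (q (k - 1 - int j))) = 0"
    by (intro sum.neutral) (simp add: T neg)
  then show ?thesis using False by (cases "k = 0") (auto simp: neg)
qed

lemma H_pow_int: "H_pow s (int k) = H_pow_nat s k" and H_pow_perp_int: "H_pow_perp s (int k) f = H_pow_perp_nat s k f"
  by (simp_all add: H_pow_def H_pow_perp_def)

lemma newton_H_pow:
  assumes "nat k \<le> N"
  shows "scale (of_int k) (H_pow s k) = scale s (\<Sum>j<N. psum j * H_pow s (k - 1 - int j))"
proof (rule newton_recursion[OF _ _ _ assms])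
  show "scale (of_nat (Suc k)) (H_pow s (int (Suc k))) = scale s (\<Sum>j\<le>k. psum j * H_pow s (int (k - j)))" for k
    unfolding H_pow_int H_pow_nat.simps by (simp del: of_nat_Suc)
qed simp_all

lemma newton_H_pow_perp:
  assumes "nat k \<le> N"
  shows "scale (of_int k) (H_pow_perp s k f) = scale s (\<Sum>j<N. psum_perp j (H_pow_perp s (k - 1 - int j) f))"
proof (rule newton_recursion[where q = "\<lambda>k. H_pow_perp s k f", OF _ _ _ assms])
  show "scale (of_nat (Suc k)) (H_pow_perp s (int (Suc k)) f) = scale s (\<Sum>j\<le>k. psum_perp j (H_pow_perp s (int (k - j)) f))" for k
    unfolding H_pow_perp_int H_pow_perp_nat.simps by (simp del: of_nat_Suc)
qed (simp_all add: linop_zero[OF linop_psum_perp])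

lemma scale_cancel: "c \<noteq> 0 \<Longrightarrow> scale c f = scale c g \<Longrightarrow> f = g"
  by (metis scale_scale scale_one left_inverse)

lemma linop_H_pow_perp_nat: "linop (H_pow_perp_nat s k)"
proof (induction k rule: less_induct)
  case (less k)
  show ?case
  proof (cases k)
    case (Suc m)
    have "linop (\<lambda>f. scale (s / of_nat (Suc m)) (\<Sum>j\<le>m. psum_perp j (H_pow_perp_nat s (m - j) f)))"
      by (intro linop_comp[OF linop_scale_op] linop_sum_op linop_comp[OF linop_psum_perp] less)
        (simp add: Suc)
    moreover have "H_pow_perp_nat s k = (\<lambda>f. scale (s / of_nat (Suc m)) (\<Sum>j\<le>m. psum_perp j (H_pow_perp_nat s (m - j) f)))"
      by (simp add: Suc fun_eq_iff)
    ultimately show ?thesis by simp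
  qed (simp add: linop_def)
qed

lemma linop_H_pow_perp: "linop (H_pow_perp s k)"
  using linop_H_pow_perp_nat[of s "nat k"] by (cases "k < 0") (simp_all add: linop_def H_pow_perp_def)

text \<open>Applying (n+1) d/dp_(n+1) to the exponential series H(u)^s multiplies it by s
  u^(n+1).\<close>

lemma psum_perp_H_pow: "psum_perp n (H_pow s k) = scale s (H_pow s (k - 1 - int n))"
proof (induction "nat k" arbitrary: k rule: less_induct)
  case less
  show ?case
  proof (cases "k \<le> 0")
    case True
    then show ?thesis by (cases "k = 0") (simp_all add: linop_zero[OF linop_psum_perp])
  next
    case False
    obtain N where N: "n < N" "nat k \<le> N" "nat (k - 1 - int n) \<le> N"
      using that[of "nat k + n + 1"] by simp
    have "scale (of_int k) (psum_perp n (H_pow s k)) = scale s (\<Sum>j<N. psum_perp n (psum j * H_pow s (k - 1 - int j)))"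
      by (simp only: linop_scale[OF linop_psum_perp, symmetric] newton_H_pow[OF N(2)])
        (simp only: linop_scale[OF linop_psum_perp] linop_sum[OF linop_psum_perp])
    also have "(\<Sum>j<N. psum_perp n (psum j * H_pow s (k - 1 - int j)))
       = (\<Sum>j<N. psum j * psum_perp n (H_pow s (k - 1 - int j)))
        + (\<Sum>j<N. if n = j then scale (of_nat (Suc n)) (H_pow s (k - 1 - int j)) else 0)"
      by (simp only: psum_perp_psum_mult sum.distrib)
    also have "(\<Sum>j<N. if n = j then scale (of_nat (Suc n)) (H_pow s (k - 1 - int j)) else 0)
        = scale (of_nat (Suc n)) (H_pow s (k - 1 - int n))"
      using N(1) by simp
    also have "(\<Sum>j<N. psum j * psum_perp n (H_pow s (k - 1 - int j)))
        = (\<Sum>j<N. scale s (psum j * H_pow s ((k - 1 - int n) - 1 - int j)))"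
    proof (intro sum.cong refl)
      fix j
      have "psum_perp n (H_pow s (k - 1 - int j)) = scale s (H_pow s (k - 1 - int j - 1 - int n))"
        using False by (intro less) simp
      moreover have "k - 1 - int j - 1 - int n = (k - 1 - int n) - 1 - int j" by simp
      ultimately show "psum j * psum_perp n (H_pow s (k - 1 - int j)) = scale s (psum j * H_pow s ((k - 1 - int n) - 1 - int j))"
        by (simp only: scale_mult_right)
    qed
    also have "\<dots> = scale (of_int (k - 1 - int n)) (H_pow s (k - 1 - int n))"
      unfolding newton_H_pow[OF N(3)] scale_sum ..
    \<comment> \<open>The weight k - 1 - n from Newton's recursion and the weight n + 1 from the
      commutator add up to k.\<close>
    also have "scale s (scale (of_int (k - 1 - int n)) (H_pow s (k - 1 - int n)) + scale (of_nat (Suc n)) (H_pow s (k - 1 - int n)))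
        = scale (of_int k) (scale s (H_pow s (k - 1 - int n)))"
      unfolding scale_add_left[symmetric] scale_scale by (simp add: mult.commute)
    finally have "scale (of_int k) (psum_perp n (H_pow s k)) = scale (of_int k) (scale s (H_pow s (k - 1 - int n)))" .
    then show ?thesis using False by - (rule scale_cancel[of "of_int k"], simp_all)
  qed
qed

text \<open>The commutator of the adjoint series with p_(n+1) is s u^(-n-1) times the series. The
  computation mirrors \<open>psum_perp_H_pow\<close>, with the roles of multiplication and
  derivation exchanged.\<close>

lemma H_pow_perp_psum_mult: "H_pow_perp s k (psum n * f) = psum n * H_pow_perp s k f + scale s (H_pow_perp s (k - 1 - int n) f)"
proof (induction "nat k" arbitrary: k rule: less_induct)
  case less
  show ?case
  proof (cases "k \<le> 0")
    case True
    then show ?thesis by (cases "k = 0") simp_all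
  next
    case False
    obtain N where N: "n < N" "nat k \<le> N" "nat (k - 1 - int n) \<le> N"
      using that[of "nat k + n + 1"] by simp
    have "scale (of_int k) (H_pow_perp s k (psum n * f)) = scale s (\<Sum>j<N. psum_perp j (H_pow_perp s (k - 1 - int j) (psum n * f)))"
      by (rule newton_H_pow_perp[OF N(2)])
    also have "(\<Sum>j<N. psum_perp j (H_pow_perp s (k - 1 - int j) (psum n * f)))
       = (\<Sum>j<N. psum n * psum_perp j (H_pow_perp s (k - 1 - int j) f)
           + (if j = n then scale (of_nat (Suc j)) (H_pow_perp s (k - 1 - int j) f) else 0)
           + scale s (psum_perp j (H_pow_perp s ((k - 1 - int n) - 1 - int j) f)))"
    proof (intro sum.cong refl)
      fix j
      have "H_pow_perp s (k - 1 - int j) (psum n * f) = psum n * H_pow_perp s (k - 1 - int j) f + scale s (H_pow_perp s (k - 1 - int j - 1 - int n) f)"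
        using False by (intro less) simp
      moreover have "k - 1 - int j - 1 - int n = (k - 1 - int n) - 1 - int j" by simp
      ultimately show "psum_perp j (H_pow_perp s (k - 1 - int j) (psum n * f)) = psum n * psum_perp j (H_pow_perp s (k - 1 - int j) f)
           + (if j = n then scale (of_nat (Suc j)) (H_pow_perp s (k - 1 - int j) f) else 0)
           + scale s (psum_perp j (H_pow_perp s ((k - 1 - int n) - 1 - int j) f))"
        by (simp only: linop_add[OF linop_psum_perp] linop_scale[OF linop_psum_perp] psum_perp_psum_mult)
    qed
    also have "\<dots> = psum n * (\<Sum>j<N. psum_perp j (H_pow_perp s (k - 1 - int j) f))
        + scale (of_nat (Suc n)) (H_pow_perp s (k - 1 - int n) f)
        + scale s (\<Sum>j<N. psum_perp j (H_pow_perp s ((k - 1 - int n) - 1 - int j) f))"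
      unfolding sum.distrib sum_distrib_left scale_sum using N(1) by simp
    also have "scale s (\<Sum>j<N. psum_perp j (H_pow_perp s ((k - 1 - int n) - 1 - int j) f)) =
       scale (of_int (k - 1 - int n)) (H_pow_perp s (k - 1 - int n) f)"
      by (rule newton_H_pow_perp[OF N(3), symmetric])
    also have "scale s (psum n * (\<Sum>j<N. psum_perp j (H_pow_perp s (k - 1 - int j) f)) + scale (of_nat (Suc n)) (H_pow_perp s (k - 1 - int n) f)
         + scale (of_int (k - 1 - int n)) (H_pow_perp s (k - 1 - int n) f))
       = psum n * scale s (\<Sum>j<N. psum_perp j (H_pow_perp s (k - 1 - int j) f)) + scale (of_int k * s) (H_pow_perp s (k - 1 - int n) f)"
    proof -
      have "of_int k * s = s * of_nat (Suc n) + s * of_int (k - 1 - int n)"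
        by (simp add: algebra_simps)
      then show ?thesis
        by (simp only: scale_add scale_mult_right add.assoc scale_add_left scale_scale)
    qed
    also have "scale s (\<Sum>j<N. psum_perp j (H_pow_perp s (k - 1 - int j) f)) = scale (of_int k) (H_pow_perp s k f)"
      by (rule newton_H_pow_perp[OF N(2), symmetric])
    finally have "scale (of_int k) (H_pow_perp s k (psum n * f)) =
        scale (of_int k) (psum n * H_pow_perp s k f + scale s (H_pow_perp s (k - 1 - int n) f))"
      by (simp add: scale_add scale_mult_right)
    then show ?thesis using False by - (rule scale_cancel[of "of_int k"], simp_all)
  qed
qed

lemma H_pow_perp_one: "H_pow_perp s k 1 = (if k = 0 then 1 else 0)"
proof (induction "nat k" arbitrary: k rule: less_induct)
  case less
  show ?case
  proof (cases "k \<le> 0")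
    case True
    then show ?thesis by (cases "k = 0") simp_all
  next
    case False
    have "psum_perp j (H_pow_perp s (k - 1 - int j) 1) = 0" for j
      using less[of "k - 1 - int j"] False by (auto simp: linop_zero[OF linop_psum_perp])
    then have "scale (of_int k) (H_pow_perp s k 1) = 0"
      using newton_H_pow_perp[of k "nat k" s 1] by simp
    with False show ?thesis by simp
  qed
qed

lemma pform_H_pow: "pform (H_pow s k * f) g = pform f (H_pow_perp s k g)"
proof (induction "nat k" arbitrary: k f rule: less_induct)
  case less
  show ?case
  proof (cases "k \<le> 0")
    case True
    then show ?thesis by (cases "k = 0") (simp_all add: linfun_zero[OF linfun_pform] linfun_zero[OF linfun_pform_left])
  next
    case False
    have "of_int k * pform (H_pow s k * f) g = pform (scale (of_int k) (H_pow s k) * f) g"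
      by (simp add: scale_mult_left pform_scale_left)
    also have "\<dots> = s * (\<Sum>j<nat k. pform (H_pow s (k - 1 - int j) * (psum j * f)) g)"
      by (simp add: newton_H_pow[of k "nat k"] scale_mult_left pform_scale_left sum_distrib_right
          linfun_sum[OF linfun_pform_left] mult.left_commute mult.assoc)
    also have "\<dots> = s * (\<Sum>j<nat k. pform (psum j * f) (H_pow_perp s (k - 1 - int j) g))"
      using False by (intro arg_cong[of _ _ "(*) s"] sum.cong refl less) simp
    also have "\<dots> = pform f (scale (of_int k) (H_pow_perp s k g))"
      by (simp add: newton_H_pow_perp[of k "nat k"] pform_scale_right linfun_sum[OF linfun_pform] pform_psum)
    finally show ?thesis using False by (simp add: pform_scale_right)
  qed
qed

lemma H_pow_perp_bounded: "\<exists>N. \<forall>k>N. H_pow_perp s k f = 0"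
proof (induction f rule: sym_induct)
  case (add f g)
  then obtain M N where "\<forall>k>M. H_pow_perp s k f = 0" "\<forall>k>N. H_pow_perp s k g = 0" by blast
  then have "\<forall>k>max M N. H_pow_perp s k (f + g) = 0" by (simp add: linop_add[OF linop_H_pow_perp])
  then show ?case by blast
next
  case (scale c f)
  then show ?case by (simp add: linop_scale[OF linop_H_pow_perp]) blast
next
  case one
  then show ?case by (auto simp: H_pow_perp_one intro!: exI[of _ 0])
next
  case (psum_mult n f)
  then obtain N where "\<forall>k>N. H_pow_perp s k f = 0" by blast
  then have "\<forall>k>N + 1 + int n. H_pow_perp s k (psum n * f) = 0"
    by (simp add: H_pow_perp_psum_mult)
  then show ?case by blast
qed

section \<open>Vertex operators\<close>

text \<open>The coefficient of \<open>u^n\<close> in \<open>H(u)^s H\<^sup>\<bottom>(u)^(-s)\<close>: \<open>X\<close> for \<open>s = 1\<close> and \<open>Y\<close> for \<open>s = -1\<close>.\<close>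

definition vertex :: "complex \<Rightarrow> int \<Rightarrow> sym \<Rightarrow> sym" where
  "vertex s n f = Sum_any (\<lambda>k. H_pow s (n + k) * H_pow_perp (- s) k f)"

lemma finite_H_pow_perp: "finite {k. H_pow_perp s k f \<noteq> 0}"
proof -
  obtain N where "\<forall>k>N. H_pow_perp s k f = 0" using H_pow_perp_bounded by blast
  then show ?thesis by (intro finite_between[of 0 _ N]) auto
qed

lemma vertex_eq_sum:
  assumes "finite K" "{k. H_pow_perp (- s) k f \<noteq> 0} \<subseteq> K"
  shows "vertex s n f = (\<Sum>k\<in>K. H_pow s (n + k) * H_pow_perp (- s) k f)"
  unfolding vertex_def by (rule Sum_any.expand_superset) (use assms in auto)

lemma linop_vertex: "linop (vertex s n)"
proof (rule linopI)
  fix f g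
  let ?K = "{k. H_pow_perp (- s) k f \<noteq> 0} \<union> {k. H_pow_perp (- s) k g \<noteq> 0}"
  have fin: "finite ?K" by (simp add: finite_H_pow_perp)
  show "vertex s n (f + g) = vertex s n f + vertex s n g"
    by (subst (1 2 3) vertex_eq_sum[OF fin])
      (auto simp: linop_add[OF linop_H_pow_perp] distrib_left sum.distrib)
next
  fix c f
  show "vertex s n (scale c f) = scale c (vertex s n f)"
    by (subst (1 2) vertex_eq_sum[OF finite_H_pow_perp[of "- s" f]])
      (auto simp: linop_scale[OF linop_H_pow_perp] scale_mult_right scale_sum)
qed

lemma vertex_one [simp]: "vertex s n 1 = H_pow s n"
  by (subst vertex_eq_sum[of "{0}"]) (auto simp: H_pow_perp_one)

text \<open>Multiplication by \<open>H_pow\<close> commutes with the power sum, so only the adjoint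
  factor with exponent -s contributes; its shifted index is absorbed by shifting the
  summation.\<close>

lemma vertex_psum_mult: "vertex s n (psum m * f) = psum m * vertex s n f - scale s (vertex s (n + 1 + int m) f)"
proof -
  let ?g = "\<lambda>k. H_pow s (n + 1 + int m + k) * H_pow_perp (- s) k f"
  have g: "finite {k. ?g k \<noteq> 0}"
    by (rule finite_subset[OF _ finite_H_pow_perp[of "- s" f]]) auto
  have "finite {k. ?g (k + (- 1 - int m)) \<noteq> 0}"
    using finite_vimageI[OF g, of "\<lambda>k. k + (- 1 - int m)"] by (simp add: vimage_def)
  then have g': "finite {k. scale s (?g (k + (- 1 - int m))) \<noteq> 0}"
    by (rule rev_finite_subset) auto
  have f: "finite {k. psum m * (H_pow s (n + k) * H_pow_perp (- s) k f) \<noteq> 0}"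
    by (rule finite_subset[OF _ finite_H_pow_perp[of "- s" f]]) auto
  have *: "H_pow s (n + k) * H_pow_perp (- s) k (psum m * f) =
      psum m * (H_pow s (n + k) * H_pow_perp (- s) k f) - scale s (?g (k + (- 1 - int m)))" for k
  proof -
    have "n + 1 + int m + (k + (- 1 - int m)) = n + k" "k - 1 - int m = k + (- 1 - int m)"
      by simp_all
    then show ?thesis
      by (simp only: H_pow_perp_psum_mult distrib_left scale_mult_right scale_minus_left mult.left_commute[of "psum m"])
        (simp add: scale_mult_right)
  qed
  have "vertex s n (psum m * f) = Sum_any (\<lambda>k. psum m * (H_pow s (n + k) * H_pow_perp (- s) k f) + scale (- s) (?g (k + (- 1 - int m))))"
    unfolding vertex_def * by (simp add: scale_minus_left)
  also have "\<dots> = Sum_any (\<lambda>k. psum m * (H_pow s (n + k) * H_pow_perp (- s) k f)) + Sum_any (\<lambda>k. scale (- s) (?g (k + (- 1 - int m))))"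
    by (rule Sum_any.distrib[OF f]) (use g' in \<open>auto simp: scale_minus_left\<close>)
  also have "Sum_any (\<lambda>k. scale (- s) (?g (k + (- 1 - int m)))) = Sum_any (\<lambda>k. scale (- s) (?g k))"
    by (rule Sum_any_shift[of "\<lambda>k. scale (- s) (?g k)"])
  also have "\<dots> = scale (- s) (vertex s (n + 1 + int m) f)"
    unfolding vertex_def by (rule linop_Sum_any[OF linop_scale_op g, symmetric])
  also have "Sum_any (\<lambda>k. psum m * (H_pow s (n + k) * H_pow_perp (- s) k f)) = psum m * vertex s n f"
    unfolding vertex_def
    by (rule linop_Sum_any[OF linop_mult, symmetric])
      (rule finite_subset[OF _ finite_H_pow_perp[of "- s" f]], auto)
  finally show ?thesis by (simp add: scale_minus_left)
qed

lemma vertex_bounded: "\<exists>N. \<forall>n<N. vertex s n f = 0"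
proof -
  obtain N where N: "\<forall>k>N. H_pow_perp (- s) k f = 0" using H_pow_perp_bounded by blast
  have "vertex s n f = 0" if "n < - N" for n
  proof -
    have "H_pow s (n + k) * H_pow_perp (- s) k f = 0" for k
      using N that by (cases "k > N") auto
    then show ?thesis by (simp only: vertex_def Sum_any.neutral)
  qed
  then show ?thesis by blast
qed

section \<open>Commutation relations\<close>

text \<open>In generating functions, moving H(v)^r to the left past the vertex operator costs the
  factor (1 - v/u)^(r s). The hypothesis \<open>r * s = 1\<close> makes it 1 - v/u, hence the two
  terms.\<close>

lemma vertex_mult_H_pow:
  assumes rs: "r * s = 1"
  shows "vertex s a (H_pow r b * f) = H_pow r b * vertex s a f - H_pow r (b - 1) * vertex s (a + 1) f"
proof (induction "nat b" arbitrary: a b rule: less_induct)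
  case less
  show ?case
  proof (cases "b \<le> 0")
    case True
    then show ?thesis by (cases "b = 0") (simp_all add: linop_zero[OF linop_vertex])
  next
    case False
    obtain N where N: "nat b \<le> N" by blast
    have N': "nat (b - 1) \<le> N" using N by simp
    let ?g = "\<lambda>j. H_pow r (b - 1 - int j) * vertex s (a + 1 + int j) f"
    have "scale (of_int b) (vertex s a (H_pow r b * f)) = vertex s a ((scale (of_int b) (H_pow r b)) * f)"
      by (simp only: linop_scale[OF linop_vertex] scale_mult_left)
    also have "\<dots> = scale r (\<Sum>j<N. vertex s a (psum j * (H_pow r (b - 1 - int j) * f)))"
      unfolding newton_H_pow[OF N] scale_mult_left linop_scale[OF linop_vertex] sum_distrib_right
        linop_sum[OF linop_vertex] mult.assoc ..
    also have "(\<Sum>j<N. vertex s a (psum j * (H_pow r (b - 1 - int j) * f)))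
       = (\<Sum>j<N. psum j * H_pow r (b - 1 - int j) * vertex s a f - psum j * H_pow r (b - 1 - 1 - int j) * vertex s (a + 1) f
                - scale s (?g j - ?g (Suc j)))"
    proof (intro sum.cong refl)
      fix j
      have *: "vertex s a' (H_pow r (b - 1 - int j) * f)
          = H_pow r (b - 1 - int j) * vertex s a' f - H_pow r (b - 1 - int j - 1) * vertex s (a' + 1) f" for a'
        using False by (intro less) simp
      have "b - 1 - int j - 1 = b - 1 - 1 - int j" "b - 1 - int (Suc j) = b - 1 - 1 - int j"
        "a + 1 + int j + 1 = a + 1 + int (Suc j)"
        by simp_all
      then show "vertex s a (psum j * (H_pow r (b - 1 - int j) * f)) =
          psum j * H_pow r (b - 1 - int j) * vertex s a f - psum j * H_pow r (b - 1 - 1 - int j) * vertex s (a + 1) f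
                - scale s (?g j - ?g (Suc j))"
        by (simp only: vertex_psum_mult * right_diff_distrib mult.assoc)
    qed
    also have "scale r \<dots> = scale r (\<Sum>j<N. psum j * H_pow r (b - 1 - int j)) * vertex s a f
         - scale r (\<Sum>j<N. psum j * H_pow r (b - 1 - 1 - int j)) * vertex s (a + 1) f
         - scale (r * s) (\<Sum>j<N. ?g j - ?g (Suc j))"
      by (simp only: sum_subtractf scale_diff scale_sum sum_distrib_right scale_mult_left scale_scale)
    \<comment> \<open>The commutator terms telescope. The far end vanishes because its
      \<open>H_pow\<close> has index b - 1 - N < 0.\<close>
    also have "(\<Sum>j<N. ?g j - ?g (Suc j)) = ?g 0 - ?g N"
      by (rule sum_lessThan_telescope')
    also have "?g N = 0" using N by simp
    also have "scale r (\<Sum>j<N. psum j * H_pow r (b - 1 - 1 - int j)) = scale (of_int (b - 1)) (H_pow r (b - 1))"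
      by (rule newton_H_pow[OF N', symmetric])
    also have "scale r (\<Sum>j<N. psum j * H_pow r (b - 1 - int j)) = scale (of_int b) (H_pow r b)"
      by (rule newton_H_pow[OF N, symmetric])
    finally have "scale (of_int b) (vertex s a (H_pow r b * f))
        = scale (of_int b) (H_pow r b * vertex s a f - H_pow r (b - 1) * vertex s (a + 1) f)"
      by (simp add: rs scale_diff scale_diff_left scale_mult_left left_diff_distrib)
    then show ?thesis using False by - (rule scale_cancel[of "of_int b"], simp_all)
  qed
qed

text \<open>At 1, \<open>vertex_mult_H_pow\<close> turns the sum into four products that cancel in
  pairs. The commutator of the sum with a power sum is a combination of the same sum at shifted
  indices, so vanishing propagates for all n and m at once.\<close>

lemma vertex_anticommute:
  assumes s: "s * s = 1"
  shows "vertex s (n - 1) (vertex s m f) = - vertex s (m - 1) (vertex s n f)"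
proof -
  have "vertex s (n - 1) (vertex s m f) + vertex s (m - 1) (vertex s n f) = 0" (is "?W n m f = 0")
  proof (induction f arbitrary: n m rule: sym_induct)
    case (add f g)
    have "?W n m (f + g) = ?W n m f + ?W n m g" by (simp add: linop_add[OF linop_vertex])
    then show ?case by (simp only: add) simp
  next
    case (scale c f)
    have "?W n m (scale c f) = scale c (?W n m f)"
      by (simp add: linop_scale[OF linop_vertex] scale_add)
    then show ?case by (simp only: scale) simp
  next
    case one
    have *: "vertex s a (H_pow s b) = H_pow s b * H_pow s a - H_pow s (b - 1) * H_pow s (a + 1)" for a b
      using vertex_mult_H_pow[OF s, of a b 1] by simp
    show ?case by (simp add: * mult.commute)
  next
    case (psum_mult k f)
    have e: "n - 1 + 1 + int k = n + 1 + int k - 1" "m - 1 + 1 + int k = m + 1 + int k - 1" by simp_all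
    have "?W n m (psum k * f) = psum k * ?W n m f - scale s (?W (n + 1 + int k) m f) - scale s (?W n (m + 1 + int k) f)"
      unfolding vertex_psum_mult linop_diff[OF linop_vertex] linop_scale[OF linop_vertex] scale_add distrib_left scale_diff e
      by (simp only: add_diff_eq diff_add_eq diff_diff_eq add.assoc add.commute add.left_commute)
    then show ?case by (simp only: psum_mult) simp
  qed
  then show ?thesis by (simp add: eq_neg_iff_add_eq_0)
qed

lemma vertex_same: "s * s = 1 \<Longrightarrow> vertex s (n - 1) (vertex s n f) = 0"
proof -
  assume "s * s = 1"
  then have "vertex s (n - 1) (vertex s n f) + vertex s (n - 1) (vertex s n f) = 0"
    using vertex_anticommute[of s n n f] by (simp add: eq_neg_iff_add_eq_0)
  then have "scale 2 (vertex s (n - 1) (vertex s n f)) = 0"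
    using scale_add_left[of 1 1 "vertex s (n - 1) (vertex s n f)"] by simp
  then show ?thesis by simp
qed

text \<open>Here the exchange factor is (1 - v/u)^(-r r), a geometric series because
  \<open>r * r = 1\<close>; all its coefficients are 1.\<close>

lemma H_pow_perp_H_pow:
  assumes r: "r * r = 1"
  shows "H_pow_perp r k (H_pow r b) = (if k < 0 then 0 else H_pow r (b - k))"
proof (induction "nat k" arbitrary: k rule: less_induct)
  case less
  show ?case
  proof (cases "k \<le> 0")
    case True
    then show ?thesis by (cases "k = 0") simp_all
  next
    case False
    have "scale (of_int k) (H_pow_perp r k (H_pow r b)) = scale r (\<Sum>j<nat k. psum_perp j (H_pow_perp r (k - 1 - int j) (H_pow r b)))"
      by (rule newton_H_pow_perp) simp
    also have "(\<Sum>j<nat k. psum_perp j (H_pow_perp r (k - 1 - int j) (H_pow r b))) = (\<Sum>j<nat k. scale r (H_pow r (b - k)))"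
    proof (intro sum.cong refl)
      fix j assume j: "j \<in> {..<nat k}"
      then have "H_pow_perp r (k - 1 - int j) (H_pow r b) = H_pow r (b - (k - 1 - int j))"
        by (subst less) (use j False in auto)
      moreover have "b - (k - 1 - int j) - 1 - int j = b - k" by simp
      ultimately show "psum_perp j (H_pow_perp r (k - 1 - int j) (H_pow r b)) = scale r (H_pow r (b - k))"
        by (simp only: psum_perp_H_pow)
    qed
    also have "\<dots> = scale (of_nat (nat k) * r) (H_pow r (b - k))"
      by (simp only: scale_sum_left[symmetric]) simp
    also have "scale r \<dots> = scale (of_nat (nat k) * (r * r)) (H_pow r (b - k))"
      by (simp only: scale_scale mult.left_commute)
    also have "\<dots> = scale (of_int k) (H_pow r (b - k))"
      using False by (simp add: r)
    finally show ?thesis using False by - (rule scale_cancel[of "of_int k"], simp_all)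
  qed
qed

text \<open>The identity H(u)^s H(u)^(-s) = 1. For n > 0, n times the coefficient splits into i and
  n - i, Newton's recursion is applied to each factor, and the two results differ only in
  sign.\<close>

lemma H_pow_convolution:
  "Sum_any (\<lambda>i. H_pow s i * H_pow (- s) (n - i)) = (if n = 0 then 1 else 0)"
proof -
  let ?c = "\<lambda>n. Sum_any (\<lambda>i. H_pow s i * H_pow (- s) (n - i))"
  have c: "?c n = (\<Sum>i=0..n. H_pow s i * H_pow (- s) (n - i))" for n
    by (rule Sum_any_between) simp_all
  consider "n < 0" | "n = 0" | "n > 0" by linarith
  then show ?thesis
  proof cases
    case 3
    define N where "N = nat n"
    let ?x = "\<lambda>i j. psum j * (H_pow s (i - 1 - int j) * H_pow (- s) (n - i))"
    let ?y = "\<lambda>i j. psum j * (H_pow s i * H_pow (- s) (n - i - 1 - int j))"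
    \<comment> \<open>Shifting i by j + 1 moves the drop in degree from the first factor to the
      second; outside 0..n all terms vanish.\<close>
    have xy: "(\<Sum>i=0..n. ?x i j) = (\<Sum>i=0..n. ?y i j)" for j
    proof -
      let ?g = "\<lambda>i. psum j * (H_pow s i * H_pow (- s) (n - i - 1 - int j))"
      have "(\<Sum>i=0..n. ?x i j) = Sum_any (\<lambda>i. ?x i j)"
        by (rule Sum_any_between[symmetric]) simp_all
      also have "\<dots> = Sum_any (\<lambda>i. ?g (i + (- 1 - int j)))"
        by (rule Sum_any.cong) (simp add: algebra_simps)
      also have "\<dots> = Sum_any ?g" by (rule Sum_any_shift)
      also have "\<dots> = (\<Sum>i=0..n. ?y i j)"
        by (rule Sum_any_between) simp_all
      finally show ?thesis .
    qed
    have "scale (of_int n) (?c n) = (\<Sum>i=0..n. scale (of_int i) (H_pow s i) * H_pow (- s) (n - i) +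
        H_pow s i * scale (of_int (n - i)) (H_pow (- s) (n - i)))"
      unfolding c scale_sum
      by (intro sum.cong refl) (simp add: scale_mult_left scale_mult_right scale_add_left[symmetric])
    also have "\<dots> = (\<Sum>i=0..n. scale s (\<Sum>j<N. ?x i j) + scale (- s) (\<Sum>j<N. ?y i j))"
    proof (intro sum.cong refl)
      fix i assume "i \<in> {0..n}"
      then have N: "nat i \<le> N" "nat (n - i) \<le> N" by (auto simp: N_def)
      show "scale (of_int i) (H_pow s i) * H_pow (- s) (n - i) + H_pow s i * scale (of_int (n - i)) (H_pow (- s) (n - i))
          = scale s (\<Sum>j<N. ?x i j) + scale (- s) (\<Sum>j<N. ?y i j)"
        unfolding newton_H_pow[OF N(1)] newton_H_pow[OF N(2)] scale_mult_left scale_mult_right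
          sum_distrib_left sum_distrib_right
        by (simp add: mult.assoc mult.left_commute)
    qed
    also have "\<dots> = scale s (\<Sum>j<N. \<Sum>i=0..n. ?x i j) + scale (- s) (\<Sum>j<N. \<Sum>i=0..n. ?y i j)"
      by (simp only: sum.distrib scale_sum[symmetric] sum.swap[of _ "{0..n}"])
    also have "\<dots> = 0" unfolding xy by (simp add: scale_minus_left)
    finally show ?thesis using 3 by - (rule scale_cancel[of "of_int n"], simp_all)
  next
    case 2
    then show ?thesis using c[of 0] by simp
  qed (simp add: c)
qed

text \<open>By the geometric series of \<open>H_pow_perp_H_pow\<close> this is one half of the
  convolution of \<open>H_pow s\<close> and \<open>H_pow (- s)\<close>, cut at i = a.\<close>

lemma vertex_H_pow_opposite:
  assumes s: "s * s = 1"
  shows "vertex s a (H_pow (- s) b) = Sum_any (\<lambda>i. if i \<ge> a then H_pow s i * H_pow (- s) (a + b - i) else 0)"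
proof -
  have "vertex s a (H_pow (- s) b) = Sum_any (\<lambda>k. if k \<ge> 0 then H_pow s (a + k) * H_pow (- s) (b - k) else 0)"
    unfolding vertex_def using s by (intro Sum_any.cong) (auto simp: H_pow_perp_H_pow)
  also have "\<dots> = Sum_any (\<lambda>k. (\<lambda>i. if i \<ge> a then H_pow s i * H_pow (- s) (a + b - i) else 0) (k + a))"
    by (intro Sum_any.cong) (auto simp: add.commute)
  also have "\<dots> = Sum_any (\<lambda>i. if i \<ge> a then H_pow s i * H_pow (- s) (a + b - i) else 0)"
    by (rule Sum_any_shift)
  finally show ?thesis .
qed

text \<open>At 1 the two products are the complementary halves i > a and i \<le> a of a convolution,
  whose value is 1 or 0. The commutators with a power sum carry opposite signs, and the two
  correction terms have the same index sum, so they cancel by the induction hypothesis.\<close>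

lemma vertex_opposite:
  assumes s: "s * s = 1"
  shows "vertex s (a + 1) (vertex (- s) b f) + vertex (- s) (b + 1) (vertex s a f) = (if a + b = - 1 then f else 0)"
    (is "?Z a b f = _")
proof (induction f arbitrary: a b rule: sym_induct)
  case (add f g)
  have "?Z a b (f + g) = ?Z a b f + ?Z a b g" by (simp add: linop_add[OF linop_vertex])
  then show ?case by (simp only: add) simp
next
  case (scale c f)
  have "?Z a b (scale c f) = scale c (?Z a b f)"
    by (simp add: linop_scale[OF linop_vertex] scale_add)
  then show ?case by (simp only: scale) simp
next
  case one
  let ?n = "a + b + 1"
  let ?h = "\<lambda>i. H_pow s i * H_pow (- s) (?n - i)"
  have 1: "vertex s (a + 1) (H_pow (- s) b) = Sum_any (\<lambda>i. if i \<ge> a + 1 then ?h i else 0)"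
    unfolding vertex_H_pow_opposite[OF s] by (intro Sum_any.cong) (simp add: algebra_simps)
  have "vertex (- s) (b + 1) (H_pow s a) = Sum_any (\<lambda>i. if i \<ge> b + 1 then H_pow (- s) i * H_pow s (?n - i) else 0)"
  proof -
    have "b + 1 + a = ?n" "- s * - s = 1" using s by simp_all
    then show ?thesis using vertex_H_pow_opposite[of "- s" "b + 1" a] by (simp only: minus_minus)
  qed
  also have "\<dots> = Sum_any (\<lambda>i. (\<lambda>i. if i \<ge> b + 1 then H_pow (- s) i * H_pow s (?n - i) else 0) (?n - i))"
    by (rule Sum_any_reflect[symmetric])
  also have "\<dots> = Sum_any (\<lambda>i. if i \<le> a then ?h i else 0)"
    by (intro Sum_any.cong) (simp add: mult.commute)
  finally have 2: "vertex (- s) (b + 1) (H_pow s a) = Sum_any (\<lambda>i. if i \<le> a then ?h i else 0)" .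
  have "Sum_any (\<lambda>i. if i \<ge> a + 1 then ?h i else 0) + Sum_any (\<lambda>i. if i \<le> a then ?h i else 0)
      = Sum_any (\<lambda>i. (if i \<ge> a + 1 then ?h i else 0) + (if i \<le> a then ?h i else 0))"
    by (intro Sum_any.distrib[symmetric] finite_between[of 0 _ ?n]) auto
  also have "\<dots> = Sum_any ?h"
    by (intro Sum_any.cong) auto
  also have "\<dots> = (if ?n = 0 then 1 else 0)" by (rule H_pow_convolution)
  finally show ?case by (simp add: 1 2 eq_neg_iff_add_eq_0)
next
  case (psum_mult m f)
  have e: "a + 1 + 1 + int m = a + 1 + int m + 1" "b + 1 + 1 + int m = b + 1 + int m + 1" by simp_all
  have "?Z a b (psum m * f) = psum m * ?Z a b f - scale s (?Z (a + 1 + int m) b f) + scale s (?Z a (b + 1 + int m) f)"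
    by (simp only: vertex_psum_mult linop_diff[OF linop_vertex] linop_minus[OF linop_vertex] linop_scale[OF linop_vertex] scale_add
        distrib_left e scale_diff scale_minus_left) simp
  then show ?case by (simp only: psum_mult) (simp add: algebra_simps)
qed

text \<open>Taking adjoints exchanges the multiplication factor and the derivation factor; the
  summation index is shifted by n to restore the shape of a vertex operator.\<close>

lemma pform_vertex: "pform (vertex s n f) g = pform f (vertex (- s) (- n) g)"
proof -
  have K: "finite {k. H_pow s (n + k) * H_pow_perp (- s) k f \<noteq> 0}" for n
    by (rule finite_subset[OF _ finite_H_pow_perp[of "- s" f]]) auto
  have lin: "\<phi> (vertex s n f) = Sum_any (\<lambda>k. \<phi> (H_pow s (n + k) * H_pow_perp (- s) k f))" if "linfun \<phi>" for \<phi> s n f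
    by (subst vertex_eq_sum[OF finite_H_pow_perp order.refl], subst linfun_sum[OF that],
      rule Sum_any.expand_superset[symmetric, OF finite_H_pow_perp]) (auto simp: linfun_zero[OF that])
  have "pform (vertex s n f) g = Sum_any (\<lambda>k. pform (H_pow s (n + k) * H_pow_perp (- s) k f) g)"
    by (rule lin[OF linfun_pform_left])
  also have "\<dots> = Sum_any (\<lambda>k. (\<lambda>k. pform f (H_pow (- s) (- n + k) * H_pow_perp s k g)) (k + n))"
  proof (rule Sum_any.cong)
    fix k
    have "pform (H_pow s (n + k) * H_pow_perp (- s) k f) g = pform (H_pow_perp s (n + k) g) (H_pow_perp (- s) k f)"
      by (simp only: pform_H_pow pform_commute[of "H_pow_perp s (n + k) g"])
    also have "\<dots> = pform (H_pow (- s) k * H_pow_perp s (n + k) g) f"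
      by (simp add: pform_H_pow)
    finally show "pform (H_pow s (n + k) * H_pow_perp (- s) k f) g = pform f (H_pow (- s) (- n + (k + n)) * H_pow_perp s (k + n) g)"
      by (simp add: pform_commute add.commute)
  qed
  also have "\<dots> = Sum_any (\<lambda>k. pform f (H_pow (- s) (- n + k) * H_pow_perp s k g))"
    by (rule Sum_any_shift)
  also have "\<dots> = pform f (vertex (- s) (- n) g)"
    using lin[OF linfun_pform, of f "- s" "- n" g] by simp
  finally show ?thesis .
qed

section \<open>Weights\<close>

definition wt :: "monom \<Rightarrow> int" where
  "wt a = (\<Sum>n\<in>Poly_Mapping.keys a. int (Suc n * Poly_Mapping.lookup a n))"

lemma wt_zero [simp]: "wt 0 = 0"
  by (simp add: wt_def)

lemma wt_nonneg [simp]: "wt a \<ge> 0"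
  by (simp add: wt_def sum_nonneg)

lemma wt_superset: "finite K \<Longrightarrow> Poly_Mapping.keys a \<subseteq> K \<Longrightarrow>
    wt a = (\<Sum>n\<in>K. int (Suc n * Poly_Mapping.lookup a n))"
  unfolding wt_def by (rule sum.mono_neutral_left) (auto simp: in_keys_iff)

lemma wt_unit_add [simp]: "wt (unit_mon n + b) = int (Suc n) + wt b"
proof -
  let ?K = "insert n (Poly_Mapping.keys b)"
  have *: "Poly_Mapping.keys (unit_mon n + b) \<subseteq> ?K"
    by (auto simp: in_keys_iff lookup_add split: if_splits)
  have "wt (unit_mon n + b) = (\<Sum>k\<in>?K. (if k = n then int (Suc n) else 0) + int (Suc k * Poly_Mapping.lookup b k))"
  proof (subst wt_superset[OF _ *])
    show "(\<Sum>k\<in>?K. int (Suc k * Poly_Mapping.lookup (unit_mon n + b) k)) =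
      (\<Sum>k\<in>?K. (if k = n then int (Suc n) else 0) + int (Suc k * Poly_Mapping.lookup b k))"
    proof (rule sum.cong[OF refl])
      fix k
      show "int (Suc k * Poly_Mapping.lookup (unit_mon n + b) k)
          = (if k = n then int (Suc n) else 0) + int (Suc k * Poly_Mapping.lookup b k)"
        by (simp add: lookup_add distrib_left)
    qed
  qed simp
  also have "\<dots> = int (Suc n) + (\<Sum>k\<in>?K. int (Suc k * Poly_Mapping.lookup b k))"
    unfolding sum.distrib by (subst sum.delta) simp_all
  also have "(\<Sum>k\<in>?K. int (Suc k * Poly_Mapping.lookup b k)) = wt b"
    by (rule wt_superset[symmetric]) auto
  finally show ?thesis .
qed

text \<open>A predicate on degrees treats homogeneous elements (d = c) and elements of bounded
  degree (d \<le> N) together.\<close>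

definition has_wt :: "(int \<Rightarrow> bool) \<Rightarrow> sym \<Rightarrow> bool" where
  "has_wt R f \<longleftrightarrow> (\<forall>a. Poly_Mapping.lookup f a \<noteq> 0 \<longrightarrow> R (wt a))"

lemma has_wt_zero [simp]: "has_wt R 0"
  by (simp add: has_wt_def)

lemma has_wt_add: "has_wt R f \<Longrightarrow> has_wt R g \<Longrightarrow> has_wt R (f + g)"
  unfolding has_wt_def lookup_add by (metis add.right_neutral)

lemma has_wt_scale: "has_wt R f \<Longrightarrow> has_wt R (scale c f)"
  by (auto simp: has_wt_def)

lemma has_wt_scale_cancel: "c \<noteq> 0 \<Longrightarrow> has_wt R (scale c f) \<Longrightarrow> has_wt R f"
  by (auto simp: has_wt_def)

lemma has_wt_sum: "(\<And>i. i \<in> I \<Longrightarrow> has_wt R (f i)) \<Longrightarrow> has_wt R (sum f I)"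
  by (induction I rule: infinite_finite_induct) (auto intro: has_wt_add)

lemma has_wt_psum_mult: "has_wt R f \<Longrightarrow> has_wt (\<lambda>d. R (d - 1 - int n)) (psum n * f)"
  unfolding has_wt_def
proof (intro allI impI)
  fix a assume R: "\<forall>a. Poly_Mapping.lookup f a \<noteq> 0 \<longrightarrow> R (wt a)" and a: "Poly_Mapping.lookup (psum n * f) a \<noteq> 0"
  show "R (wt a - 1 - int n)"
  proof (rule monom_cases[of a n])
    fix b assume "a = unit_mon n + b"
    then show ?thesis using R a by simp
  qed (use a lookup_psum_mult_zero in auto)
qed

lemma has_wt_psum_perp: "has_wt R f \<Longrightarrow> has_wt (\<lambda>d. R (d + 1 + int n)) (psum_perp n f)"
  unfolding has_wt_def
proof (intro allI impI)
  fix a assume R: "\<forall>a. Poly_Mapping.lookup f a \<noteq> 0 \<longrightarrow> R (wt a)" and a: "Poly_Mapping.lookup (psum_perp n f) a \<noteq> 0"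
  from a have "Poly_Mapping.lookup f (unit_mon n + a) \<noteq> 0" by (auto simp: lookup_psum_perp)
  with R have "R (wt (unit_mon n + a))" by blast
  moreover have "wt (unit_mon n + a) = wt a + 1 + int n" by simp
  ultimately show "R (wt a + 1 + int n)" by (simp only:)
qed

lemma has_wt_H_pow_mult: "has_wt R f \<Longrightarrow> has_wt (\<lambda>d. R (d - k)) (H_pow s k * f)"
proof (induction "nat k" arbitrary: k rule: less_induct)
  case less
  show ?case
  proof (cases "k \<le> 0")
    case True
    then show ?thesis using less by (cases "k = 0") simp_all
  next
    case False
    have "has_wt (\<lambda>d. R (d - k)) (psum j * (H_pow s (k - 1 - int j) * f))" for j
    proof -
      have "has_wt (\<lambda>d. R (d - (k - 1 - int j))) (H_pow s (k - 1 - int j) * f)"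
        using False by (intro less) simp_all
      from has_wt_psum_mult[OF this, of j] show ?thesis by (simp add: algebra_simps)
    qed
    then have "has_wt (\<lambda>d. R (d - k)) (scale (of_int k) (H_pow s k) * f)"
      unfolding newton_H_pow[OF order.refl] scale_mult_left sum_distrib_right mult.assoc
      by (intro has_wt_scale has_wt_sum)
    with False show ?thesis
      by (intro has_wt_scale_cancel[of "of_int k" _ "H_pow s k * f"]) (simp_all only: scale_mult_left of_int_eq_0_iff)
  qed
qed

lemma has_wt_H_pow_perp: "has_wt R f \<Longrightarrow> has_wt (\<lambda>d. R (d + k)) (H_pow_perp s k f)"
proof (induction "nat k" arbitrary: k rule: less_induct)
  case less
  show ?case
  proof (cases "k \<le> 0")
    case True
    then show ?thesis using less by (cases "k = 0") simp_all
  next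
    case False
    have "has_wt (\<lambda>d. R (d + k)) (psum_perp j (H_pow_perp s (k - 1 - int j) f))" for j
    proof -
      have "has_wt (\<lambda>d. R (d + (k - 1 - int j))) (H_pow_perp s (k - 1 - int j) f)"
        using False by (intro less) simp_all
      from has_wt_psum_perp[OF this, of j] show ?thesis by (simp add: algebra_simps)
    qed
    then have "has_wt (\<lambda>d. R (d + k)) (scale (of_int k) (H_pow_perp s k f))"
      unfolding newton_H_pow_perp[OF order.refl] by (intro has_wt_scale has_wt_sum)
    with False show ?thesis by (intro has_wt_scale_cancel[of "of_int k" _ "H_pow_perp s k f"]) simp_all
  qed
qed

lemma has_wt_vertex:
  assumes "has_wt R f"
  shows "has_wt (\<lambda>d. R (d - n)) (vertex s n f)"
proof -
  have "has_wt (\<lambda>d. R (d - n)) (H_pow s (n + k) * H_pow_perp (- s) k f)" for k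
    using has_wt_H_pow_mult[OF has_wt_H_pow_perp[OF assms, of k "- s"], of "n + k" s] by (simp add: algebra_simps)
  then show ?thesis
    by (subst vertex_eq_sum[OF finite_H_pow_perp order.refl]) (rule has_wt_sum)
qed

section \<open>Identification of the complete and elementary symmetric functions\<close>

lemma of_nat_eq_scale: "of_nat n * f = scale (of_nat n) (f :: sym)"
  by (metis scale_eq_mult single_of_nat)

lemma exp_ser_superset:
  assumes F: "fps_nth F 0 = 0" and M: "k \<le> M"
  shows "fps_nth (exp_ser F) k = (\<Sum>m\<le>M. scale (1 / fact m) (fps_nth (F ^ m) k))"
  unfolding exp_ser_def fps_nth_Abs_fps
  by (rule sum.mono_neutral_left) (use M startsby_zero_power_prefix[OF F] in auto)

text \<open>The differential equation (exp F)' = F' exp F, read off at the coefficient of u^k. It is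
  what turns the exponential into Newton's recursion.\<close>

lemma exp_ser_deriv:
  assumes F: "fps_nth F 0 = 0"
  shows "scale (of_nat (Suc k)) (fps_nth (exp_ser F) (Suc k)) =
    (\<Sum>j\<le>k. scale (of_nat (Suc j)) (fps_nth F (Suc j)) * fps_nth (exp_ser F) (k - j))"
proof -
  have deriv_nth: "fps_nth (fps_deriv G) n = scale (of_nat (Suc n)) (fps_nth G (Suc n))" for G :: "sym fps" and n
    by (simp only: fps_deriv_nth of_nat_eq_scale Suc_eq_plus1)
  have "scale (of_nat (Suc k)) (fps_nth (exp_ser F) (Suc k)) =
    (\<Sum>m\<le>Suc k. scale (1 / fact m) (fps_nth (fps_deriv (F ^ m)) k))"
    unfolding exp_ser_superset[OF F order.refl] deriv_nth scale_sum scale_scale by (simp add: mult.commute)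
  \<comment> \<open>The term m = 0 has derivative 0, and reindexing brings the upper limit from k +
    1 down to k.\<close>
  also have "\<dots> = (\<Sum>m\<le>k. scale (1 / fact (Suc m)) (fps_nth (fps_deriv (F ^ Suc m)) k))"
    by (subst sum.atMost_Suc_shift) (simp del: power_Suc fact_Suc)
  also have "\<dots> = (\<Sum>m\<le>k. scale (1 / fact m) (\<Sum>j\<le>k. fps_nth (fps_deriv F) j * fps_nth (F ^ m) (k - j)))"
  proof (intro sum.cong refl)
    fix m
    have "fps_deriv (F ^ Suc m) = of_nat (Suc m) * (fps_deriv F * F ^ m)"
      unfolding fps_deriv_power' by (simp only: diff_Suc_1 mult.assoc)
    then have "fps_nth (fps_deriv (F ^ Suc m)) k = scale (of_nat (Suc m)) (fps_nth (fps_deriv F * F ^ m) k)"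
      by (simp only: fps_of_nat[symmetric] fps_mult_left_const_nth of_nat_eq_scale)
    moreover have "1 / fact (Suc m) * of_nat (Suc m) = (1 / fact m :: complex)"
      by (simp add: field_simps del: of_nat_Suc)
    ultimately show "scale (1 / fact (Suc m)) (fps_nth (fps_deriv (F ^ Suc m)) k) =
        scale (1 / fact m) (\<Sum>j\<le>k. fps_nth (fps_deriv F) j * fps_nth (F ^ m) (k - j))"
      by (simp only: scale_scale fps_mult_nth atLeast0AtMost)
  qed
  also have "\<dots> = (\<Sum>j\<le>k. fps_nth (fps_deriv F) j * (\<Sum>m\<le>k. scale (1 / fact m) (fps_nth (F ^ m) (k - j))))"
    unfolding scale_sum sum_distrib_left scale_mult_right by (rule sum.swap)
  also have "\<dots> = (\<Sum>j\<le>k. scale (of_nat (Suc j)) (fps_nth F (Suc j)) * fps_nth (exp_ser F) (k - j))"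
  proof (intro sum.cong refl)
    fix j assume "j \<in> {..k}"
    then have "(\<Sum>m\<le>k. scale (1 / fact m) (fps_nth (F ^ m) (k - j))) = fps_nth (exp_ser F) (k - j)"
      by (intro exp_ser_superset[OF F, symmetric]) simp
    then show "fps_nth (fps_deriv F) j * (\<Sum>m\<le>k. scale (1 / fact m) (fps_nth (F ^ m) (k - j))) =
        scale (of_nat (Suc j)) (fps_nth F (Suc j)) * fps_nth (exp_ser F) (k - j)"
      by (simp only: deriv_nth)
  qed
  finally show ?thesis .
qed

lemma exp_ser_0: "fps_nth (exp_ser F) 0 = 1"
  by (simp add: exp_ser_def)

text \<open>The parameter t is the substitution of t u for u: s = t = 1 gives H(u), and s = t = -1
  gives E(u), since (-1)(-1)^n = (-1)^(n-1).\<close>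

lemma exp_ser_eq_H_pow_nat:
  assumes "fps_nth F 0 = 0"
    and F: "\<And>j. scale (of_nat (Suc j)) (fps_nth F (Suc j)) = scale (s * t ^ Suc j) (psum j)"
  shows "fps_nth (exp_ser F) k = scale (t ^ k) (H_pow_nat s k)"
proof (induction k rule: less_induct)
  case (less k)
  show ?case
  proof (cases k)
    case (Suc m)
    have "scale (of_nat (Suc m)) (fps_nth (exp_ser F) (Suc m))
      = (\<Sum>j\<le>m. scale (s * t ^ Suc j) (psum j) * scale (t ^ (m - j)) (H_pow_nat s (m - j)))"
      unfolding exp_ser_deriv[OF assms(1)] F by (intro sum.cong refl) (simp add: less Suc)
    also have "\<dots> = (\<Sum>j\<le>m. scale (s * t ^ Suc m) (psum j * H_pow_nat s (m - j)))"
    proof (intro sum.cong refl)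
      fix j assume "j \<in> {..m}"
      then have "t ^ (m - j) * (s * t ^ Suc j) = s * t ^ Suc m"
        by (simp add: power_add[symmetric] mult.left_commute)
      then show "scale (s * t ^ Suc j) (psum j) * scale (t ^ (m - j)) (H_pow_nat s (m - j)) =
          scale (s * t ^ Suc m) (psum j * H_pow_nat s (m - j))"
        by (simp only: scale_mult_left scale_mult_right scale_scale mult.commute)
    qed
    also have "\<dots> = scale (of_nat (Suc m)) (scale (t ^ Suc m) (H_pow_nat s (Suc m)))"
      by (simp add: scale_sum[symmetric] mult.commute mult.left_commute del: of_nat_Suc)
    finally show ?thesis
      unfolding Suc by (rule scale_cancel[rotated]) (simp del: of_nat_Suc)
  qed (simp add: exp_ser_0)
qed

lemma h_sym_eq: "h_sym k = H_pow 1 k"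
proof -
  have "fps_nth (exp_ser (Abs_fps (\<lambda>n. if n = 0 then 0 else scale (1 / of_nat n) (p_sym n)))) n
     = scale (1 ^ n) (H_pow_nat 1 n)" for n
    by (rule exp_ser_eq_H_pow_nat) (simp_all add: psum_def del: of_nat_Suc)
  then show ?thesis by (simp add: h_sym_def H_pow_def)
qed

lemma e_sym_eq: "e_sym k = (if even k then H_pow (- 1) k else - H_pow (- 1) k)"
proof -
  have "fps_nth (exp_ser (Abs_fps (\<lambda>n. if n = 0 then 0 else scale ((-1) ^ (n - 1) / of_nat n) (p_sym n)))) n
     = scale ((-1) ^ n) (H_pow_nat (- 1) n)" for n
    by (rule exp_ser_eq_H_pow_nat) (simp_all add: psum_def del: of_nat_Suc)
  moreover have "k \<ge> 0 \<Longrightarrow> even (nat k) \<longleftrightarrow> even k"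
    by (simp add: even_nat_iff)
  ultimately show ?thesis
    by (auto simp: e_sym_def H_pow_def scale_minus_left)
qed

section \<open>Schur functions and the vertex operator\<close>

definition gamma_word :: "int list \<Rightarrow> sym" where
  "gamma_word \<alpha> = foldr (vertex 1) \<alpha> 1"

lemma gamma_word_Nil [simp]: "gamma_word [] = 1"
  and gamma_word_Cons [simp]: "gamma_word (a # \<alpha>) = vertex 1 a (gamma_word \<alpha>)"
  by (simp_all add: gamma_word_def)

text \<open>The ring homomorphism \<open>E\<^sup>\<bottom>(-u)\<close> as a polynomial in \<open>w = 1/u\<close>.\<close>

definition Theta :: "sym \<Rightarrow> sym poly" where
  "Theta f = Abs_poly (\<lambda>k. H_pow_perp (- 1) (int k) f)"

lemma coeff_Theta: "coeff (Theta f) k = H_pow_perp (- 1) (int k) f"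
proof -
  obtain N where "\<forall>k>N. H_pow_perp (- 1) k f = 0" using H_pow_perp_bounded by blast
  then show ?thesis
    unfolding Theta_def by (subst coeff_Abs_poly[of "nat N"]) auto
qed

lemma Theta_add: "Theta (f + g) = Theta f + Theta g"
  by (rule poly_eqI) (simp add: coeff_Theta linop_add[OF linop_H_pow_perp])

lemma Theta_scale: "Theta (scale c f) = [:Poly_Mapping.single 0 c:] * Theta f"
  by (rule poly_eqI) (simp add: coeff_Theta linop_scale[OF linop_H_pow_perp], simp add: scale_eq_mult)

lemma Theta_one: "Theta 1 = 1"
  by (rule poly_eqI) (simp add: coeff_Theta H_pow_perp_one coeff_1)

text \<open>\<open>Theta\<close> substitutes p_(n+1) - w^(n+1) for p_(n+1). This is why it is
  multiplicative and may be applied to a determinant entrywise.\<close>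

lemma Theta_psum_mult: "Theta (psum n * f) = ([:psum n:] - monom 1 (Suc n)) * Theta f"
proof (rule poly_eqI)
  fix k
  show "coeff (Theta (psum n * f)) k = coeff (([:psum n:] - monom 1 (Suc n)) * Theta f) k"
    by (simp add: coeff_Theta H_pow_perp_psum_mult left_diff_distrib coeff_monom_mult scale_minus_left
        of_nat_diff del: of_nat_Suc) (simp add: algebra_simps)
qed

lemma Theta_mult: "Theta (f * g) = Theta f * Theta g"
  by (induction f rule: sym_induct)
    (simp_all add: Theta_add Theta_scale Theta_one Theta_psum_mult distrib_right scale_mult_left mult.assoc)

text \<open>The exchange factor of exponents -1 and 1 is 1 - v/u, so only k = 0 and k = 1
  survive.\<close>

lemma H_pow_perp_H_pow_opposite:
  "H_pow_perp (- 1) k (H_pow 1 b) = (if k = 0 then H_pow 1 b else if k = 1 then - H_pow 1 (b - 1) else 0)"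
proof (induction "nat k" arbitrary: k rule: less_induct)
  case less
  let ?q = "\<lambda>k. if k = 0 then H_pow 1 b else if k = 1 then - H_pow 1 (b - 1) else 0"
  show ?case
  proof (cases "k \<le> 0")
    case True
    then show ?thesis by (cases "k = 0") simp_all
  next
    case False
    have "scale (of_int k) (H_pow_perp (- 1) k (H_pow 1 b)) = scale (- 1) (\<Sum>j<nat k. psum_perp j (H_pow_perp (- 1) (k - 1 - int j) (H_pow 1 b)))"
      by (rule newton_H_pow_perp) simp
    also have "(\<Sum>j<nat k. psum_perp j (H_pow_perp (- 1) (k - 1 - int j) (H_pow 1 b))) = (\<Sum>j<nat k. psum_perp j (?q (k - 1 - int j)))"
      using False by (intro sum.cong refl arg_cong[of _ _ "psum_perp _"] less) auto
    \<comment> \<open>Only j = k - 1 and j = k - 2 meet a nonzero value of the induction hypothesis;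
      their contributions cancel when k \<ge> 2.\<close>
    also have "\<dots> = (\<Sum>j<nat k. (if j = nat (k - 1) then H_pow 1 (b - k) else 0)
        - (if j = nat (k - 2) \<and> k \<ge> 2 then H_pow 1 (b - k) else 0))"
    proof (intro sum.cong refl)
      fix j assume "j \<in> {..<nat k}"
      then consider "k = 1 + int j" | "k = 2 + int j" | "k - 1 - int j \<noteq> 0" "k - 1 - int j \<noteq> 1" by linarith
      then show "psum_perp j (?q (k - 1 - int j)) = (if j = nat (k - 1) then H_pow 1 (b - k) else 0)
        - (if j = nat (k - 2) \<and> k \<ge> 2 then H_pow 1 (b - k) else 0)"
      proof cases
        case 1
        then have "b - 1 - int j = b - k" by simp
        with 1 show ?thesis by (auto simp: psum_perp_H_pow)
      next
        case 2
        then have "b - 1 - 1 - int j = b - k" by simp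
        with 2 show ?thesis by (auto simp: psum_perp_H_pow linop_minus[OF linop_psum_perp] scale_minus_left)
      next
        case 3
        with False show ?thesis by (auto simp: linop_zero[OF linop_psum_perp])
      qed
    qed
    also have "\<dots> = H_pow 1 (b - k) - (if k \<ge> 2 then H_pow 1 (b - k) else 0)"
    proof -
      have "nat (k - 1) < nat k" "k \<ge> 2 \<Longrightarrow> nat (k - 2) < nat k" using False by auto
      then show ?thesis by (cases "k \<ge> 2") (simp_all add: sum_subtractf del: nat_less_iff)
    qed
    finally have "scale (of_int k) (H_pow_perp (- 1) k (H_pow 1 b)) = scale (- 1) (H_pow 1 (b - k) - (if k \<ge> 2 then H_pow 1 (b - k) else 0))" .
    then show ?thesis using False by (cases "k = 1") (auto simp: scale_minus_left)
  qed
qed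

lemma Theta_H_pow: "Theta (H_pow 1 b) = [:H_pow 1 b, - H_pow 1 (b - 1):]"
  by (rule poly_eqI) (auto simp: coeff_Theta H_pow_perp_H_pow_opposite coeff_pCons split: nat.split)

lemma comm_ring_hom_Theta: "comm_ring_hom Theta"
proof -
  have "Theta 0 = 0" by (rule poly_eqI) (simp add: coeff_Theta linop_zero[OF linop_H_pow_perp])
  then show ?thesis
    by unfold_locales (simp_all add: Theta_add Theta_mult Theta_one)
qed

lemma comm_ring_hom_const: "comm_ring_hom (\<lambda>c::sym. [:c:])"
  by unfold_locales (simp_all add: one_pCons)

text \<open>
  Column operations turn the matrix of \<open>schur (a # \<alpha>)\<close> with its first row replaced by the powers of
  \<open>w\<close> into \<open>Theta\<close> of the matrix of \<open>schur \<alpha>\<close>; so the cofactors of that row are the coefficients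
  of \<open>Theta (schur \<alpha>)\<close>.
\<close>

lemma coeff_Theta_schur:
  fixes \<alpha> :: "int list" and a :: int
  defines "n \<equiv> Suc (length \<alpha>)"
  defines "S \<equiv> mat n n (\<lambda>(i, j). h_sym ((a # \<alpha>) ! i - int i + int j))"
  shows "coeff (Theta (schur \<alpha>)) k = (if k < n then cofactor S 0 k else 0)"
proof -
  define N where "N = mat n n (\<lambda>(i, j). if i = 0 then monom (1::sym) j else [:S $$ (i, j):])"
  define U where "U = mat n n (\<lambda>(k, j). if k = j then 1 else if Suc k = j then - monom (1::sym) 1 else 0)"
  have N: "N \<in> carrier_mat n n" and U: "U \<in> carrier_mat n n" and S: "S \<in> carrier_mat n n"
    by (simp_all add: N_def U_def S_def)
  have detU: "det U = 1"
  proof -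
    have "upper_triangular U" by (auto simp: upper_triangular_def U_def)
    then have "det U = prod_list (diag_mat U)" by (rule det_upper_triangular[OF _ U])
    also have "diag_mat U = map (\<lambda>_. 1) [0..<n]"
      by (auto simp: diag_mat_def U_def intro!: map_cong)
    also have "prod_list \<dots> = 1" by (simp add: map_replicate_const)
    finally show ?thesis .
  qed
  have NU: "(N * U) $$ (i, j) = (if j = 0 then N $$ (i, 0) else N $$ (i, j) - monom 1 1 * N $$ (i, j - 1))"
    if ij: "i < n" "j < n" for i j
  proof -
    have "(N * U) $$ (i, j) = (\<Sum>k = 0..<n. N $$ (i, k) * U $$ (k, j))"
      using N U ij by (simp add: Matrix.scalar_prod_def)
    also have "\<dots> = (\<Sum>k = 0..<n. (if k = j then N $$ (i, k) else 0)
        + (if k = j - 1 then (if j = 0 then 0 else - (monom 1 1 * N $$ (i, k))) else 0))"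
      using ij by (intro sum.cong refl) (auto simp: U_def)
    also have "\<dots> = N $$ (i, j) + (if j = 0 then 0 else - (monom 1 1 * N $$ (i, j - 1)))"
      using ij unfolding sum.distrib by (subst (1 2) sum.delta) auto
    finally show ?thesis by auto
  qed
  \<comment> \<open>Subtracting w times the preceding column from each column sends the row 1, w,
    w^2, ... to 1, 0, 0, ...\<close>
  have row0: "(N * U) $$ (0, j) = (if j = 0 then 1 else 0)" if "j < n" for j
  proof -
    have "0 < n" using that by simp
    then show ?thesis
      using that by (cases j) (auto simp: NU, auto simp: N_def mult_monom)
  qed
  have NUc: "N * U \<in> carrier_mat n n" using N U by simp
  have "det (N * U) = (\<Sum>j<n. (N * U) $$ (0, j) * cofactor (N * U) 0 j)"
    by (rule laplace_expansion_row[OF NUc]) (simp add: n_def)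
  also have "\<dots> = (\<Sum>j<n. if j = 0 then cofactor (N * U) 0 0 else 0)"
    by (intro sum.cong refl) (auto simp: row0)
  also have "\<dots> = cofactor (N * U) 0 0" by (simp add: n_def)
  also have "\<dots> = det (mat_delete (N * U) 0 0)" by (simp add: cofactor_def)
  \<comment> \<open>The remaining entries have the form h_c - w h_(c-1), which is
    \<open>Theta\<close> of h_c.\<close>
  also have "mat_delete (N * U) 0 0 = map_mat Theta (mat (length \<alpha>) (length \<alpha>) (\<lambda>(i, j). h_sym (\<alpha> ! i - int i + int j)))"
  proof (rule eq_matI)
    fix i j assume ij: "i < dim_row (map_mat Theta (mat (length \<alpha>) (length \<alpha>) (\<lambda>(i, j). h_sym (\<alpha> ! i - int i + int j))))"
      "j < dim_col (map_mat Theta (mat (length \<alpha>) (length \<alpha>) (\<lambda>(i, j). h_sym (\<alpha> ! i - int i + int j))))"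
    then have ij': "i < length \<alpha>" "j < length \<alpha>" by simp_all
    have d: "dim_row (N * U) = n" "dim_col (N * U) = n" using NUc by auto
    have "mat_delete (N * U) 0 0 $$ (i, j) = (N * U) $$ (Suc i, Suc j)"
      unfolding mat_delete_def using d ij' by (simp add: n_def)
    also have "\<dots> = N $$ (Suc i, Suc j) - monom 1 1 * N $$ (Suc i, j)"
      using ij' by (simp add: NU n_def)
    also have "\<dots> = [:h_sym (\<alpha> ! i - int i + int j):] - monom 1 1 * [:h_sym (\<alpha> ! i - int i + int j - 1):]"
      using ij' by (simp add: N_def S_def n_def algebra_simps)
    also have "\<dots> = Theta (h_sym (\<alpha> ! i - int i + int j))"
      by (rule poly_eqI) (auto simp: h_sym_eq Theta_H_pow coeff_monom_mult coeff_pCons split: nat.split)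
    finally show "mat_delete (N * U) 0 0 $$ (i, j)
        = map_mat Theta (mat (length \<alpha>) (length \<alpha>) (\<lambda>(i, j). h_sym (\<alpha> ! i - int i + int j))) $$ (i, j)"
      using ij' by simp
  qed (use N U in \<open>auto simp: n_def mat_delete_def\<close>)
  also have "det \<dots> = Theta (schur \<alpha>)"
    unfolding schur_def by (rule comm_ring_hom.hom_det[OF comm_ring_hom_Theta])
  finally have "Theta (schur \<alpha>) = det N"
    by (simp add: det_mult[OF N U] detU)
  \<comment> \<open>Expanding along the row of powers of w, with constant cofactors, exhibits the
    determinant as a polynomial in w.\<close>
  also have "\<dots> = (\<Sum>j<n. N $$ (0, j) * cofactor N 0 j)"
    by (rule laplace_expansion_row[OF N]) (simp add: n_def)
  also have "\<dots> = (\<Sum>j<n. monom (cofactor S 0 j) j)"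
  proof (intro sum.cong refl)
    fix j assume j: "j \<in> {..<n}"
    have "mat_delete N 0 j = map_mat (\<lambda>c. [:c:]) (mat_delete S 0 j)"
      using N S j by (intro eq_matI) (auto simp: mat_delete_def N_def S_def)
    then have "det (mat_delete N 0 j) = [:det (mat_delete S 0 j):]"
      by (simp only: comm_ring_hom.hom_det[OF comm_ring_hom_const])
    moreover have "(- 1) ^ m * [:c:] = [:(- 1) ^ m * c:]" for m and c :: sym
      by (cases "even m") simp_all
    ultimately have "cofactor N 0 j = [:cofactor S 0 j:]"
      by (simp add: cofactor_def)
    moreover have "N $$ (0, j) = monom 1 j" using j by (simp add: N_def)
    ultimately show "N $$ (0, j) * cofactor N 0 j = monom (cofactor S 0 j) j"
      by (simp add: monom_altdef)
  qed
  finally have "coeff (Theta (schur \<alpha>)) k = (\<Sum>j<n. if j = k then cofactor S 0 j else 0)"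
    by (simp add: coeff_sum)
  then show ?thesis by simp
qed

text \<open>Laplace expansion along the first row is the defining sum of the vertex operator: the
  entries are h_(a+k), and the cofactors are the coefficients of E^perp(-u) on
  \<open>schur \<alpha>\<close>.\<close>

lemma schur_Cons: "schur (a # \<alpha>) = vertex 1 a (schur \<alpha>)"
proof -
  let ?n = "Suc (length \<alpha>)"
  let ?S = "mat ?n ?n (\<lambda>(i, j). h_sym ((a # \<alpha>) ! i - int i + int j))"
  have *: "H_pow_perp (- 1) k (schur \<alpha>) = (if 0 \<le> k \<and> k < int ?n then cofactor ?S 0 (nat k) else 0)" for k
  proof (cases "k < 0")
    case False
    then show ?thesis
      using coeff_Theta_schur[of \<alpha> "nat k" a] by (auto simp: coeff_Theta nat_less_iff)
  qed simp
  have "vertex 1 a (schur \<alpha>) = (\<Sum>k\<in>int ` {..<?n}. H_pow 1 (a + k) * H_pow_perp (- 1) k (schur \<alpha>))"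
  proof (rule vertex_eq_sum)
    show "{k. H_pow_perp (- 1) k (schur \<alpha>) \<noteq> 0} \<subseteq> int ` {..<?n}"
    proof
      fix k assume "k \<in> {k. H_pow_perp (- 1) k (schur \<alpha>) \<noteq> 0}"
      then have "0 \<le> k" "k < int ?n" by (auto simp only: * mem_Collect_eq split: if_splits)
      then have "k = int (nat k)" "nat k < ?n" by auto
      then show "k \<in> int ` {..<?n}" by blast
    qed
  qed simp
  also have "\<dots> = (\<Sum>k<?n. H_pow 1 (a + int k) * H_pow_perp (- 1) (int k) (schur \<alpha>))"
    by (subst sum.reindex) (auto simp del: of_nat_Suc)
  also have "\<dots> = (\<Sum>k<?n. ?S $$ (0, k) * cofactor ?S 0 k)"
    by (intro sum.cong refl) (simp add: * h_sym_eq)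
  also have "\<dots> = det ?S"
    by (rule laplace_expansion_row[symmetric]) simp_all
  finally show ?thesis by (simp add: schur_def)
qed

lemma schur_eq: "schur \<alpha> = gamma_word \<alpha>"
proof (induction \<alpha>)
  case Nil
  then show ?case by (simp add: schur_def)
next
  case (Cons a \<alpha>)
  then show ?case by (simp add: schur_Cons)
qed

text \<open>Under this bound even the last subscript in row i is negative, so the row is zero. The
  resulting lower bound on indices is what makes the later expansions finite.\<close>

lemma schur_eq_zero:
  assumes "i < length \<alpha>" "\<alpha> ! i + int (length \<alpha>) \<le> int i"
  shows "schur \<alpha> = 0"
proof -
  let ?n = "length \<alpha>"
  let ?A = "mat ?n ?n (\<lambda>(i, j). h_sym (\<alpha> ! i - int i + int j))"
  have "det ?A = (\<Sum>j<?n. ?A $$ (i, j) * cofactor ?A i j)"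
    by (rule laplace_expansion_row) (use assms in simp_all)
  also have "\<dots> = 0"
    by (intro sum.neutral) (use assms in \<open>auto simp: h_sym_eq\<close>)
  finally show ?thesis by (simp add: schur_def)
qed

lemma has_wt_schur: "has_wt (\<lambda>d. d = sum_list \<alpha>) (schur \<alpha>)"
proof (induction \<alpha>)
  case Nil
  then show ?case by (auto simp: schur_eq has_wt_def lookup_one when_def)
next
  case (Cons a \<alpha>)
  then show ?case
    using has_wt_vertex[OF Cons, of a 1] by (simp add: schur_Cons algebra_simps)
qed

text \<open>
  Adding the last variable \<open>u\<^sub>l\<close>: the factors \<open>1 - u\<^sub>l / u\<^sub>i\<close> appear when \<open>H(u\<^sub>l)\<close> is moved
  to the left through \<open>\<Gamma>(u\<^sub>i)\<close>.
\<close>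

definition shift_diff :: "nat \<times> nat \<Rightarrow> (int list \<Rightarrow> sym) \<Rightarrow> int list \<Rightarrow> sym" where
  "shift_diff = (\<lambda>(i, j) c \<beta>. c \<beta> - c (\<beta>[i := \<beta> ! i + 1, j := \<beta> ! j - 1]))"

lemma shift_diff_apply: "shift_diff (i, j) c \<beta> = c \<beta> - c (\<beta>[i := \<beta> ! i + 1, j := \<beta> ! j - 1])"
  by (simp add: shift_diff_def)

text \<open>Invariant: after the factors with i < k the multiplication by \<open>H_pow 1 b\<close>
  stands to the right of the first k vertex operators. The next factor moves it past one more, by
  \<open>vertex_mult_H_pow\<close> with r = s = 1.\<close>

lemma fold_shift_diff_last:
  assumes "length \<beta> = n" "k \<le> n"
    and c: "\<And>\<beta> b. length \<beta> = n \<Longrightarrow> c (\<beta> @ [b]) = H_pow 1 b * gamma_word \<beta>"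
  shows "fold shift_diff [(i, n). i \<leftarrow> [0..<k]] c (\<beta> @ [b]) =
     foldr (vertex 1) (take k \<beta>) (H_pow 1 b * gamma_word (drop k \<beta>))"
  using assms(1,2)
proof (induction k arbitrary: \<beta> b)
  case 0
  then show ?case by (simp add: c)
next
  case (Suc k)
  let ?G = "fold shift_diff [(i, n). i \<leftarrow> [0..<k]] c"
  let ?g = "gamma_word (drop (Suc k) \<beta>)"
  have k: "k < length \<beta>" using Suc by simp
  have lin: "linop (foldr (vertex 1) \<gamma>)" for \<gamma>
  proof (induction \<gamma>)
    case Nil
    then show ?case by (simp add: linop_def)
  next
    case (Cons a \<gamma>)
    then show ?case using linop_comp[OF linop_vertex Cons, of 1 a] by (simp add: o_def)
  qed
  have d: "drop k \<beta> = \<beta> ! k # drop (Suc k) \<beta>"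
    using k by (simp add: Cons_nth_drop_Suc)
  have "fold shift_diff [(i, n). i \<leftarrow> [0..<Suc k]] c (\<beta> @ [b])
      = ?G (\<beta> @ [b]) - ?G (\<beta>[k := \<beta> ! k + 1] @ [b - 1])"
    using k Suc by (simp add: shift_diff_apply nth_append list_update_append)
  also have "?G (\<beta> @ [b]) = foldr (vertex 1) (take k \<beta>) (H_pow 1 b * vertex 1 (\<beta> ! k) ?g)"
    using Suc by (simp add: d)
  also have "?G (\<beta>[k := \<beta> ! k + 1] @ [b - 1]) = foldr (vertex 1) (take k \<beta>) (H_pow 1 (b - 1) * vertex 1 (\<beta> ! k + 1) ?g)"
    using Suc k by (simp add: Cons_nth_drop_Suc[symmetric] drop_update_cancel)
  also have "foldr (vertex 1) (take k \<beta>) (H_pow 1 b * vertex 1 (\<beta> ! k) ?g) - foldr (vertex 1) (take k \<beta>) (H_pow 1 (b - 1) * vertex 1 (\<beta> ! k + 1) ?g)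
     = foldr (vertex 1) (take k \<beta>) (vertex 1 (\<beta> ! k) (H_pow 1 b * ?g))"
    by (simp add: linop_diff[OF lin, symmetric] vertex_mult_H_pow)
  also have "\<dots> = foldr (vertex 1) (take (Suc k) \<beta>) (H_pow 1 b * ?g)"
    using k by (simp add: take_Suc_conv_app_nth)
  finally show ?case .
qed

text \<open>Factors among the first n variables do not touch the last exponent, so its H-coefficient
  can be pulled out.\<close>

lemma fold_shift_diff_append:
  assumes "\<And>i j. (i, j) \<in> set ps \<Longrightarrow> i < n \<and> j < n" "length \<beta> = n"
  shows "fold shift_diff ps (\<lambda>\<gamma>. \<Prod>b\<leftarrow>\<gamma>. h_sym b) (\<beta> @ [b]) =
     H_pow 1 b * fold shift_diff ps (\<lambda>\<gamma>. \<Prod>b\<leftarrow>\<gamma>. h_sym b) \<beta>"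
  using assms
proof (induction ps arbitrary: \<beta> rule: rev_induct)
  case Nil
  then show ?case by (simp add: h_sym_eq mult.commute)
next
  case (snoc p ps)
  obtain i j where p: "p = (i, j)" by (cases p)
  have ij: "i < length \<beta>" "j < length \<beta>" using snoc.prems p by auto
  have IH: "fold shift_diff ps (\<lambda>\<gamma>. \<Prod>b\<leftarrow>\<gamma>. h_sym b) (\<gamma> @ [b]) =
     H_pow 1 b * fold shift_diff ps (\<lambda>\<gamma>. \<Prod>b\<leftarrow>\<gamma>. h_sym b) \<gamma>" if "length \<gamma> = n" for \<gamma>
    by (rule snoc.IH) (use snoc.prems that in auto)
  show ?case
    using ij snoc.prems by (simp add: p shift_diff_apply nth_append list_update_append IH right_diff_distrib)
qed

lemma S_coeff_eq: "S_coeff \<alpha> = schur \<alpha>"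
proof -
  let ?c = "\<lambda>n. fold shift_diff [(i, j). j \<leftarrow> [0..<n], i \<leftarrow> [0..<j]] (\<lambda>\<gamma>. \<Prod>b\<leftarrow>\<gamma>. h_sym b)"
  have "length \<alpha> = n \<Longrightarrow> ?c n \<alpha> = gamma_word \<alpha>" for n
  proof (induction n arbitrary: \<alpha>)
    case (Suc n)
    then obtain \<beta> b where \<alpha>: "\<alpha> = \<beta> @ [b]" and \<beta>: "length \<beta> = n"
      by (metis length_Suc_conv_rev)
    have "?c (Suc n) = fold shift_diff [(i, n). i \<leftarrow> [0..<n]] (?c n)"
      by simp
    moreover have "?c n (\<gamma> @ [b]) = H_pow 1 b * gamma_word \<gamma>" if "length \<gamma> = n" for \<gamma> b
      using that by (subst fold_shift_diff_append[of _ n]) (auto simp: Suc)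
    ultimately have "?c (Suc n) \<alpha> = foldr (vertex 1) \<beta> (H_pow 1 b)"
      using fold_shift_diff_last[OF \<beta> order.refl, of "?c n" b] \<beta> by (simp only: \<alpha>) simp
    then show ?case by (simp add: \<alpha> gamma_word_def)
  qed simp
  then show ?thesis by (simp add: S_coeff_def shift_diff_def schur_eq)
qed

section \<open>The scalar product and the adjoints\<close>

text \<open>Y with index -c is moved to the right through the word; each exchange lowers the index
  by 1. The delta term would need a letter equal to the current c, which is excluded, and on 1 the
  negative index gives 0.\<close>

lemma vertex_gamma_word_kill:
  "c > 0 \<Longrightarrow> \<forall>x\<in>set \<nu>. x < c \<Longrightarrow> vertex (- 1) (- c) (gamma_word \<nu>) = 0"
proof (induction \<nu> arbitrary: c)
  case Nil
  then show ?case by simp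
next
  case (Cons b \<nu>)
  have "vertex (- 1) (- c - 1) (gamma_word \<nu>) = 0"
  proof -
    have "- c - 1 = - (c + 1)" by simp
    then show ?thesis using Cons.IH[of "c + 1"] Cons.prems by (simp only:) fastforce
  qed
  then show ?case
    using vertex_opposite[of 1 b "- c - 1" "gamma_word \<nu>"] Cons.prems by (simp add: linop_zero[OF linop_vertex])
qed

lemma is_partition_Cons: "is_partition (a # \<mu>) \<longleftrightarrow> a > 0 \<and> (\<forall>x\<in>set \<mu>. x \<le> a) \<and> is_partition \<mu>"
  by (auto simp: is_partition_def)

lemma is_partition_Nil [simp]: "is_partition []"
  by (simp add: is_partition_def)

text \<open>The leading operator of the word with the larger first part is moved to the other side
  by adjunction, where it kills the word. For equal first parts it cancels the leading operator
  there, and the tails remain.\<close>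

lemma pform_gamma_word:
  "is_partition \<mu> \<Longrightarrow> is_partition \<nu> \<Longrightarrow> pform (gamma_word \<mu>) (gamma_word \<nu>) = (if \<mu> = \<nu> then 1 else 0)"
proof (induction \<mu> arbitrary: \<nu>)
  have one: "pform 1 (gamma_word (b # \<nu>)) = 0" if "is_partition (b # \<nu>)" for b \<nu>
  proof -
    have "b > 0" using that by (simp add: is_partition_Cons)
    have "pform 1 (gamma_word (b # \<nu>)) = pform (vertex 1 b (gamma_word \<nu>)) 1"
      by (simp add: pform_commute)
    also have "\<dots> = 0" using \<open>b > 0\<close> by (simp only: pform_vertex vertex_one) (simp add: linfun_zero[OF linfun_pform])
    finally show ?thesis .
  qed
  {
    case Nil
    show ?case
    proof (cases \<nu>)
      case Nil
      then show ?thesis using pform_single[of 0 1] by simp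
    next
      case (Cons b \<nu>')
      then show ?thesis using one Nil by simp
    qed
  next
    case (Cons a \<mu>)
    show ?case
    proof (cases \<nu>)
      case Nil
      then show ?thesis using one[OF Cons.prems(1)] by (simp add: pform_commute)
    next
      case (Cons b \<nu>')
      note \<nu> = Cons
      have a: "a > 0" "\<forall>x\<in>set \<mu>. x \<le> a" "is_partition \<mu>" and b: "b > 0" "\<forall>x\<in>set \<nu>'. x \<le> b" "is_partition \<nu>'"
        using Cons.prems \<nu> by (simp_all add: is_partition_Cons)
      consider "a > b" | "a < b" | "a = b" by linarith
      then show ?thesis
      proof cases
        case 1
        have "vertex (- 1) (- a) (gamma_word \<nu>) = 0"
          by (rule vertex_gamma_word_kill) (use 1 a b \<nu> in auto)
        then have "pform (gamma_word (a # \<mu>)) (gamma_word \<nu>) = 0"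
          by (simp only: gamma_word_Cons pform_vertex linfun_zero[OF linfun_pform])
        with 1 \<nu> show ?thesis by simp
      next
        case 2
        have "vertex (- 1) (- b) (gamma_word (a # \<mu>)) = 0"
          by (rule vertex_gamma_word_kill) (use 2 a b in auto)
        then have "pform (gamma_word \<nu>) (gamma_word (a # \<mu>)) = 0"
          unfolding \<nu> gamma_word_Cons[of b] by (simp only: pform_vertex linfun_zero[OF linfun_pform])
        with 2 \<nu> show ?thesis by (simp add: pform_commute)
      next
        case 3
        have "vertex (- 1) (- (a + 1)) (gamma_word \<nu>') = 0"
          by (rule vertex_gamma_word_kill) (use 3 a b in auto)
        \<comment> \<open>In the anticommutator the delta term is 1, and the exchanged product
          vanishes by the preceding line.\<close>
        then have *: "vertex (- 1) (- a) (vertex 1 a (gamma_word \<nu>')) = gamma_word \<nu>'"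
          using vertex_opposite[of 1 a "- a - 1" "gamma_word \<nu>'"] by (simp add: linop_zero[OF linop_vertex])
        have "pform (gamma_word (a # \<mu>)) (gamma_word \<nu>) = pform (gamma_word \<mu>) (gamma_word \<nu>')"
          unfolding \<nu> gamma_word_Cons pform_vertex 3[symmetric] * ..
        also have "\<dots> = (if \<mu> = \<nu>' then 1 else 0)"
          by (rule Cons.IH) (use a b in auto)
        finally show ?thesis using 3 \<nu> by simp
      qed
    qed
  }
qed

section \<open>Schur functions of partitions span the ring\<close>

inductive schur_span :: "sym \<Rightarrow> bool" where
  schur_span_gamma: "is_partition \<mu> \<Longrightarrow> schur_span (gamma_word \<mu>)"
| schur_span_add: "schur_span f \<Longrightarrow> schur_span g \<Longrightarrow> schur_span (f + g)"
| schur_span_scale: "schur_span f \<Longrightarrow> schur_span (scale c f)"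

lemma schur_span_zero: "schur_span 0"
  using schur_span_scale[OF schur_span_gamma[OF is_partition_Nil], of 0] by simp

lemma schur_span_one: "schur_span 1"
  using schur_span_gamma[OF is_partition_Nil] by simp

lemma schur_span_minus: "schur_span f \<Longrightarrow> schur_span (- f)"
  using schur_span_scale[of f "- 1"] by (simp add: scale_minus_left)

lemma schur_span_sum: "(\<And>i. i \<in> I \<Longrightarrow> schur_span (f i)) \<Longrightarrow> schur_span (sum f I)"
  by (induction I rule: infinite_finite_induct) (auto intro: schur_span_zero schur_span_add)

text \<open>The straightening rule X_n X_a = -X_(a-1) X_(n+1), for n < a - 1. The bound M is carried
  along because the inner result must have parts at most a: if its first part is a, then X_(a-1)
  kills it, and otherwise a - 1 can be put in front.\<close>

lemma vertex_gamma_word_straighten: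
  assumes "is_partition \<mu>" "\<forall>x\<in>set \<mu>. x \<le> M" "n \<le> M"
  shows "\<exists>\<nu> c. is_partition \<nu> \<and> (\<forall>x\<in>set \<nu>. x \<le> M) \<and> vertex 1 n (gamma_word \<mu>) = scale c (gamma_word \<nu>)"
proof -
  have zero: "\<exists>\<nu> c. is_partition \<nu> \<and> (\<forall>x\<in>set \<nu>. x \<le> M) \<and> 0 = scale c (gamma_word \<nu>)" for M
    by (rule exI[of _ "[]"], rule exI[of _ 0]) simp
  have up: "\<exists>\<nu> c. is_partition \<nu> \<and> (\<forall>x\<in>set \<nu>. x \<le> M) \<and> vertex 1 n (gamma_word \<mu>) = scale c (gamma_word \<nu>)"
    if "is_partition \<mu>" "\<forall>x\<in>set \<mu>. x \<le> n" "n \<le> M" for \<mu> n M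
  proof -
    have "n > 0 \<or> \<mu> = []"
      using that by (cases \<mu>) (auto simp: is_partition_Cons)
    then consider "\<mu> = []" "n < 0" | "\<mu> = []" "n = 0" | "n > 0"
      by linarith
    then show ?thesis
    proof cases
      case 1
      then show ?thesis using zero by simp
    next
      case 2
      then show ?thesis by (intro exI[of _ "[]"] exI[of _ 1]) simp
    next
      case 3
      then show ?thesis using that by (intro exI[of _ "n # \<mu>"] exI[of _ 1]) (auto simp: is_partition_Cons)
    qed
  qed
  show ?thesis
    using assms
  proof (induction \<mu> arbitrary: n M)
    case Nil
    then show ?case using up[of "[]" n M] by simp
  next
    case (Cons a \<mu>)
    note a = Cons.prems(1)[unfolded is_partition_Cons]
    consider "n \<ge> a" | "n = a - 1" | "n < a - 1" by linarith
    then show ?case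
    proof cases
      case 1
      then show ?thesis using Cons.prems a by (intro up) fastforce+
    next
      case 2
      then show ?thesis using zero[of M] vertex_same[of 1 a] by simp
    next
      case 3
      have "\<exists>\<nu> c. is_partition \<nu> \<and> (\<forall>x\<in>set \<nu>. x \<le> a) \<and> vertex 1 (n + 1) (gamma_word \<mu>) = scale c (gamma_word \<nu>)"
        using a 3 by (intro Cons.IH) auto
      then obtain \<nu> c where \<nu>: "is_partition \<nu>" "\<forall>x\<in>set \<nu>. x \<le> a"
        "vertex 1 (n + 1) (gamma_word \<mu>) = scale c (gamma_word \<nu>)" by blast
      have eq: "vertex 1 n (gamma_word (a # \<mu>)) = scale (- c) (vertex 1 (a - 1) (gamma_word \<nu>))"
        using vertex_anticommute[of 1 "n + 1" a "gamma_word \<mu>"]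
        by (simp add: \<nu>(3) linop_scale[OF linop_vertex] scale_minus_left)
      show ?thesis
      proof (cases "\<exists>\<nu>'. \<nu> = a # \<nu>'")
        case True
        then show ?thesis using eq vertex_same[of 1 a] zero[of M] by auto
      next
        case False
        have "\<forall>x\<in>set \<nu>. x \<le> a - 1"
          using False \<nu>(1,2) by (cases \<nu>) (force simp: is_partition_Cons)+
        then obtain \<nu>' c' where "is_partition \<nu>'" "\<forall>x\<in>set \<nu>'. x \<le> M" "vertex 1 (a - 1) (gamma_word \<nu>) = scale c' (gamma_word \<nu>')"
          using up[of \<nu> "a - 1" M] \<nu>(1) Cons.prems by auto
        then show ?thesis unfolding eq by (metis scale_scale)
      qed
    qed
  qed
qed

lemma schur_span_vertex: "schur_span f \<Longrightarrow> schur_span (vertex 1 n f)"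
proof (induction rule: schur_span.induct)
  case (schur_span_gamma \<mu>)
  define M where "M = Max (insert n (set \<mu>))"
  have "\<forall>x\<in>set \<mu>. x \<le> M" "n \<le> M" by (auto simp: M_def)
  from vertex_gamma_word_straighten[OF schur_span_gamma this] obtain \<nu> c
    where "is_partition \<nu>" "vertex 1 n (gamma_word \<mu>) = scale c (gamma_word \<nu>)" by blast
  then show ?case
    by (simp only: schur_span.schur_span_scale schur_span.schur_span_gamma)
qed (auto simp: linop_add[OF linop_vertex] linop_scale[OF linop_vertex] intro: schur_span.intros)

lemma schur_span_gamma_word: "schur_span (gamma_word \<alpha>)"
  by (induction \<alpha>) (simp_all add: schur_span_one schur_span_vertex)

text \<open>The power sum is pushed through the word to its end. Each exchange leaves a word with
  one letter raised by n + 1, which straightening handles; at the end only the power sum itself is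
  left.\<close>

lemma schur_span_psum_mult_gamma: "schur_span (psum n) \<Longrightarrow> schur_span (psum n * gamma_word \<alpha>)"
proof (induction \<alpha>)
  case (Cons a \<alpha>)
  have "psum n * gamma_word (a # \<alpha>) = vertex 1 a (psum n * gamma_word \<alpha>) + gamma_word ((a + 1 + int n) # \<alpha>)"
    by (simp add: vertex_psum_mult)
  moreover have "schur_span (vertex 1 a (psum n * gamma_word \<alpha>))"
    by (rule schur_span_vertex[OF Cons.IH[OF Cons.prems]])
  ultimately show ?case by (simp only: schur_span_add schur_span_gamma_word)
qed simp

text \<open>Newton's identity expresses p_(n+1) through h_(n+1) and products of smaller power sums
  with complete functions.\<close>

lemma schur_span_psum: "schur_span (psum n)"
proof (induction n rule: less_induct)
  case (less n)
  have "scale (of_nat (Suc n)) (H_pow_nat 1 (Suc n)) = (\<Sum>j\<le>n. psum j * H_pow_nat 1 (n - j))"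
    by (simp del: of_nat_Suc)
  also have "\<dots> = psum n + (\<Sum>j<n. psum j * H_pow_nat 1 (n - j))"
    by (simp add: lessThan_Suc_atMost[symmetric] add.commute)
  finally have "psum n = scale (of_nat (Suc n)) (gamma_word [int (Suc n)]) + - (\<Sum>j<n. psum j * gamma_word [int (n - j)])"
    by (simp only: gamma_word_Cons gamma_word_Nil vertex_one H_pow_int add_uminus_conv_diff add_diff_cancel_right')
  also have "schur_span \<dots>"
    by (intro schur_span_add schur_span_scale schur_span_minus schur_span_sum
        schur_span_gamma_word schur_span_psum_mult_gamma less) simp
  finally show ?case .
qed

lemma schur_span_psum_mult: "schur_span f \<Longrightarrow> schur_span (psum n * f)"
proof (induction rule: schur_span.induct)
  case (schur_span_gamma \<mu>)
  show ?case by (intro schur_span_psum_mult_gamma schur_span_psum)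
next
  case (schur_span_add f g)
  then show ?case unfolding distrib_left by (intro schur_span.schur_span_add)
next
  case (schur_span_scale f c)
  then show ?case unfolding scale_mult_right by (intro schur_span.schur_span_scale)
qed

lemma schur_span_all: "schur_span f"
  by (induction f rule: sym_induct)
    (simp_all add: schur_span_one schur_span_add schur_span_scale schur_span_psum_mult)

lemma is_schur_form_pform: "is_schur_form pform"
  unfolding is_schur_form_def
  by (simp add: pform_add_left pform_add_right pform_scale_left pform_scale_right schur_eq pform_gamma_word)

text \<open>Together with \<open>is_schur_form_pform\<close> this evaluates the description defining
  \<open>scalar_prod\<close>; bilinearity reduces it to spanning.\<close>

lemma is_schur_form_unique:
  assumes "is_schur_form B" "is_schur_form C"
  shows "B f g = C f g"
  using schur_span_all[of f]
proof (induction rule: schur_span.induct)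
  case (schur_span_gamma \<mu>)
  show ?case
    using schur_span_all[of g]
  proof (induction rule: schur_span.induct)
    case (schur_span_gamma \<nu>)
    show ?case
      using assms \<open>is_partition \<mu>\<close> \<open>is_partition \<nu>\<close> by (simp add: is_schur_form_def schur_eq)
  qed (use assms in \<open>simp_all add: is_schur_form_def\<close>)
qed (use assms in \<open>simp_all add: is_schur_form_def\<close>)

lemma scalar_prod_eq: "scalar_prod = pform"
  unfolding scalar_prod_def
  by (rule the_equality, rule is_schur_form_pform) (intro ext is_schur_form_unique is_schur_form_pform)

lemma perp_eqI:
  assumes x: "\<And>w. pform x w = pform g (f * w)"
  shows "perp f g = x"
  unfolding perp_def scalar_prod_eq
proof (rule the_equality)
  fix y assume "\<forall>w. pform y w = pform g (f * w)"
  then have "pform w y = pform w x" for w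
    unfolding pform_commute[of w y] pform_commute[of w x] by (simp add: x)
  then show "y = x" by (rule pform_eqI)
qed (simp add: x)

lemma pform_H_pow_perp: "pform (H_pow_perp s k f) w = pform f (H_pow s k * w)"
  using pform_H_pow[of s k w f] by (subst (1 2) pform_commute) simp

lemma perp_h_sym: "perp (h_sym k) f = H_pow_perp 1 k f"
  by (rule perp_eqI) (simp only: h_sym_eq pform_H_pow_perp)

lemma perp_e_sym: "perp (e_sym k) f = (if even k then H_pow_perp (- 1) k f else - H_pow_perp (- 1) k f)"
proof (rule perp_eqI)
  fix w
  have neg: "pform (- x) w = - pform x w" "pform f (- x) = - pform f x" for x
    using pform_scale_left[of "- 1" x w] pform_scale_right[of f "- 1" x] by (simp_all add: scale_minus_left)
  show "pform (if even k then H_pow_perp (- 1) k f else - H_pow_perp (- 1) k f) w = pform f (e_sym k * w)"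
    by (simp add: e_sym_eq pform_H_pow_perp neg)
qed

lemma H_Eperp: "ser_mult H_ser (ser_neg Eperp_ser) n f = vertex 1 n f"
proof -
  have "ser_mult H_ser (ser_neg Eperp_ser) n f = Sum_any (\<lambda>i. (\<lambda>k. H_pow 1 (n + k) * H_pow_perp (- 1) k f) (i + (- n)))"
    unfolding ser_mult_def
    by (rule Sum_any.cong) (simp add: H_ser_def ser_neg_def Eperp_ser_def h_sym_eq perp_e_sym)
  also have "\<dots> = vertex 1 n f"
    unfolding vertex_def by (rule Sum_any_shift)
  finally show ?thesis .
qed

lemma E_Hperp: "ser_mult (ser_neg E_ser) Hperp_ser n f = vertex (- 1) n f"
proof -
  have "ser_mult (ser_neg E_ser) Hperp_ser n f = Sum_any (\<lambda>i. (\<lambda>k. H_pow (- 1) (n + k) * H_pow_perp 1 k f) (i + (- n)))"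
    unfolding ser_mult_def
    by (rule Sum_any.cong) (simp add: E_ser_def ser_neg_def Hperp_ser_def e_sym_eq perp_h_sym)
  also have "\<dots> = vertex (- 1) n f"
    unfolding vertex_def by (simp add: Sum_any_shift[of "\<lambda>k. H_pow (- 1) (n + k) * H_pow_perp 1 k f" "- n", simplified])
  finally show ?thesis .
qed

lemma Gam_eq: "Gam j f = vertex 1 (- j) f"
  by (simp add: Gam_def H_Eperp)

section \<open>The bilinear identity\<close>

lemma linfun_Sum_any:
  assumes \<phi>: "linfun \<phi>" and fin: "finite {i. f i \<noteq> 0}"
  shows "\<phi> (Sum_any f) = Sum_any (\<lambda>i. \<phi> (f i))"
proof -
  have "Sum_any (\<lambda>i. \<phi> (f i)) = (\<Sum>i\<in>{i. f i \<noteq> 0}. \<phi> (f i))"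
    by (rule Sum_any.expand_superset[OF fin]) (auto simp: linfun_zero[OF \<phi>])
  then show ?thesis by (simp add: Sum_any.expand_set linfun_sum[OF \<phi>])
qed

lemma Sum_any_diff:
  fixes f g :: "'a \<Rightarrow> 'b::ab_group_add"
  assumes "finite {i. f i \<noteq> 0}" "finite {i. g i \<noteq> 0}"
  shows "Sum_any (\<lambda>i. f i - g i) = Sum_any f - Sum_any g"
proof -
  have "Sum_any (\<lambda>i. f i + - g i) = Sum_any f + Sum_any (\<lambda>i. - g i)"
    by (rule Sum_any.distrib) (use assms in auto)
  also have "Sum_any (\<lambda>i. - g i) = - Sum_any g"
    by (simp add: Sum_any.expand_set sum_negf)
  finally show ?thesis by simp
qed

text \<open>
  The bilinear identity \<open>\<Sum>\<^sub>n X\<^bsub>-1-n\<^esub> f \<otimes> Y\<^sub>n f = 0\<close> for \<open>X = vertex 1\<close>, \<open>Y = vertex (-1)\<close>, with a linear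
  functional applied to the second tensor factor.
\<close>

definition KP_bilinear :: "sym \<Rightarrow> bool" where
  "KP_bilinear f \<longleftrightarrow>
     (\<forall>\<phi>. linfun \<phi> \<longrightarrow> Sum_any (\<lambda>n. scale (\<phi> (vertex (- 1) n f)) (vertex 1 (- 1 - n) f)) = 0)"

text \<open>One factor vanishes for small n and the other for large n, which makes the bilinear sum
  finite.\<close>

lemma vertex_range:
  obtains a b where "\<And>n. n < a \<Longrightarrow> vertex s n f = 0" "\<And>n. n > b \<Longrightarrow> vertex t (- 1 - n) g = 0"
proof -
  obtain a c where "\<forall>n<a. vertex s n f = 0" "\<forall>n<c. vertex t n g = 0" using vertex_bounded by meson
  then show ?thesis by (intro that[of a "- c - 1"]) auto
qed

lemma finite_vertex_pair:
  assumes "\<phi> 0 = 0"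
  shows "finite {n. scale (\<phi> (vertex (- 1) n f)) (vertex 1 (- 1 - n) g) \<noteq> 0}"
proof -
  obtain a b where "\<And>n. n < a \<Longrightarrow> vertex (- 1) n f = 0" "\<And>n. n > b \<Longrightarrow> vertex 1 (- 1 - n) g = 0"
    using vertex_range by blast
  then show ?thesis using assms by (intro finite_between[of a _ b]) auto
qed

section \<open>From the bosonic Fock space to the ring of symmetric functions\<close>

lemma lookup_z_pow: "Poly_Mapping.lookup (z_pow m f) (k, x) = (if k = m then Poly_Mapping.lookup f x else 0)"
  by (simp add: z_pow_def lookup_tensor lookup_single when_def)

lemma linop_z_pow: "linop (z_pow m)"
  unfolding z_pow_def by (rule linop_tensor_right)

lemma z_pow_single: "z_pow m (Poly_Mapping.single a 1) = Poly_Mapping.single (m, a) 1"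
  by (simp add: z_pow_def tensor_single)

lemma z_pow_eq_0_iff: "z_pow m f = 0 \<longleftrightarrow> f = 0"
proof
  assume "z_pow m f = 0"
  then have "Poly_Mapping.lookup f x = 0" for x
    using lookup_z_pow[of m f m x] by simp
  then show "f = 0" by (intro poly_mapping_eqI) simp
qed (simp add: linop_zero[OF linop_z_pow])

lemma psi_plus_z_pow: "psi_plus i (z_pow m f) = z_pow (m + 1) (vertex 1 (- i - 1 - m) f)"
proof (rule linop_ext[where f = f])
  show "linop (\<lambda>f. psi_plus i (z_pow m f))"
    unfolding psi_plus_def by (rule linop_comp[OF linop_lin_ext linop_z_pow])
  show "linop (\<lambda>f. z_pow (m + 1) (vertex 1 (- i - 1 - m) f))"
    by (rule linop_comp[OF linop_z_pow linop_vertex])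
qed (simp add: z_pow_single, simp add: psi_plus_def H_Eperp)

lemma psi_minus_z_pow: "psi_minus i (z_pow m f) = z_pow (m - 1) (vertex (- 1) (- i - 1 + m) f)"
proof (rule linop_ext[where f = f])
  show "linop (\<lambda>f. psi_minus i (z_pow m f))"
    unfolding psi_minus_def by (rule linop_comp[OF linop_lin_ext linop_z_pow])
  show "linop (\<lambda>f. z_pow (m - 1) (vertex (- 1) (- i - 1 + m) f))"
    by (rule linop_comp[OF linop_z_pow linop_vertex])
qed (simp add: z_pow_single, simp add: psi_minus_def E_Hperp)

text \<open>The factors u^m and u^(-m) shift the two exponents oppositely; the substitution n = i +
  m removes m from the vertex operators.\<close>

lemma Omega_z_pow:
  "Omega (tensor (z_pow m f) (z_pow m f)) =
     Sum_any (\<lambda>n. tensor (z_pow (m + 1) (vertex 1 (- 1 - n) f)) (z_pow (m - 1) (vertex (- 1) n f)))"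
proof -
  have lin: "linop (psi_plus i)" "linop (psi_minus i)" for i
    unfolding psi_plus_def psi_minus_def by (rule linop_lin_ext)+
  have "Omega (tensor (z_pow m f) (z_pow m f)) =
     Sum_any (\<lambda>i. (\<lambda>n. tensor (z_pow (m + 1) (vertex 1 (- 1 - n) f)) (z_pow (m - 1) (vertex (- 1) n f))) (i + m))"
    unfolding Omega_def
  proof (rule Sum_any.cong)
    fix i
    have "- i - 1 - m = - 1 - (i + m)" "- (- i - 1) - 1 + m = i + m" by simp_all
    then show "tensor_op (psi_plus i) (psi_minus (- i - 1)) (tensor (z_pow m f) (z_pow m f)) =
        tensor (z_pow (m + 1) (vertex 1 (- 1 - (i + m)) f)) (z_pow (m - 1) (vertex (- 1) (i + m) f))"
      by (simp only: tensor_op_tensor[OF lin] psi_plus_z_pow psi_minus_z_pow)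
  qed
  also have "\<dots> = Sum_any (\<lambda>n. tensor (z_pow (m + 1) (vertex 1 (- 1 - n) f)) (z_pow (m - 1) (vertex (- 1) n f)))"
    by (rule Sum_any_shift)
  finally show ?thesis .
qed

text \<open>Vanishing of the tensor means vanishing of its coefficients, that is, contraction with
  coefficient functionals; only finitely many of them matter for any given functional. The
  right-hand side shows that the charge m is immaterial.\<close>

lemma KP_tau_iff: "KP_tau (z_pow m f) \<longleftrightarrow> f \<noteq> 0 \<and> KP_bilinear f"
proof -
  let ?T = "\<lambda>n. tensor (z_pow (m + 1) (vertex 1 (- 1 - n) f)) (z_pow (m - 1) (vertex (- 1) n f))"
  let ?b = "\<lambda>x y. Sum_any (\<lambda>n. Poly_Mapping.lookup (vertex (- 1) n f) y * Poly_Mapping.lookup (vertex 1 (- 1 - n) f) x)"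
  obtain a b where ab: "\<And>n. n < a \<Longrightarrow> vertex (- 1) n f = 0" "\<And>n. n > b \<Longrightarrow> vertex 1 (- 1 - n) f = 0"
    using vertex_range by blast
  have finT: "finite {n. ?T n \<noteq> 0}"
    by (rule finite_between[of a _ b])
      (simp_all add: ab linop_zero[OF linop_z_pow] linop_zero[OF linop_tensor_right] linop_zero[OF linop_tensor_left])
  have lookT: "Poly_Mapping.lookup (Sum_any ?T) ((k, x), (l, y)) = (if k = m + 1 \<and> l = m - 1 then ?b x y else 0)" for k l x y
    unfolding linfun_Sum_any[OF linfun_lookup finT]
    by (auto simp: lookup_tensor lookup_z_pow mult.commute)
  have lookK: "Poly_Mapping.lookup (Sum_any (\<lambda>n. scale (\<phi> (vertex (- 1) n f)) (vertex 1 (- 1 - n) f))) x =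
      Sum_any (\<lambda>n. \<phi> (vertex (- 1) n f) * Poly_Mapping.lookup (vertex 1 (- 1 - n) f) x)" if "linfun \<phi>" for \<phi> x
    by (subst linfun_Sum_any[OF linfun_lookup finite_vertex_pair]) (simp_all add: linfun_zero[OF that])
  have "KP_bilinear f \<longleftrightarrow> (\<forall>x y. ?b x y = 0)"
  proof
    assume "KP_bilinear f"
    then have "Sum_any (\<lambda>n. scale (Poly_Mapping.lookup (vertex (- 1) n f) y) (vertex 1 (- 1 - n) f)) = 0" for y
      unfolding KP_bilinear_def using linfun_lookup[of y] by blast
    then show "\<forall>x y. ?b x y = 0"
      by (simp only: lookK[OF linfun_lookup, symmetric] lookup_zero) simp
  next
    assume b: "\<forall>x y. ?b x y = 0"
    show "KP_bilinear f"
      unfolding KP_bilinear_def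
    proof (intro allI impI poly_mapping_eqI)
      fix \<phi> :: "sym \<Rightarrow> complex" and x assume \<phi>: "linfun \<phi>"
      \<comment> \<open>All monomials that occur in the second factor; on these elements the
        functional is a combination of finitely many coefficient functionals.\<close>
      define K where "K = (\<Union>n\<in>{a..b}. Poly_Mapping.keys (vertex (- 1) n f))"
      have K: "finite K" by (simp add: K_def)
      have \<phi>_eq: "\<phi> (vertex (- 1) n f) = (\<Sum>y\<in>K. Poly_Mapping.lookup (vertex (- 1) n f) y * \<phi> (Poly_Mapping.single y 1))"
        if "n \<in> {a..b}" for n
      proof -
        have "\<phi> (vertex (- 1) n f) = \<phi> (\<Sum>y\<in>Poly_Mapping.keys (vertex (- 1) n f).
            scale (Poly_Mapping.lookup (vertex (- 1) n f) y) (Poly_Mapping.single y 1))"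
          by (simp add: sum_single)
        also have "\<dots> = (\<Sum>y\<in>Poly_Mapping.keys (vertex (- 1) n f). Poly_Mapping.lookup (vertex (- 1) n f) y * \<phi> (Poly_Mapping.single y 1))"
          by (simp only: linfun_sum[OF \<phi>] linfun_scale[OF \<phi>])
        also have "\<dots> = (\<Sum>y\<in>K. Poly_Mapping.lookup (vertex (- 1) n f) y * \<phi> (Poly_Mapping.single y 1))"
          by (rule sum.mono_neutral_left[OF K]) (use that in \<open>auto simp: K_def in_keys_iff\<close>)
        finally show ?thesis .
      qed
      have "Sum_any (\<lambda>n. \<phi> (vertex (- 1) n f) * Poly_Mapping.lookup (vertex 1 (- 1 - n) f) x)
          = (\<Sum>n=a..b. \<phi> (vertex (- 1) n f) * Poly_Mapping.lookup (vertex 1 (- 1 - n) f) x)"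
        by (rule Sum_any_between) (simp_all add: ab linfun_zero[OF \<phi>])
      also have "\<dots> = (\<Sum>n=a..b. \<Sum>y\<in>K. \<phi> (Poly_Mapping.single y 1) *
          (Poly_Mapping.lookup (vertex (- 1) n f) y * Poly_Mapping.lookup (vertex 1 (- 1 - n) f) x))"
        by (intro sum.cong refl) (simp only: \<phi>_eq sum_distrib_right sum_distrib_left mult_ac)
      also have "\<dots> = (\<Sum>y\<in>K. \<phi> (Poly_Mapping.single y 1) *
          (\<Sum>n=a..b. Poly_Mapping.lookup (vertex (- 1) n f) y * Poly_Mapping.lookup (vertex 1 (- 1 - n) f) x))"
        unfolding sum_distrib_left by (rule sum.swap)
      also have "\<dots> = (\<Sum>y\<in>K. \<phi> (Poly_Mapping.single y 1) * ?b x y)"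
        by (intro sum.cong refl arg_cong[of _ _ "(*) _"] Sum_any_between[symmetric]) (simp_all add: ab)
      also have "\<dots> = 0" using b by simp
      finally show "Poly_Mapping.lookup (Sum_any (\<lambda>n. scale (\<phi> (vertex (- 1) n f)) (vertex 1 (- 1 - n) f))) x
          = Poly_Mapping.lookup 0 x"
        by (simp add: lookK[OF \<phi>])
    qed
  qed
  also have "\<dots> \<longleftrightarrow> Sum_any ?T = 0"
  proof
    assume "\<forall>x y. ?b x y = 0"
    then show "Sum_any ?T = 0"
      by (intro poly_mapping_eqI) (auto simp: lookT simp del: split_paired_All)
  next
    assume "Sum_any ?T = 0"
    then show "\<forall>x y. ?b x y = 0"
      using lookT[of "m + 1" _ "m - 1"] by simp
  qed
  finally show ?thesis
    by (auto simp: KP_tau_def Omega_z_pow z_pow_eq_0_iff)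
qed

section \<open>Linear combinations of vertex operators\<close>

text \<open>A row of a \<open>row_finite\<close> matrix after the change of sign \<Gamma>_j =
  X_(-j): vanishing for small indices becomes vanishing for large ones.\<close>

definition bdd_coeffs :: "(int \<Rightarrow> complex) \<Rightarrow> bool" where
  "bdd_coeffs a \<longleftrightarrow> (\<exists>M. \<forall>j>M. a j = 0)"

definition vertex_comb :: "(int \<Rightarrow> complex) \<Rightarrow> sym \<Rightarrow> sym" where
  "vertex_comb a f = Sum_any (\<lambda>j. scale (a j) (vertex 1 j f))"

lemma bdd_coeffs_shift: "bdd_coeffs a \<Longrightarrow> bdd_coeffs (\<lambda>j. a (j + k))"
proof -
  assume "bdd_coeffs a"
  then obtain M where "\<forall>j>M. a j = 0" by (auto simp: bdd_coeffs_def)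
  then have "\<forall>j>M - k. a (j + k) = 0" by simp
  then show ?thesis unfolding bdd_coeffs_def by blast
qed

lemma finite_vertex_comb:
  assumes "bdd_coeffs a"
  shows "finite {j. scale (a j) (vertex 1 j f) \<noteq> 0}"
proof -
  obtain M N where "\<forall>j>M. a j = 0" "\<forall>j<N. vertex 1 j f = 0"
    using assms vertex_bounded[of 1 f] by (auto simp: bdd_coeffs_def)
  then show ?thesis by (intro finite_between[of N _ M]) auto
qed

lemma linop_vertex_comb:
  assumes "bdd_coeffs a"
  shows "linop (vertex_comb a)"
proof (rule linopI)
  fix f g
  show "vertex_comb a (f + g) = vertex_comb a f + vertex_comb a g"
    unfolding vertex_comb_def linop_add[OF linop_vertex] scale_add
    by (rule Sum_any.distrib[OF finite_vertex_comb[OF assms] finite_vertex_comb[OF assms]])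
next
  fix c f
  have "vertex_comb a (scale c f) = Sum_any (\<lambda>j. scale c (scale (a j) (vertex 1 j f)))"
    unfolding vertex_comb_def by (simp add: linop_scale[OF linop_vertex] mult.commute)
  also have "\<dots> = scale c (vertex_comb a f)"
    unfolding vertex_comb_def by (rule linop_Sum_any[OF linop_scale_op finite_vertex_comb[OF assms], symmetric])
  finally show "vertex_comb a (scale c f) = scale c (vertex_comb a f)" .
qed

text \<open>The square of a fermion is 0. The coefficients of the outer operator are shifted by 1
  because the fermion changes the charge; the double sum then equals its own negative.\<close>

lemma vertex_comb_shift_vertex_comb:
  assumes "bdd_coeffs a"
  shows "vertex_comb (\<lambda>j. a (j + 1)) (vertex_comb a f) = 0"
proof -
  obtain M N where M: "\<forall>j>M. a j = 0" and N: "\<forall>j<N. vertex 1 j f = 0"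
    using assms vertex_bounded[of 1 f] by (auto simp: bdd_coeffs_def)
  let ?t = "\<lambda>j k. scale (a j * a k) (vertex 1 (j - 1) (vertex 1 k f))"
  have anti: "?t j k = - ?t k j" for j k
    using vertex_anticommute[of 1 j k f] by (simp add: scale_minus mult.commute)
  have "vertex_comb a f = (\<Sum>k=N..M. scale (a k) (vertex 1 k f))"
    unfolding vertex_comb_def by (rule Sum_any_between) (simp_all add: M N)
  then have "vertex_comb (\<lambda>j. a (j + 1)) (vertex_comb a f) = Sum_any (\<lambda>j. (\<lambda>j. \<Sum>k=N..M. ?t j k) (j + 1))"
    unfolding vertex_comb_def
    by (simp add: linop_sum[OF linop_vertex] linop_scale[OF linop_vertex] scale_sum)
  also have "\<dots> = Sum_any (\<lambda>j. \<Sum>k=N..M. ?t j k)" by (rule Sum_any_shift)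
  also have "\<dots> = (\<Sum>j=N..M. \<Sum>k=N..M. ?t j k)"
  proof (rule Sum_any_between)
    fix j assume "j < N"
    \<comment> \<open>For j < N the bound on the inner operator applies only after the two operators
      have been exchanged.\<close>
    then have "?t j k = 0" for k
      by (subst anti) (simp add: N linop_zero[OF linop_vertex])
    then show "(\<Sum>k=N..M. ?t j k) = 0" by (intro sum.neutral) simp
  qed (simp add: M)
  finally have eq: "vertex_comb (\<lambda>j. a (j + 1)) (vertex_comb a f) = (\<Sum>j=N..M. \<Sum>k=N..M. ?t j k)" .
  have "(\<Sum>j=N..M. \<Sum>k=N..M. ?t j k) = (\<Sum>k=N..M. \<Sum>j=N..M. ?t j k)"
    by (rule sum.swap)
  also have "\<dots> = (\<Sum>k=N..M. \<Sum>j=N..M. - ?t k j)"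
    by (subst anti) simp
  also have "\<dots> = - (\<Sum>j=N..M. \<Sum>k=N..M. ?t j k)"
    by (simp only: sum_negf)
  finally have "(\<Sum>j=N..M. \<Sum>k=N..M. ?t j k) + (\<Sum>j=N..M. \<Sum>k=N..M. ?t j k) = 0"
    by (simp only: eq_neg_iff_add_eq_0)
  then have "scale 2 (\<Sum>j=N..M. \<Sum>k=N..M. ?t j k) = 0"
    using scale_add_left[of 1 1 "\<Sum>j=N..M. \<Sum>k=N..M. ?t j k"] by (simp only: scale_one one_add_one)
  then show ?thesis unfolding eq by (simp only: scale_eq_0_iff) simp
qed

text \<open>The anticommutator contributes only at j = -n; in the exchanged term the index of every
  operator in the combination rises by 1, recorded as a shift of the coefficients.\<close>

lemma vertex_minus_vertex_comb:
  assumes a: "bdd_coeffs a"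
  shows "vertex (- 1) n (vertex_comb a f) = scale (a (- n)) f - vertex_comb (\<lambda>j. a (j - 1)) (vertex (- 1) (n - 1) f)"
proof -
  let ?u = "\<lambda>j. scale (a j) (if j = - n then f else 0)"
  let ?v = "\<lambda>j. scale (a j) (vertex 1 (j + 1) (vertex (- 1) (n - 1) f))"
  have shift: "?v = (\<lambda>j. (\<lambda>j. scale (a (j - 1)) (vertex 1 j (vertex (- 1) (n - 1) f))) (j + 1))"
    by simp
  have fin: "finite {j. (\<lambda>j. scale (a (j - 1)) (vertex 1 j (vertex (- 1) (n - 1) f))) j \<noteq> 0}"
    using finite_vertex_comb[OF bdd_coeffs_shift[OF a, of "- 1"]] by simp
  have "vertex (- 1) n (vertex_comb a f) = Sum_any (\<lambda>j. scale (a j) (vertex (- 1) n (vertex 1 j f)))"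
    unfolding vertex_comb_def linop_Sum_any[OF linop_vertex finite_vertex_comb[OF a]] by (simp add: linop_scale[OF linop_vertex])
  also have "\<dots> = Sum_any (\<lambda>j. ?u j - ?v j)"
  proof (rule Sum_any.cong)
    fix j
    have "vertex (- 1) n (vertex 1 j f) = (if j = - n then f else 0) - vertex 1 (j + 1) (vertex (- 1) (n - 1) f)"
      using vertex_opposite[of 1 j "n - 1" f] by (auto simp: algebra_simps)
    then show "scale (a j) (vertex (- 1) n (vertex 1 j f)) = ?u j - ?v j"
      by (simp only: scale_diff)
  qed
  also have "\<dots> = Sum_any ?u - Sum_any ?v"
  proof (rule Sum_any_diff)
    show "finite {j. ?u j \<noteq> 0}"
      by (rule finite_subset[of _ "{- n}"]) auto
    have "finite ((\<lambda>j. j + 1) -` {j. scale (a (j - 1)) (vertex 1 j (vertex (- 1) (n - 1) f)) \<noteq> 0})"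
      by (rule finite_vimageI[OF fin]) simp
    then show "finite {j. ?v j \<noteq> 0}" by (simp add: vimage_def)
  qed
  also have "Sum_any ?u = scale (a (- n)) f"
    by (subst Sum_any.expand_superset[of "{- n}"]) auto
  also have "Sum_any ?v = vertex_comb (\<lambda>j. a (j - 1)) (vertex (- 1) (n - 1) f)"
    unfolding shift vertex_comb_def by (rule Sum_any_shift)
  finally show ?thesis .
qed

lemma vertex_plus_vertex_comb:
  assumes a: "bdd_coeffs a"
  shows "vertex 1 (- 1 - n) (vertex_comb a f) = - vertex_comb (\<lambda>j. a (j + 1)) (vertex 1 (- n) f)"
proof -
  have "vertex 1 (- 1 - n) (vertex_comb a f) = Sum_any (\<lambda>j. scale (a j) (vertex 1 (- 1 - n) (vertex 1 j f)))"
    unfolding vertex_comb_def linop_Sum_any[OF linop_vertex finite_vertex_comb[OF a]] by (simp add: linop_scale[OF linop_vertex])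
  also have "\<dots> = Sum_any (\<lambda>j. (\<lambda>j. scale (- a (j + 1)) (vertex 1 j (vertex 1 (- n) f))) (j + (- 1)))"
  proof (rule Sum_any.cong)
    fix j
    have "vertex 1 (- 1 - n) (vertex 1 j f) = - vertex 1 (j - 1) (vertex 1 (- n) f)"
    proof -
      have "- 1 - n = - n - 1" by simp
      then show ?thesis using vertex_anticommute[of 1 "- n" j f] by (simp only:) simp
    qed
    then show "scale (a j) (vertex 1 (- 1 - n) (vertex 1 j f)) = scale (- a (j + - 1 + 1)) (vertex 1 (j + - 1) (vertex 1 (- n) f))"
      by (simp add: scale_minus scale_minus_left)
  qed
  also have "\<dots> = Sum_any (\<lambda>j. scale (- a (j + 1)) (vertex 1 j (vertex 1 (- n) f)))"
    by (rule Sum_any_shift)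
  also have "\<dots> = - vertex_comb (\<lambda>j. a (j + 1)) (vertex 1 (- n) f)"
    unfolding vertex_comb_def by (simp add: Sum_any.expand_set sum_negf scale_minus_left)
  finally show ?thesis .
qed

text \<open>
  With \<open>v = vertex_comb a\<close>, the operator \<open>\<Omega>\<close> commutes with \<open>v \<otimes> v\<close> up to a term containing the square of the
  fermion behind \<open>v\<close>, which vanishes.
\<close>

lemma KP_bilinear_vertex_comb:
  assumes a: "bdd_coeffs a" and f: "KP_bilinear f"
  shows "KP_bilinear (vertex_comb a f)"
  unfolding KP_bilinear_def
proof (intro allI impI)
  fix \<phi> :: "sym \<Rightarrow> complex" assume \<phi>: "linfun \<phi>"
  let ?a1 = "\<lambda>j. a (j - 1)" and ?a2 = "\<lambda>j. a (j + 1)"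
  have a1: "bdd_coeffs ?a1" and a2: "bdd_coeffs ?a2"
    using bdd_coeffs_shift[OF a, of "- 1"] bdd_coeffs_shift[OF a, of 1] by simp_all
  \<comment> \<open>The operator acting on the second factor is absorbed into the functional, so the
    hypothesis on f applies to the \<open>?p\<close> terms.\<close>
  let ?\<psi> = "\<lambda>g. \<phi> (vertex_comb ?a1 g)"
  have \<psi>: "linfun ?\<psi>" by (rule linfun_comp[OF \<phi> linop_vertex_comb[OF a1]])
  let ?p = "\<lambda>n. scale (?\<psi> (vertex (- 1) (n - 1) f)) (vertex 1 (- n) f)"
  let ?q = "\<lambda>n. scale (\<phi> f) (scale (a (- n)) (vertex 1 (- n) f))"
  let ?p' = "\<lambda>n. scale (?\<psi> (vertex (- 1) n f)) (vertex 1 (- 1 - n) f)"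
  have pp: "?p = (\<lambda>n. ?p' (n + (- 1)))" by (simp add: fun_eq_iff)
  have finp': "finite {n. ?p' n \<noteq> 0}"
    by (rule finite_vertex_pair[of ?\<psi>]) (rule linfun_zero[OF \<psi>])
  have "finite ((\<lambda>n. n - 1) -` {n. ?p' n \<noteq> 0})"
    by (rule finite_vimageI[OF finp']) (simp add: inj_def)
  moreover have "(\<lambda>n. n - 1) -` {n. ?p' n \<noteq> 0} = {n. ?p n \<noteq> 0}"
    by (simp add: vimage_def)
  ultimately have finp: "finite {n. ?p n \<noteq> 0}" by (simp only:)
  have "finite (uminus -` {j. scale (a j) (vertex 1 j f) \<noteq> 0})"
    by (rule finite_vimageI[OF finite_vertex_comb[OF a]]) simp
  then have finq: "finite {n. scale (a (- n)) (vertex 1 (- n) f) \<noteq> 0}" by (simp only: vimage_def mem_Collect_eq)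
  have "finite {n. ?q n \<noteq> 0}" by (rule finite_subset[OF _ finq]) auto
  note fins = finp this
  have "Sum_any (\<lambda>n. scale (\<phi> (vertex (- 1) n (vertex_comb a f))) (vertex 1 (- 1 - n) (vertex_comb a f)))
      = Sum_any (\<lambda>n. vertex_comb ?a2 (?p n - ?q n))"
    by (rule Sum_any.cong)
      (simp add: vertex_minus_vertex_comb[OF a] vertex_plus_vertex_comb[OF a] linfun_diff[OF \<phi>] linfun_scale[OF \<phi>]
        linop_diff[OF linop_vertex_comb[OF a2]] linop_scale[OF linop_vertex_comb[OF a2]] scale_minus scale_diff_left mult.commute)
  also have "\<dots> = vertex_comb ?a2 (Sum_any (\<lambda>n. ?p n - ?q n))"
    by (rule linop_Sum_any[OF linop_vertex_comb[OF a2], symmetric])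
      (rule finite_subset[OF _ finite_UnI[OF fins]], auto)
  also have "Sum_any (\<lambda>n. ?p n - ?q n) = Sum_any ?p - Sum_any ?q"
    by (rule Sum_any_diff[OF fins])
  also have "Sum_any ?p = Sum_any ?p'" unfolding pp by (rule Sum_any_shift)
  also have "\<dots> = 0" using f \<psi> unfolding KP_bilinear_def by blast
  also have "Sum_any ?q = scale (\<phi> f) (Sum_any (\<lambda>n. (\<lambda>j. scale (a j) (vertex 1 j f)) (0 - n)))"
    using linop_Sum_any[OF linop_scale_op finq, of "\<phi> f"] by simp
  also have "Sum_any (\<lambda>n. (\<lambda>j. scale (a j) (vertex 1 j f)) (0 - n)) = vertex_comb a f"
    unfolding vertex_comb_def by (rule Sum_any_reflect)
  \<comment> \<open>What the anticommutators left over is a multiple of the fermion applied to f,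
    and the outer fermion kills it.\<close>
  also have "vertex_comb ?a2 (0 - scale (\<phi> f) (vertex_comb a f)) = 0"
    by (simp add: linop_minus[OF linop_vertex_comb[OF a2]] linop_scale[OF linop_vertex_comb[OF a2]] vertex_comb_shift_vertex_comb[OF a])
  finally show "Sum_any (\<lambda>n. scale (\<phi> (vertex (- 1) n (vertex_comb a f))) (vertex 1 (- 1 - n) (vertex_comb a f))) = 0" .
qed

text \<open>The indices n and -1 - n are never both nonnegative, so one factor of every term is
  zero.\<close>

lemma KP_bilinear_one: "KP_bilinear 1"
  unfolding KP_bilinear_def
proof (intro allI impI)
  fix \<phi> :: "sym \<Rightarrow> complex" assume \<phi>: "linfun \<phi>"
  have "scale (\<phi> (vertex (- 1) n 1)) (vertex 1 (- 1 - n) 1) = 0" for n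
    by (cases "n < 0") (simp_all add: linfun_zero[OF \<phi>])
  then show "Sum_any (\<lambda>n. scale (\<phi> (vertex (- 1) n 1)) (vertex 1 (- 1 - n) 1)) = 0"
    by (simp only: Sum_any.neutral)
qed

text \<open>A single Y is moved to the outside in both factors, acting as an operator on the first
  and inside the functional on the second; the delta term again meets the square of a
  fermion.\<close>

lemma KP_bilinear_vertex_minus:
  assumes f: "KP_bilinear f"
  shows "KP_bilinear (vertex (- 1) j f)"
  unfolding KP_bilinear_def
proof (intro allI impI)
  fix \<phi> :: "sym \<Rightarrow> complex" assume \<phi>: "linfun \<phi>"
  let ?\<psi> = "\<lambda>g. \<phi> (vertex (- 1) (j - 1) g)"
  have \<psi>: "linfun ?\<psi>" by (rule linfun_comp[OF \<phi> linop_vertex])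
  let ?p = "\<lambda>n. scale (?\<psi> (vertex (- 1) n f)) (vertex 1 (- 1 - n) f)"
  have "Sum_any (\<lambda>n. scale (\<phi> (vertex (- 1) n (vertex (- 1) j f))) (vertex 1 (- 1 - n) (vertex (- 1) j f)))
      = Sum_any (\<lambda>n. (\<lambda>n. vertex (- 1) (j + 1) (?p n)) (n + 1))"
  proof (rule Sum_any.cong)
    fix n
    have 1: "vertex (- 1) n (vertex (- 1) j f) = - vertex (- 1) (j - 1) (vertex (- 1) (n + 1) f)"
      using vertex_anticommute[of "- 1" "n + 1" j f] by simp
    have e: "- 1 - (n + 1) = - 2 - n" by simp
    have 2: "vertex 1 (- 1 - n) (vertex (- 1) j f) = (if n + 1 = j then f else 0) - vertex (- 1) (j + 1) (vertex 1 (- 2 - n) f)"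
      using vertex_opposite[of 1 "- 2 - n" j f] by (auto simp: algebra_simps)
    have 3: "\<phi> (vertex (- 1) n (vertex (- 1) j f)) = - ?\<psi> (vertex (- 1) (n + 1) f)"
      unfolding 1 using linfun_diff[OF \<phi>, of 0] by (simp add: linfun_zero[OF \<phi>])
    \<comment> \<open>The anticommutator differs from a plain exchange only here, and its
      coefficient contains Y_(j-1) Y_j f = 0.\<close>
    have 4: "n + 1 = j \<Longrightarrow> ?\<psi> (vertex (- 1) (n + 1) f) = 0"
      using vertex_same[of "- 1" j f] by (simp add: linfun_zero[OF \<phi>])
    show "scale (\<phi> (vertex (- 1) n (vertex (- 1) j f))) (vertex 1 (- 1 - n) (vertex (- 1) j f)) =
        vertex (- 1) (j + 1) (?p (n + 1))"
      unfolding 2 3 e linop_scale[OF linop_vertex]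
      using 4 by (cases "n + 1 = j") (simp_all add: scale_minus_left scale_minus)
  qed
  also have "\<dots> = Sum_any (\<lambda>n. vertex (- 1) (j + 1) (?p n))" by (rule Sum_any_shift)
  also have "\<dots> = vertex (- 1) (j + 1) (Sum_any ?p)"
    by (rule linop_Sum_any[OF linop_vertex, symmetric]) (rule finite_vertex_pair[of ?\<psi>], rule linfun_zero[OF \<psi>])
  also have "Sum_any ?p = 0" using f \<psi> unfolding KP_bilinear_def by blast
  finally show "Sum_any (\<lambda>n. scale (\<phi> (vertex (- 1) n (vertex (- 1) j f))) (vertex 1 (- 1 - n) (vertex (- 1) j f))) = 0"
    by (simp only: linop_zero[OF linop_vertex])
qed

text \<open>Applying Y_(b+1) to the first factor, the delta term isolates f paired with g = Y_b f,
  and the exchanged terms are X_(-n) g paired with Y_n f. A functional with value 1 on g solves for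
  f, with coefficients a_j obtained from Y_(-j) f.\<close>

lemma KP_bilinear_split:
  assumes f: "KP_bilinear f" and g: "vertex (- 1) b f \<noteq> 0"
  obtains a where "bdd_coeffs a" "f = vertex_comb a (vertex (- 1) b f)"
proof -
  let ?g = "vertex (- 1) b f"
  obtain y where y: "Poly_Mapping.lookup ?g y \<noteq> 0"
    using g by (metis poly_mapping_eqI lookup_zero)
  define \<phi> where "\<phi> = (\<lambda>h. Poly_Mapping.lookup (scale (1 / Poly_Mapping.lookup ?g y) h) y)"
  have \<phi>: "linfun \<phi>" unfolding \<phi>_def by (rule linfun_comp[OF linfun_lookup linop_scale_op])
  have \<phi>g: "\<phi> ?g = 1" using y by (simp add: \<phi>_def)
  let ?a = "\<lambda>j. \<phi> (vertex (- 1) (- j) f)"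
  have bdd: "bdd_coeffs ?a"
  proof -
    obtain N where N: "\<forall>n<N. vertex (- 1) n f = 0" using vertex_bounded by blast
    have "\<forall>j>- N. ?a j = 0" using N by (simp add: linfun_zero[OF \<phi>])
    then show ?thesis unfolding bdd_coeffs_def by blast
  qed
  let ?p = "\<lambda>n. scale (\<phi> (vertex (- 1) n f)) (vertex 1 (- 1 - n) f)"
  let ?u = "\<lambda>n. scale (\<phi> (vertex (- 1) n f)) (if n = b then f else 0)"
  let ?v = "\<lambda>n. scale (?a (0 - n)) (vertex 1 (0 - n) ?g)"
  have "0 = vertex (- 1) (b + 1) (Sum_any ?p)"
    using f \<phi> by (simp add: KP_bilinear_def linop_zero[OF linop_vertex])
  also have "\<dots> = Sum_any (\<lambda>n. vertex (- 1) (b + 1) (?p n))"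
    by (rule linop_Sum_any[OF linop_vertex]) (rule finite_vertex_pair[of \<phi>], rule linfun_zero[OF \<phi>])
  also have "\<dots> = Sum_any (\<lambda>n. ?u n - ?v n)"
  proof (rule Sum_any.cong)
    fix n
    have "vertex (- 1) (b + 1) (vertex 1 (- 1 - n) f) = (if n = b then f else 0) - vertex 1 (0 - n) ?g"
      using vertex_opposite[of 1 "- 1 - n" b f] by (auto simp: algebra_simps)
    then show "vertex (- 1) (b + 1) (?p n) = ?u n - ?v n"
      by (simp add: linop_scale[OF linop_vertex] scale_diff)
  qed
  also have "\<dots> = Sum_any ?u - Sum_any ?v"
  proof (rule Sum_any_diff)
    show "finite {n. ?u n \<noteq> 0}" by (rule finite_subset[of _ "{b}"]) auto
    have "finite ((\<lambda>n. 0 - n) -` {j. scale (?a j) (vertex 1 j ?g) \<noteq> 0})"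
      by (rule finite_vimageI[OF finite_vertex_comb[OF bdd]]) (simp add: inj_def)
    then show "finite {n. ?v n \<noteq> 0}" by (simp only: vimage_def mem_Collect_eq)
  qed
  also have "Sum_any ?u = f"
    by (subst Sum_any.expand_superset[of "{b}"]) (auto simp: \<phi>g)
  also have "Sum_any ?v = vertex_comb ?a ?g"
    unfolding vertex_comb_def by (rule Sum_any_reflect[of "\<lambda>j. scale (?a j) (vertex 1 j ?g)"])
  finally have "f = vertex_comb ?a ?g" by simp
  with bdd show ?thesis by (rule that)
qed

section \<open>Every polynomial tau-function is a vertex operator product\<close>

text \<open>In Newton's recursion at k = n + 1 only the summand with the full derivation
  p_(n+1)^perp survives, so all partial derivatives of f vanish.\<close>

lemma constant_if_H_pow_perp_zero:
  assumes f: "\<And>k. k > 0 \<Longrightarrow> H_pow_perp 1 k f = 0"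
  obtains c where "f = scale c 1"
proof -
  have psum_perp: "psum_perp n f = 0" for n
  proof -
    have "0 = scale (of_int (int (Suc n))) (H_pow_perp 1 (int (Suc n)) f)" using f by simp
    also have "\<dots> = scale 1 (\<Sum>j<Suc n. psum_perp j (H_pow_perp 1 (int (Suc n) - 1 - int j) f))"
      by (rule newton_H_pow_perp) simp
    also have "\<dots> = psum_perp n f"
      by (simp add: f linop_zero[OF linop_psum_perp])
    finally show ?thesis by simp
  qed
  have "Poly_Mapping.lookup f a = 0" if "a \<noteq> 0" for a
  proof -
    obtain n where n: "Poly_Mapping.lookup a n \<noteq> 0"
    proof (rule ccontr)
      assume "\<not> thesis"
      with that have "Poly_Mapping.lookup a n = 0" for n by blast
      then have "a = 0" by (intro poly_mapping_eqI) simp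
      with \<open>a \<noteq> 0\<close> show False ..
    qed
    show ?thesis
    proof (rule monom_cases[of a n])
      fix b assume "a = unit_mon n + b"
      then show ?thesis using lookup_psum_perp[of n f b] psum_perp[of n] by (simp del: of_nat_mult of_nat_Suc mult_Suc)
    qed (use n in simp)
  qed
  then have "f = scale (Poly_Mapping.lookup f 0) 1"
    by (intro poly_mapping_eqI) (auto simp: lookup_one when_def)
  then show ?thesis by (rule that)
qed

text \<open>
  The coefficient of lowest order of \<open>E(-u) H\<^sup>\<bottom>(u) f\<close> is \<open>h\<^sub>d\<^sup>\<bottom> f\<close> for the largest \<open>d\<close> with
  \<open>h\<^sub>d\<^sup>\<bottom> f \<noteq> 0\<close>; it has smaller degree than \<open>f\<close> unless \<open>f\<close> is constant.
\<close>

lemma vertex_minus_lowest: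
  assumes "\<And>k. k > d \<Longrightarrow> H_pow_perp 1 k f = 0"
  shows "vertex (- 1) (- d) f = H_pow_perp 1 d f"
proof -
  have "vertex (- 1) (- d) f = Sum_any (\<lambda>k. if k = d then H_pow_perp 1 d f else 0)"
    unfolding vertex_def
  proof (rule Sum_any.cong)
    fix k
    show "H_pow (- 1) (- d + k) * H_pow_perp (- (- 1)) k f = (if k = d then H_pow_perp 1 d f else 0)"
      by (rule linorder_cases[of k d]) (simp_all add: assms)
  qed
  then show ?thesis by simp
qed

lemma KP_bilinear_factorization:
  assumes "KP_bilinear f" "f \<noteq> 0" "has_wt (\<lambda>d. d \<le> int N) f"
  shows "\<exists>as. as \<noteq> [] \<and> (\<forall>a\<in>set as. bdd_coeffs a) \<and> f = foldr vertex_comb as 1"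
  using assms
proof (induction N arbitrary: f rule: less_induct)
  case (less N)
  show ?case
  proof (cases "\<exists>k>0. H_pow_perp 1 k f \<noteq> 0")
    case False
    then obtain c where c: "f = scale c 1" using constant_if_H_pow_perp_zero by blast
    \<comment> \<open>Since X_0 1 = 1, the constant c is itself an operator applied to 1; this keeps
      the list of operators nonempty.\<close>
    let ?a = "\<lambda>j. if j = 0 then c else 0 :: complex"
    have "vertex_comb ?a 1 = Sum_any (\<lambda>j::int. if j = 0 then scale c 1 else 0)"
      unfolding vertex_comb_def by (rule Sum_any.cong) simp
    then have "f = foldr vertex_comb [?a] 1" by (simp add: c)
    moreover have "bdd_coeffs ?a" unfolding bdd_coeffs_def by (rule exI[of _ 0]) simp
    ultimately show ?thesis by (intro exI[of _ "[?a]"]) simp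
  next
    case True
    let ?K = "{k. H_pow_perp 1 k f \<noteq> 0}"
    define d where "d = Max ?K"
    have K: "finite ?K" "?K \<noteq> {}" using finite_H_pow_perp True by auto
    have d: "H_pow_perp 1 d f \<noteq> 0" using Max_in[OF K] by (simp add: d_def)
    have "d > 0" using True Max_ge[OF K(1)] by (fastforce simp: d_def)
    have "H_pow_perp 1 k f = 0" if "k > d" for k
      using Max_ge[OF K(1), of k] that by (auto simp: d_def)
    then have g: "vertex (- 1) (- d) f = H_pow_perp 1 d f" by (rule vertex_minus_lowest)
    have wt: "has_wt (\<lambda>e. e + d \<le> int N) (H_pow_perp 1 d f)"
      by (rule has_wt_H_pow_perp[OF less.prems(3)])
    have "d \<le> int N"
    proof -
      obtain y where "Poly_Mapping.lookup (H_pow_perp 1 d f) y \<noteq> 0"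
        using d by (metis poly_mapping_eqI lookup_zero)
      then have "wt y + d \<le> int N" using wt by (simp add: has_wt_def)
      then show ?thesis using wt_nonneg[of y] by linarith
    qed
    have "\<exists>as. as \<noteq> [] \<and> (\<forall>a\<in>set as. bdd_coeffs a) \<and> H_pow_perp 1 d f = foldr vertex_comb as 1"
    proof (rule less.IH[of "nat (int N - d)"])
      show "nat (int N - d) < N" using \<open>d > 0\<close> \<open>d \<le> int N\<close> by linarith
      show "KP_bilinear (H_pow_perp 1 d f)" using KP_bilinear_vertex_minus[OF less.prems(1), of "- d"] by (simp only: g)
      show "has_wt (\<lambda>e. e \<le> int (nat (int N - d))) (H_pow_perp 1 d f)"
        using wt \<open>d \<le> int N\<close> by (simp add: algebra_simps)
    qed (rule d)
    then obtain as where as: "\<forall>a\<in>set as. bdd_coeffs a" "H_pow_perp 1 d f = foldr vertex_comb as 1" by blast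
    obtain a where "bdd_coeffs a" "f = vertex_comb a (H_pow_perp 1 d f)"
      using KP_bilinear_split[OF less.prems(1), of "- d"] d by (auto simp: g)
    then show ?thesis using as by (intro exI[of _ "a # as"]) simp
  qed
qed

lemma ex_has_wt_bound: "\<exists>N. has_wt (\<lambda>d. d \<le> int N) f"
proof -
  have "wt a \<le> int (nat (Max (wt ` Poly_Mapping.keys f)))" if "Poly_Mapping.lookup f a \<noteq> 0" for a
  proof -
    have "wt a \<le> Max (wt ` Poly_Mapping.keys f)" using that by (intro Max_ge) (auto simp: in_keys_iff)
    then show ?thesis by simp
  qed
  then show ?thesis unfolding has_wt_def by blast
qed

lemma Gam_tilde_eq: "Gam_tilde A i f = vertex_comb (\<lambda>j. A i (- j)) f"
proof -
  have "Gam_tilde A i f = Sum_any (\<lambda>j. (\<lambda>j. scale (A i (- j)) (vertex 1 j f)) (0 - j))"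
    unfolding Gam_tilde_def by (rule Sum_any.cong) (simp add: Gam_eq)
  also have "\<dots> = vertex_comb (\<lambda>j. A i (- j)) f"
    unfolding vertex_comb_def by (rule Sum_any_reflect)
  finally show ?thesis .
qed

lemma row_finite_bdd_coeffs: "row_finite A \<Longrightarrow> bdd_coeffs (\<lambda>j. A i (- j))"
proof -
  assume "row_finite A"
  then obtain N where "\<forall>j<N. A i j = 0" by (auto simp: row_finite_def)
  then have "\<forall>j>- N. A i (- j) = 0" by simp
  then show ?thesis unfolding bdd_coeffs_def by blast
qed

lemma KP_bilinear_s_tilde: "row_finite A \<Longrightarrow> KP_bilinear (s_tilde A \<mu>)"
  unfolding s_tilde_def
  by (induction \<mu>) (simp_all add: KP_bilinear_one Gam_tilde_eq KP_bilinear_vertex_comb row_finite_bdd_coeffs)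

lemma KP_bilinear_imp_s_tilde:
  assumes "KP_bilinear f" "f \<noteq> 0"
  shows "\<exists>A \<mu>. row_finite A \<and> \<mu> \<noteq> [] \<and> f = s_tilde A \<mu>"
proof -
  obtain as where as: "as \<noteq> []" "\<forall>a\<in>set as. bdd_coeffs a" "f = foldr vertex_comb as 1"
    using KP_bilinear_factorization[OF assms] ex_has_wt_bound by blast
  \<comment> \<open>The i-th operator becomes the row -i, selected by the entry i of \<mu> = (0, 1,
    ..., l-1); all other rows are zero. The sign of j comes from \<Gamma>_j = X_(-j).\<close>
  define A where "A = (\<lambda>k j. if k \<le> 0 \<and> nat (- k) < length as then (as ! nat (- k)) (- j) else 0)"
  define \<mu> where "\<mu> = map int [0..<length as]"
  have "row_finite A"
    unfolding row_finite_def
  proof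
    fix k
    show "\<exists>N. \<forall>j<N. A k j = 0"
    proof (cases "k \<le> 0 \<and> nat (- k) < length as")
      case True
      then have "bdd_coeffs (as ! nat (- k))" using as(2) nth_mem by blast
      then obtain M where "\<forall>j>M. (as ! nat (- k)) j = 0" by (auto simp: bdd_coeffs_def)
      then have "\<forall>j<(- M). A k j = 0" by (simp add: A_def)
      then show ?thesis by blast
    qed (auto simp: A_def)
  qed
  moreover have "s_tilde A \<mu> = f"
  proof -
    have "s_tilde A \<mu> = foldr vertex_comb (map (\<lambda>i. as ! i) [0..<length as]) 1"
      unfolding s_tilde_def \<mu>_def foldr_map
      by (rule foldr_cong) (auto simp: Gam_tilde_eq A_def)
    then show ?thesis by (simp add: map_nth as(3))
  qed
  moreover have "\<mu> \<noteq> []" using as(1) by (simp add: \<mu>_def)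
  ultimately show ?thesis by blast
qed

section \<open>Expansions over integer vectors\<close>

definition int_lists :: "nat \<Rightarrow> int set \<Rightarrow> int list set" where
  "int_lists n S = {\<alpha>. set \<alpha> \<subseteq> S \<and> length \<alpha> = n}"

lemma finite_int_lists: "finite S \<Longrightarrow> finite (int_lists n S)"
  unfolding int_lists_def by (rule finite_lists_length_eq)

lemma int_lists_0 [simp]: "int_lists 0 S = {[]}"
  by (auto simp: int_lists_def)

lemma sum_int_lists_Suc:
  "(\<Sum>\<alpha>\<in>int_lists (Suc n) S. f \<alpha>) = (\<Sum>a\<in>S. \<Sum>\<alpha>\<in>int_lists n S. f (a # \<alpha>))"
proof -
  have "bij_betw (\<lambda>(a, \<alpha>). a # \<alpha>) (S \<times> int_lists n S) (int_lists (Suc n) S)"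
    by (rule bij_betwI[of _ _ _ "\<lambda>\<alpha>. (hd \<alpha>, tl \<alpha>)"]) (auto simp: int_lists_def length_Suc_conv)
  from sum.reindex_bij_betw[OF this, of f] show ?thesis
    by (simp add: sum.cartesian_product split_def)
qed

lemma schur_nonzero_nth: "schur \<alpha> \<noteq> 0 \<Longrightarrow> i < length \<alpha> \<Longrightarrow> - int (length \<alpha>) \<le> \<alpha> ! i"
  using schur_eq_zero[of i \<alpha>] by linarith

lemma s_tilde_term_Cons:
  "s_tilde_term A (k # \<mu>) (a # \<alpha>) = scale (A (- k) (- a)) (vertex 1 a (s_tilde_term A \<mu> \<alpha>))"
  unfolding s_tilde_term_def
  by (simp add: prod.lessThan_Suc_shift schur_Cons linop_scale[OF linop_vertex] del: prod.lessThan_Suc)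

lemma s_tilde_term_nonzero:
  assumes "s_tilde_term A \<mu> \<alpha> \<noteq> 0" "length \<alpha> = length \<mu>"
    and N: "\<forall>k\<in>set \<mu>. \<forall>a>N. A (- k) (- a) = 0"
  shows "\<alpha> \<in> int_lists (length \<mu>) {- int (length \<mu>)..N}"
proof -
  have s: "schur \<alpha> \<noteq> 0" and A: "\<And>i. i < length \<mu> \<Longrightarrow> A (- (\<mu> ! i)) (- (\<alpha> ! i)) \<noteq> 0"
    using assms(1) by (auto simp: s_tilde_term_def)
  have "\<alpha> ! i \<in> {- int (length \<mu>)..N}" if "i < length \<alpha>" for i
    using schur_nonzero_nth[OF s that] A[of i] N that assms(2) nth_mem[of i \<mu>] by force
  then show ?thesis using assms(2) by (auto simp: int_lists_def in_set_conv_nth)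
qed

text \<open>L is kept separate from the length so that one box serves all tails of \<mu> in the
  induction. A leading index below -L contributes nothing because the first row of the determinant
  is zero.\<close>

lemma s_tilde_eq_sum:
  assumes "length \<mu> \<le> L" and "\<forall>k\<in>set \<mu>. \<forall>a>N. A (- k) (- a) = 0"
  shows "s_tilde A \<mu> = (\<Sum>\<alpha>\<in>int_lists (length \<mu>) {- int L..N}. s_tilde_term A \<mu> \<alpha>)"
  using assms
proof (induction \<mu>)
  case Nil
  then show ?case by (simp add: s_tilde_def s_tilde_term_def schur_eq)
next
  case (Cons k \<mu>)
  let ?S = "{- int L..N}" and ?n = "length \<mu>"
  have IH: "s_tilde A \<mu> = (\<Sum>\<alpha>\<in>int_lists ?n ?S. s_tilde_term A \<mu> \<alpha>)"
    using Cons by simp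
  have vertex: "vertex 1 a (s_tilde A \<mu>) = (\<Sum>\<alpha>\<in>int_lists ?n ?S. vertex 1 a (s_tilde_term A \<mu> \<alpha>))" for a
    unfolding IH by (rule linop_sum[OF linop_vertex])
  have "s_tilde A (k # \<mu>) = Sum_any (\<lambda>a. scale (A (- k) (- a)) (vertex 1 a (s_tilde A \<mu>)))"
    by (simp add: s_tilde_def Gam_tilde_eq vertex_comb_def)
  also have "\<dots> = (\<Sum>a\<in>?S. scale (A (- k) (- a)) (vertex 1 a (s_tilde A \<mu>)))"
  proof (rule Sum_any_between)
    fix a assume a: "a < - int L"
    have "vertex 1 a (s_tilde_term A \<mu> \<alpha>) = 0" if "\<alpha> \<in> int_lists ?n ?S" for \<alpha>
    proof -
      have "schur (a # \<alpha>) = 0"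
        using schur_eq_zero[of 0 "a # \<alpha>"] that a Cons.prems(1) by (simp add: int_lists_def)
      then show ?thesis by (simp add: s_tilde_term_def linop_scale[OF linop_vertex] schur_Cons)
    qed
    then show "scale (A (- k) (- a)) (vertex 1 a (s_tilde A \<mu>)) = 0" by (simp add: vertex)
  qed (use Cons.prems in simp)
  also have "\<dots> = (\<Sum>a\<in>?S. \<Sum>\<alpha>\<in>int_lists ?n ?S. s_tilde_term A (k # \<mu>) (a # \<alpha>))"
    by (simp only: vertex scale_sum s_tilde_term_Cons)
  also have "\<dots> = (\<Sum>\<alpha>\<in>int_lists (length (k # \<mu>)) ?S. s_tilde_term A (k # \<mu>) \<alpha>)"
    by (simp only: length_Cons sum_int_lists_Suc)
  finally show ?case .
qed

lemma row_finite_uniform: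
  assumes "row_finite A"
  obtains N where "\<forall>k\<in>set \<mu>. \<forall>a>N. A (- k) (- a) = 0"
proof -
  have "\<exists>N. \<forall>k\<in>set \<mu>. \<forall>a>N. A (- k) (- a) = 0"
  proof (induction \<mu>)
    case (Cons k \<mu>)
    then obtain N where N: "\<forall>k\<in>set \<mu>. \<forall>a>N. A (- k) (- a) = 0" by blast
    obtain M where M: "\<forall>j<M. A (- k) j = 0" using assms by (auto simp: row_finite_def)
    have "\<forall>k'\<in>set (k # \<mu>). \<forall>a>max N (- M). A (- k') (- a) = 0"
      using N M by auto
    then show ?case by blast
  qed simp
  then show ?thesis using that by blast
qed

lemma s_tilde_expansion:
  assumes "row_finite A"
  shows "finite {\<alpha>. length \<alpha> = length \<mu> \<and> s_tilde_term A \<mu> \<alpha> \<noteq> 0}" (is "finite ?Z")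
    and "s_tilde A \<mu> = Sum_any (\<lambda>\<alpha>. if length \<alpha> = length \<mu> then s_tilde_term A \<mu> \<alpha> else 0)"
proof -
  obtain N where N: "\<forall>k\<in>set \<mu>. \<forall>a>N. A (- k) (- a) = 0"
    using row_finite_uniform[OF assms] by blast
  let ?I = "int_lists (length \<mu>) {- int (length \<mu>)..N}"
  have sub: "?Z \<subseteq> ?I" using s_tilde_term_nonzero[OF _ _ N] by blast
  then show "finite ?Z" by (rule finite_subset) (simp add: finite_int_lists)
  have "Sum_any (\<lambda>\<alpha>. if length \<alpha> = length \<mu> then s_tilde_term A \<mu> \<alpha> else 0)
      = (\<Sum>\<alpha>\<in>?I. if length \<alpha> = length \<mu> then s_tilde_term A \<mu> \<alpha> else 0)"
    by (rule Sum_any.expand_superset) (use sub in \<open>auto simp: finite_int_lists split: if_splits\<close>)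
  also have "\<dots> = (\<Sum>\<alpha>\<in>?I. s_tilde_term A \<mu> \<alpha>)"
    by (intro sum.cong refl) (auto simp: int_lists_def)
  also have "\<dots> = s_tilde A \<mu>"
    by (rule s_tilde_eq_sum[OF order.refl N, symmetric])
  finally show "s_tilde A \<mu> = Sum_any (\<lambda>\<alpha>. if length \<alpha> = length \<mu> then s_tilde_term A \<mu> \<alpha> else 0)" ..
qed

lemma sum_list_lower_bound:
  fixes L :: int
  assumes "\<forall>b\<in>set \<beta>. - L \<le> b"
  shows "- L * int (length \<beta>) \<le> sum_list \<beta>"
  using assms by (induction \<beta>) (auto simp: algebra_simps)

lemma sum_list_upper_bound:
  fixes L :: int
  assumes "\<forall>b\<in>set \<beta>. - L \<le> b" "b \<in> set \<beta>" "L \<ge> 0"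
  shows "b \<le> sum_list \<beta> + L * int (length \<beta>)"
  using assms
proof (induction \<beta>)
  case (Cons a \<beta>)
  show ?case
  proof (cases "b = a")
    case True
    then show ?thesis using sum_list_lower_bound[of \<beta> L] Cons.prems by (simp add: algebra_simps)
  next
    case False
    then have "b \<le> sum_list \<beta> + L * int (length \<beta>)" using Cons by simp
    then show ?thesis using Cons.prems by (simp add: algebra_simps)
  qed
qed simp

text \<open>The l entries are at least -l and sum to the degree of the monomial x, so none exceeds
  that degree by more than l * l.\<close>

lemma lookup_schur_nonzero:
  assumes "Poly_Mapping.lookup (schur \<beta>) x \<noteq> 0"
  shows "\<beta> \<in> int_lists (length \<beta>) {- int (length \<beta>)..wt x + int (length \<beta>) * int (length \<beta>)}"
proof -
  have s: "schur \<beta> \<noteq> 0" using assms by auto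
  have low: "\<forall>b\<in>set \<beta>. - int (length \<beta>) \<le> b"
    using schur_nonzero_nth[OF s] by (auto simp: in_set_conv_nth)
  have "wt x = sum_list \<beta>"
    using has_wt_schur[of \<beta>] assms by (simp add: has_wt_def)
  then show ?thesis
    using low sum_list_upper_bound[OF low] by (auto simp: int_lists_def)
qed

text \<open>Unlike in \<open>s_tilde_eq_sum\<close>, the range of summation depends neither on A nor
  on \<mu>; this allows the interchange with an infinite sum over \<mu>.\<close>

lemma lookup_s_tilde:
  assumes A: "row_finite A" and \<mu>: "length \<mu> = l"
  shows "Poly_Mapping.lookup (s_tilde A \<mu>) x =
    (\<Sum>\<beta>\<in>int_lists l {- int l..wt x + int l * int l}.
       (\<Prod>i<l. A (- (\<mu> ! i)) (- (\<beta> ! i))) * Poly_Mapping.lookup (schur \<beta>) x)"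
proof -
  let ?I = "int_lists l {- int l..wt x + int l * int l}"
  let ?t = "\<lambda>\<alpha>. if length \<alpha> = length \<mu> then s_tilde_term A \<mu> \<alpha> else 0"
  have "{\<alpha>. ?t \<alpha> \<noteq> 0} = {\<alpha>. length \<alpha> = length \<mu> \<and> s_tilde_term A \<mu> \<alpha> \<noteq> 0}" by auto
  then have fin: "finite {\<alpha>. ?t \<alpha> \<noteq> 0}" by (simp only: s_tilde_expansion(1)[OF A])
  have "Poly_Mapping.lookup (s_tilde A \<mu>) x = Sum_any (\<lambda>\<alpha>. Poly_Mapping.lookup (?t \<alpha>) x)"
    unfolding s_tilde_expansion(2)[OF A] by (rule linfun_Sum_any[OF linfun_lookup fin])
  also have "\<dots> = (\<Sum>\<alpha>\<in>?I. Poly_Mapping.lookup (?t \<alpha>) x)"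
  proof (rule Sum_any.expand_superset)
    show "{\<alpha>. Poly_Mapping.lookup (?t \<alpha>) x \<noteq> 0} \<subseteq> ?I"
    proof
      fix \<alpha> assume "\<alpha> \<in> {\<alpha>. Poly_Mapping.lookup (?t \<alpha>) x \<noteq> 0}"
      then have "Poly_Mapping.lookup (schur \<alpha>) x \<noteq> 0" "length \<alpha> = l"
        using \<mu> by (auto simp: s_tilde_term_def split: if_splits)
      with lookup_schur_nonzero[of \<alpha> x] show "\<alpha> \<in> ?I" by simp
    qed
  qed (simp add: finite_int_lists)
  also have "\<dots> = (\<Sum>\<beta>\<in>?I. (\<Prod>i<l. A (- (\<mu> ! i)) (- (\<beta> ! i))) * Poly_Mapping.lookup (schur \<beta>) x)"
    by (intro sum.cong refl) (simp add: int_lists_def s_tilde_term_def \<mu>)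
  finally show ?thesis .
qed

section \<open>Unconditional sums of products\<close>

text \<open>Unconditional summability of complex families is absolute summability, which passes to
  products and justifies the iterated sum.\<close>

lemma has_sum_times:
  fixes f :: "'a \<Rightarrow> complex" and g :: "'b \<Rightarrow> complex"
  assumes f: "(f has_sum a) A" and g: "(g has_sum b) B"
  shows "((\<lambda>(x, y). f x * g y) has_sum a * b) (A \<times> B)"
proof (rule has_sum_SigmaI)
  show "((\<lambda>y. case (x, y) of (x, y) \<Rightarrow> f x * g y) has_sum f x * b) B" for x
    using has_sum_cmult_right[OF g, of "f x"] by simp
  show "((\<lambda>x. f x * b) has_sum a * b) A"
    by (rule has_sum_cmult_left[OF f])
  have f': "f abs_summable_on A" and g': "g abs_summable_on B"
    using f g by (simp_all add: has_sum_imp_summable summable_on_iff_abs_summable_on_complex[symmetric])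
  have "(\<lambda>(x, y). f x * g y) abs_summable_on (A \<times> B)"
    unfolding abs_summable_on_Sigma_iff
  proof (intro conjI ballI)
    show "(\<lambda>y. case (x, y) of (x, y) \<Rightarrow> f x * g y) abs_summable_on B" for x
      using summable_on_cmult_right[OF g', of "norm (f x)"] by (simp add: norm_mult)
    have "(\<lambda>x. norm (f x) * infsum (\<lambda>y. norm (g y)) B) summable_on A"
      by (rule summable_on_cmult_left[OF f'])
    then show "(\<lambda>x. \<Sum>\<^sub>\<infinity>y\<in>B. norm (case (x, y) of (x, y) \<Rightarrow> f x * g y)) abs_summable_on A"
      by (simp add: norm_mult infsum_cmult_right' abs_mult infsum_nonneg)
  qed
  then show "(\<lambda>(x, y). f x * g y) summable_on A \<times> B"
    by (rule abs_summable_summable)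
qed

lemma has_sum_prod_lists:
  fixes f :: "nat \<Rightarrow> int \<Rightarrow> complex"
  assumes "\<And>i. i < l \<Longrightarrow> (f i has_sum s i) UNIV"
  shows "((\<lambda>\<mu>. \<Prod>i<l. f i (\<mu> ! i)) has_sum (\<Prod>i<l. s i)) {\<mu>. length \<mu> = l}"
  using assms
proof (induction l arbitrary: f s)
  case 0
  then show ?case by (simp add: has_sum_finite_iff)
next
  case (Suc l)
  have bij: "bij_betw (\<lambda>(a, \<mu>). a # \<mu>) (UNIV \<times> {\<mu>::int list. length \<mu> = l}) {\<mu>. length \<mu> = Suc l}"
    by (rule bij_betwI[of _ _ _ "\<lambda>\<alpha>. (hd \<alpha>, tl \<alpha>)"]) (auto simp: length_Suc_conv)
  have "((\<lambda>\<mu>. \<Prod>i<l. f (Suc i) (\<mu> ! i)) has_sum (\<Prod>i<l. s (Suc i))) {\<mu>. length \<mu> = l}"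
    by (rule Suc.IH) (simp add: Suc.prems)
  from has_sum_times[OF Suc.prems[of 0] this]
  have "((\<lambda>(a, \<mu>). f 0 a * (\<Prod>i<l. f (Suc i) (\<mu> ! i))) has_sum (\<Prod>i<Suc l. s i)) (UNIV \<times> {\<mu>. length \<mu> = l})"
    by (simp add: prod.lessThan_Suc_shift del: prod.lessThan_Suc)
  also have "(\<lambda>(a, \<mu>). f 0 a * (\<Prod>i<l. f (Suc i) (\<mu> ! i)))
      = (\<lambda>p. (\<lambda>\<mu>. \<Prod>i<Suc l. f i (\<mu> ! i)) ((\<lambda>(a, \<mu>). a # \<mu>) p))"
    by (auto simp: fun_eq_iff prod.lessThan_Suc_shift simp del: prod.lessThan_Suc)
  finally show ?case
    by (rule has_sum_reindex_bij_betw[OF bij, THEN iffD1])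
qed

lemma has_sum_finite_sum:
  fixes f :: "'i \<Rightarrow> 'a \<Rightarrow> complex"
  assumes "finite I" "\<And>i. i \<in> I \<Longrightarrow> (f i has_sum s i) A"
  shows "((\<lambda>x. \<Sum>i\<in>I. f i x) has_sum (\<Sum>i\<in>I. s i)) A"
  using assms by (induction I rule: finite_induct) (auto intro: has_sum_0 has_sum_add)

text \<open>For a fixed monomial the sum over \<beta> is finite. The sum over \<mu> then factors
  into l sums over integers, the i-th of which is the entry of B A at (-\<alpha>_i, -\<beta>_i),
  leaving only \<beta> = \<alpha>.\<close>

lemma has_reexpansion_left_inverse:
  assumes A: "row_finite A" and BA: "left_inverse B A"
  shows "has_reexpansion A B l"
  unfolding has_reexpansion_def
proof (intro allI impI conjI)
  fix \<alpha> :: "int list" and x assume \<alpha>: "length \<alpha> = l"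
  let ?I = "int_lists l {- int l..wt x + int l * int l}"
  let ?f = "\<lambda>\<beta> i k. B (- (\<alpha> ! i)) (- k) * A (- k) (- (\<beta> ! i))"
  let ?L = "\<lambda>\<beta>. Poly_Mapping.lookup (schur \<beta>) x"
  have I: "finite ?I" by (simp add: finite_int_lists)
  have term_eq: "Poly_Mapping.lookup (reexp_term A B \<alpha> \<mu>) x = (\<Sum>\<beta>\<in>?I. ?L \<beta> * (\<Prod>i<l. ?f \<beta> i (\<mu> ! i)))"
    if "length \<mu> = l" for \<mu>
    by (simp add: reexp_term_def g_coeff_def \<alpha> lookup_s_tilde[OF A that] sum_distrib_left prod.distrib mult_ac)
  have sum_f: "(?f \<beta> i has_sum (if \<alpha> ! i = \<beta> ! i then 1 else 0)) UNIV" for \<beta> i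
  proof -
    have "bij_betw (uminus :: int \<Rightarrow> int) UNIV UNIV"
      by (rule bij_betwI[of _ _ _ uminus]) auto
    moreover have "((\<lambda>k. B (- (\<alpha> ! i)) k * A k (- (\<beta> ! i))) has_sum (if - (\<alpha> ! i) = - (\<beta> ! i) then 1 else 0)) UNIV"
      using BA unfolding left_inverse_def by blast
    ultimately show ?thesis
      using has_sum_reindex_bij_betw[of uminus UNIV UNIV "\<lambda>k. B (- (\<alpha> ! i)) k * A k (- (\<beta> ! i))"]
      by (simp only: neg_equal_iff_equal)
  qed
  have delta: "(\<Prod>i<l. if \<alpha> ! i = \<beta> ! i then 1 else 0) = (if \<beta> = \<alpha> then 1 else (0::complex))"
    if "\<beta> \<in> ?I" for \<beta>
  proof (cases "\<beta> = \<alpha>")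
    case False
    with that \<alpha> obtain i where "i < l" "\<alpha> ! i \<noteq> \<beta> ! i"
      by (auto simp: int_lists_def list_eq_iff_nth_eq)
    with False show ?thesis by (auto intro!: prod_zero)
  qed simp
  have "((\<lambda>\<mu>. \<Sum>\<beta>\<in>?I. ?L \<beta> * (\<Prod>i<l. ?f \<beta> i (\<mu> ! i))) has_sum
      (\<Sum>\<beta>\<in>?I. ?L \<beta> * (\<Prod>i<l. if \<alpha> ! i = \<beta> ! i then 1 else 0))) {\<mu>. length \<mu> = l}"
    by (intro has_sum_finite_sum I has_sum_cmult_right has_sum_prod_lists sum_f)
  also have "(\<Sum>\<beta>\<in>?I. ?L \<beta> * (\<Prod>i<l. if \<alpha> ! i = \<beta> ! i then 1 else 0)) = (\<Sum>\<beta>\<in>?I. if \<beta> = \<alpha> then ?L \<alpha> else 0)"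
    by (intro sum.cong refl) (auto simp: delta)
  \<comment> \<open>If \<alpha> lies outside the box, both sides are 0, because the coefficient of x
    in \<open>schur \<alpha>\<close> vanishes.\<close>
  also have "\<dots> = ?L \<alpha>"
    using I lookup_schur_nonzero[of \<alpha> x] \<alpha> by auto
  finally show "((\<lambda>\<mu>. Poly_Mapping.lookup (reexp_term A B \<alpha> \<mu>) x) has_sum Poly_Mapping.lookup (S_coeff \<alpha>) x) {\<mu>. length \<mu> = l}"
    unfolding S_coeff_eq by (rule has_sum_cong[THEN iffD2, rotated]) (simp add: term_eq)
  assume fin: "\<forall>i j. finite {k. B i k * A k j \<noteq> 0}"
  \<comment> \<open>A nonzero term needs some \<beta> in the box for which every entry of \<mu> lies
    in the support of one of the l products, and these supports are finite.\<close>
  have "{\<mu>. length \<mu> = l \<and> Poly_Mapping.lookup (reexp_term A B \<alpha> \<mu>) x \<noteq> 0}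
      \<subseteq> (\<Union>\<beta>\<in>?I. int_lists l (\<Union>i<l. {k. ?f \<beta> i k \<noteq> 0}))"
  proof
    fix \<mu> assume \<mu>: "\<mu> \<in> {\<mu>. length \<mu> = l \<and> Poly_Mapping.lookup (reexp_term A B \<alpha> \<mu>) x \<noteq> 0}"
    then have "length \<mu> = l" "Poly_Mapping.lookup (reexp_term A B \<alpha> \<mu>) x \<noteq> 0" by auto
    then have "(\<Sum>\<beta>\<in>?I. ?L \<beta> * (\<Prod>i<l. ?f \<beta> i (\<mu> ! i))) \<noteq> 0" by (simp only: term_eq) simp
    then obtain \<beta> where \<beta>: "\<beta> \<in> ?I" "(\<Prod>i<l. ?f \<beta> i (\<mu> ! i)) \<noteq> 0"
      by (metis (no_types, lifting) mult_zero_right sum.neutral)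
    then have "\<And>i. i < l \<Longrightarrow> ?f \<beta> i (\<mu> ! i) \<noteq> 0" by simp
    then have "\<mu> \<in> int_lists l (\<Union>i<l. {k. ?f \<beta> i k \<noteq> 0})"
      using \<mu> by (fastforce simp: int_lists_def in_set_conv_nth)
    with \<beta>(1) show "\<mu> \<in> (\<Union>\<beta>\<in>?I. int_lists l (\<Union>i<l. {k. ?f \<beta> i k \<noteq> 0}))" by blast
  qed
  moreover have "finite {k. ?f \<beta> i k \<noteq> 0}" for \<beta> i
  proof -
    have "finite (uminus -` {k. B (- (\<alpha> ! i)) k * A k (- (\<beta> ! i)) \<noteq> 0})"
      using fin by (intro finite_vimageI) auto
    then show ?thesis by (simp only: vimage_def mem_Collect_eq)
  qed
  ultimately show "finite {\<mu>. length \<mu> = l \<and> Poly_Mapping.lookup (reexp_term A B \<alpha> \<mu>) x \<noteq> 0}"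
    by (elim finite_subset) (intro finite_UN_I I finite_int_lists finite_lessThan)
qed

theorem theorem6p1:
  fixes m :: int
  shows
    "(\<forall>A \<mu>. row_finite A \<longrightarrow>
        finite {\<alpha>. length \<alpha> = length \<mu> \<and> s_tilde_term A \<mu> \<alpha> \<noteq> 0} \<and>
        s_tilde A \<mu> = Sum_any (\<lambda>\<alpha>. if length \<alpha> = length \<mu> then s_tilde_term A \<mu> \<alpha> else 0) \<and>
        (s_tilde A \<mu> \<noteq> 0 \<longrightarrow> KP_tau (z_pow m (s_tilde A \<mu>)))) \<and>
     (\<forall>\<tau>. KP_tau (z_pow m \<tau>) \<longrightarrow>
        (\<exists>A \<mu>. row_finite A \<and> \<mu> \<noteq> [] \<and> \<tau> = s_tilde A \<mu>)) \<and>
     (\<forall>A B l. row_finite A \<and> left_inverse B A \<longrightarrow>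
        has_reexpansion A B l \<and>
        (\<forall>\<mu>. length \<mu> = l \<and> s_tilde A \<mu> \<noteq> 0 \<longrightarrow> KP_tau (z_pow m (s_tilde A \<mu>))))"
proof (intro conjI allI impI)
  fix A :: "int \<Rightarrow> int \<Rightarrow> complex" and \<mu> assume A: "row_finite A"
  show "finite {\<alpha>. length \<alpha> = length \<mu> \<and> s_tilde_term A \<mu> \<alpha> \<noteq> 0}"
    "s_tilde A \<mu> = Sum_any (\<lambda>\<alpha>. if length \<alpha> = length \<mu> then s_tilde_term A \<mu> \<alpha> else 0)"
    by (rule s_tilde_expansion[OF A])+
  show "s_tilde A \<mu> \<noteq> 0 \<Longrightarrow> KP_tau (z_pow m (s_tilde A \<mu>))"
    by (simp add: KP_tau_iff KP_bilinear_s_tilde[OF A])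
next
  fix \<tau> assume "KP_tau (z_pow m \<tau>)"
  then show "\<exists>A \<mu>. row_finite A \<and> \<mu> \<noteq> [] \<and> \<tau> = s_tilde A \<mu>"
    using KP_bilinear_imp_s_tilde unfolding KP_tau_iff by blast
next
  fix A B :: "int \<Rightarrow> int \<Rightarrow> complex" and l
  assume AB: "row_finite A \<and> left_inverse B A"
  then show "has_reexpansion A B l" by (simp add: has_reexpansion_left_inverse)
  fix \<mu> assume "length \<mu> = l \<and> s_tilde A \<mu> \<noteq> 0"
  with AB show "KP_tau (z_pow m (s_tilde A \<mu>))"
    by (simp add: KP_tau_iff KP_bilinear_s_tilde)
qed

end
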